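(* Let $X=(W_X,Q_X,\pi_X,I_X)$ be an object of $\mathscr D$ such that $W_X$ is the Weyl group of type $A_n$ and $\Gamma_X$ is the Dynkin quiver of type $A_n$ (the underlying graph of $\Gamma_X$ is the Dynkin diagram $A_n$). Then there is an isomorphism of algebras $\psi_X:\mathcal H(\mathcal S_X)\to U(\mathfrak n_+)$.
   Context: $k$ is a field containing $\mathbb Z$; algebras are over $k$. $U(\mathfrak n_+)$ is the universal enveloping algebra of the positive nilpotent part $\mathfrak n_+$ in the triangular decomposition of the Lie algebra $\mathfrak g=\mathfrak{sl}_{n+1}$ of type $A_n$. Quadruples. For a Coxeter group $W$ of finite rank with simple reflections $s_1,\dots,s_n$, let $V$ be the real vector space with basis the simple roots $\alpha_1,\dots,\alpha_n$, with the form $\langle\alpha_i,\alpha_j\rangle=-\cos(\pi/\operatorname{ord}(s_is_j))$ and the usual geometric action of $W$. Write $[m]=\{1,\dots,m\}$. For a word $Q=s_{i_1}\cdots s_{i_m}$ and $\pi\in W$, the subword complex $\mathcal{SC}_W(Q,\pi)$ has as faces the subsets $I\subseteq[m]$ such that the subword of $Q$ at positions $[m]\setminus I$ contains a reduced expression of $\pi$. A quadruple is $X=(W,Q,\pi,I)$ with $I$ a maximal face of $\mathcal{SC}_W(Q,\pi)$. The root function is $r(l)=\big(\prod_{j\in[l-1]\setminus I}s_{i_j}\big)(\alpha_{i_l})$, $l\in[m]$ (product in increasing order of $j$). $X$ is irreducible if $\{r(i)\}_{i\in I}$ spans $V$; it is moreover root independent if $\{r(i)\}_{i\in I}$ is a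 basis of $V$. The objects of $\mathscr D$ are the root independent irreducible quadruples. Root configuration quiver. $\Gamma_X$ has vertex set (labelled by) $I$, and there is a (single) arrow $i\to j$ if and only if $(i-j)\cdot\langle r(i),r(j)\rangle>0$. The subobjects of $X$ are indexed by subsets $J\subseteq I$; the subobject $X(J)$ has root configuration quiver $\Gamma_{X(J)}$, identified with the full subquiver of $\Gamma_X$ on $J$. $\mathcal S_X$: objects are finite disjoint unions $\bigsqcup_{i=1}^t\Gamma_{X(J_i)}$ of labelled quivers, $J_i\subseteq I$ (repetitions allowed); morphisms $A\to B$ are label-preserving partial isomorphisms, i.e. diagrams $A\hookleftarrow P\hookrightarrow B$ given by an $I$-labelled quiver $P$ identified, preserving labels, with a (full) subquiver of $A$ and of $B$; composition is by intersection in the middle object. Proto-exact structure (for $\Gamma_X$ a tree). For $a,b\in I$ put $a\preceq b$ iff there is a path from $b$ to $a$ in $\Gamma_X$. For $J\subseteq H\subseteq I$, $\Gamma_{X(J)}\hookleftarrow\Gamma_{X(J)}\hookrightarrow\Gamma_{X(H)}$ is a basic admissible monomorphism iff $\{b\in H\mid b\preceq a\}\subseteq J$ for all $a\in J$; for $K\subseteq H$, $\Gamma_{X(H)}\hookleftarrow\Gamma_{X(K)}\hookrightarrow\Gamma_{X(K)}$ is a basic admissible epimorphism iff $\{b\in H\mid a\preceq b\}\subseteq K$ for all $a\in K$. Admissible monomorphisms (epimorphisms) are finite disjoint unions of basic ones. An admissible proto-exact sequence $A\to B\to C$ is an admissible monomorphism $A\to B$ and an admissible epimorphism $B\to C$ forming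 with $A\to0\to C$ a biCartesian square. $\operatorname{Ext}_{\mathcal S_X}(C,A)_B$ is the set of equivalence classes (isomorphism of middle terms inducing identities on $A$ and $C$) of admissible proto-exact sequences $A\to B'\to C$ with $B'\cong B$. $\mathcal H(\mathcal S_X)$ is the $k$-vector space on isomorphism classes of objects of $\mathcal S_X$ with product $[\Gamma_1]\cdot[\Gamma_2]=\sum_{K}|\operatorname{Ext}_{\mathcal S_X}(\Gamma_2,\Gamma_1)_K|\,[K]$, $K$ over isomorphism classes. *)

theory Defs
  imports
    "HOL-Analysis.Analysis"
    "HOL-Algebra.Multiplicative_Group"
    "HOL-Algebra.QuotRing"
    "HOL-Library.Sublist"
    "Jordan_Normal_Form.Matrix"
begin

section \<open>Coxeter systems\<close>

text \<open>Simple reflections are indexed by a finite type, so that the rank is its cardinality.\<close>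

definition word_prod :: "'g monoid \<Rightarrow> ('n \<Rightarrow> 'g) \<Rightarrow> 'n list \<Rightarrow> 'g" where
  "word_prod W s u = foldr (\<lambda>i w. s i \<otimes>\<^bsub>W\<^esub> w) u \<one>\<^bsub>W\<^esub>"

definition coxeter_matrix :: "'g monoid \<Rightarrow> ('n \<Rightarrow> 'g) \<Rightarrow> 'n \<Rightarrow> 'n \<Rightarrow> nat" where
  "coxeter_matrix W s i j = group.ord W (s i \<otimes>\<^bsub>W\<^esub> s j)"

text \<open>
  Equality of words in the group presented by \<open>(s\<^sub>i s\<^sub>j)^(m i j) = 1\<close>. The entry 0
  stands for infinite order and yields the trivial relation, in accordance with
  the convention of \<open>group.ord\<close>. Only words in the generators occur, since the
  diagonal entries are 1 and so the generators are their own inverses.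
\<close>
inductive coxeter_eq :: "('n \<Rightarrow> 'n \<Rightarrow> nat) \<Rightarrow> 'n list \<Rightarrow> 'n list \<Rightarrow> bool"
  for m :: "'n \<Rightarrow> 'n \<Rightarrow> nat" where
  rel: "coxeter_eq m (u @ concat (replicate (m i j) [i, j]) @ v) (u @ v)"
| refl: "coxeter_eq m u u"
| sym: "coxeter_eq m u v \<Longrightarrow> coxeter_eq m v u"
| trans: "coxeter_eq m u v \<Longrightarrow> coxeter_eq m v w \<Longrightarrow> coxeter_eq m u w"

definition coxeter_system :: "'g monoid \<Rightarrow> ('n::finite \<Rightarrow> 'g) \<Rightarrow> bool" where
  "coxeter_system W s \<longleftrightarrow>
     group W \<and> inj s \<and> range s \<subseteq> carrier W \<and>
     (\<forall>i. s i \<otimes>\<^bsub>W\<^esub> s i = \<one>\<^bsub>W\<^esub>) \<and>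
     carrier W = range (word_prod W s) \<and>
     (\<forall>u v. word_prod W s u = word_prod W s v \<longleftrightarrow> coxeter_eq (coxeter_matrix W s) u v)"

definition adjacent_A :: "nat \<Rightarrow> nat \<Rightarrow> bool" where
  "adjacent_A a b \<longleftrightarrow> a = Suc b \<or> b = Suc a"

definition weyl_type_A :: "nat \<Rightarrow> 'g monoid \<Rightarrow> ('n::finite \<Rightarrow> 'g) \<Rightarrow> bool" where
  "weyl_type_A n W s \<longleftrightarrow> coxeter_system W s \<and>
     (\<exists>\<sigma>. bij_betw \<sigma> UNIV {1..n} \<and>
        (\<forall>i j. coxeter_matrix W s i j =
                 (if i = j then 1 else if adjacent_A (\<sigma> i) (\<sigma> j) then 3 else 2)))"

text \<open>
  The geometric representation on \<open>real ^ 'n\<close>; the simple root \<open>\<alpha>\<^sub>i\<close> is \<open>axis i 1\<close>. For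
  infinite order the entry of the form is \<open>- cos (pi / 0) = - cos 0 = - 1\<close>, as usual.
\<close>
definition geo_form ::
    "'g monoid \<Rightarrow> ('n::finite \<Rightarrow> 'g) \<Rightarrow> real ^ 'n \<Rightarrow> real ^ 'n \<Rightarrow> real" where
  "geo_form W s v w =
     (\<Sum>i\<in>UNIV. \<Sum>j\<in>UNIV. vec_nth v i * vec_nth w j *
        (- cos (pi / real (coxeter_matrix W s i j))))"

definition geo_refl ::
    "'g monoid \<Rightarrow> ('n::finite \<Rightarrow> 'g) \<Rightarrow> 'n \<Rightarrow> real ^ 'n \<Rightarrow> real ^ 'n" where
  "geo_refl W s i v = v - (2 * geo_form W s (axis i 1) v) *\<^sub>R axis i 1"


section \<open>Subword complexes and root independent quadruples\<close>

text \<open>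
  Positions of words are counted from 0, so \<open>[m]\<close> becomes \<open>{..<length Q}\<close>.
\<close>

definition reduced_expression :: "'g monoid \<Rightarrow> ('n \<Rightarrow> 'g) \<Rightarrow> 'n list \<Rightarrow> 'g \<Rightarrow> bool" where
  "reduced_expression W s u w \<longleftrightarrow>
     word_prod W s u = w \<and> (\<forall>v. word_prod W s v = w \<longrightarrow> length u \<le> length v)"

definition subword_complex ::
    "'g monoid \<Rightarrow> ('n \<Rightarrow> 'g) \<Rightarrow> 'n list \<Rightarrow> 'g \<Rightarrow> nat set set" where
  "subword_complex W s Q w =
     {F. F \<subseteq> {..<length Q} \<and>
         (\<exists>u. subseq u (nths Q ({..<length Q} - F)) \<and> reduced_expression W s u w)}"

record ('g, 'n) quadruple =
  Wgrp :: "'g monoid"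
  srefl :: "'n \<Rightarrow> 'g"
  Qword :: "'n list"
  pielt :: "'g"
  Iface :: "nat set"

definition is_quadruple :: "('g, 'n::finite) quadruple \<Rightarrow> bool" where
  "is_quadruple X \<longleftrightarrow>
     coxeter_system (Wgrp X) (srefl X) \<and> pielt X \<in> carrier (Wgrp X) \<and>
     (let faces = subword_complex (Wgrp X) (srefl X) (Qword X) (pielt X)
      in Iface X \<in> faces \<and> (\<forall>F\<in>faces. Iface X \<subseteq> F \<longrightarrow> F = Iface X))"

definition root_fun :: "('g, 'n::finite) quadruple \<Rightarrow> nat \<Rightarrow> real ^ 'n" where
  "root_fun X l =
     foldr (geo_refl (Wgrp X) (srefl X)) (nths (Qword X) ({..<l} - Iface X))
       (axis (Qword X ! l) 1)"

definition irreducible_quadruple :: "('g, 'n::finite) quadruple \<Rightarrow> bool" where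
  "irreducible_quadruple X \<longleftrightarrow> span (root_fun X ` Iface X) = UNIV"

text \<open>A basis is meant as a family, hence the injectivity of the root function on the facet.\<close>
definition root_independent :: "('g, 'n::finite) quadruple \<Rightarrow> bool" where
  "root_independent X \<longleftrightarrow>
     inj_on (root_fun X) (Iface X) \<and> independent (root_fun X ` Iface X) \<and>
     span (root_fun X ` Iface X) = UNIV"

definition objects_D :: "('g, 'n::finite) quadruple set" where
  "objects_D = {X. is_quadruple X \<and> irreducible_quadruple X \<and> root_independent X}"


section \<open>The root configuration quiver\<close>

record 'a quiver =
  vertices :: "'a set"
  arrows :: "('a \<times> 'a) set"

definition root_quiver :: "('g, 'n::finite) quadruple \<Rightarrow> nat quiver" where
  "root_quiver X =
     \<lparr> vertices = Iface X,
       arrows = {(i, j). i \<in> Iface X \<and> j \<in> Iface X \<and>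
         (real i - real j) * geo_form (Wgrp X) (srefl X) (root_fun X i) (root_fun X j) > 0} \<rparr>"

definition dynkin_quiver_A :: "nat \<Rightarrow> 'a quiver \<Rightarrow> bool" where
  "dynkin_quiver_A n \<Gamma> \<longleftrightarrow>
     (\<exists>\<tau>. bij_betw \<tau> (vertices \<Gamma>) {1..n} \<and>
        (\<forall>i\<in>vertices \<Gamma>. \<forall>j\<in>vertices \<Gamma>.
           (i, j) \<in> arrows \<Gamma> \<or> (j, i) \<in> arrows \<Gamma> \<longleftrightarrow> adjacent_A (\<tau> i) (\<tau> j)))"

definition full_subquiver :: "'a quiver \<Rightarrow> 'a set \<Rightarrow> 'a quiver" where
  "full_subquiver \<Gamma> J = \<lparr> vertices = J, arrows = arrows \<Gamma> \<inter> J \<times> J \<rparr>"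


section \<open>The category of disjoint unions of subquivers\<close>

text \<open>
  The list \<open>[J\<^sub>1, \<dots>, J\<^sub>t]\<close> of vertex sets of \<open>\<Gamma>\<close> represents the disjoint union of the full
  subquivers on the \<open>J\<^sub>p\<close>. Its vertices are the pairs \<open>(p, v)\<close> of a summand and a vertex
  \<open>v \<in> J\<^sub>p\<close>, and the label of \<open>(p, v)\<close> is \<open>v\<close>.
\<close>
type_synonym obj = "nat set list"

definition disjoint_union :: "nat quiver \<Rightarrow> obj \<Rightarrow> (nat \<times> nat) quiver" where
  "disjoint_union \<Gamma> A =
     \<lparr> vertices = {(p, v). p < length A \<and> v \<in> vertices (full_subquiver \<Gamma> (A ! p))},
       arrows = {((p, v), (q, w)). p = q \<and> p < length A \<and>
                   (v, w) \<in> arrows (full_subquiver \<Gamma> (A ! p))} \<rparr>"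

abbreviation label :: "nat \<times> nat \<Rightarrow> nat" where
  "label \<equiv> snd"

definition objects_S :: "nat quiver \<Rightarrow> obj set" where
  "objects_S \<Gamma> = lists (Pow (vertices \<Gamma>))"

text \<open>
  A diagram \<open>A \<hookleftarrow> P \<hookrightarrow> B\<close>, taken up to isomorphism of \<open>P\<close>, is the graph of a partial
  injection. Composition (intersection in the middle object) is then relational
  composition, written in diagrammatic order.
\<close>
definition hom_S :: "nat quiver \<Rightarrow> obj \<Rightarrow> obj \<Rightarrow> (nat \<times> nat) rel set" where
  "hom_S \<Gamma> A B =
     {f. f \<subseteq> vertices (disjoint_union \<Gamma> A) \<times> vertices (disjoint_union \<Gamma> B) \<and>
         single_valued f \<and> single_valued (f\<inverse>) \<and>
         (\<forall>(x, y)\<in>f. label x = label y) \<and>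
         (\<forall>(x, y)\<in>f. \<forall>(x', y')\<in>f.
            (x, x') \<in> arrows (disjoint_union \<Gamma> A) \<longleftrightarrow>
            (y, y') \<in> arrows (disjoint_union \<Gamma> B))}"

definition id_S :: "nat quiver \<Rightarrow> obj \<Rightarrow> (nat \<times> nat) rel" where
  "id_S \<Gamma> A = Id_on (vertices (disjoint_union \<Gamma> A))"

definition isos_S :: "nat quiver \<Rightarrow> obj \<Rightarrow> obj \<Rightarrow> (nat \<times> nat) rel set" where
  "isos_S \<Gamma> A B =
     {f \<in> hom_S \<Gamma> A B. \<exists>g\<in>hom_S \<Gamma> B A. f O g = id_S \<Gamma> A \<and> g O f = id_S \<Gamma> B}"

definition iso_rel_S :: "nat quiver \<Rightarrow> obj rel" where
  "iso_rel_S \<Gamma> = {(A, B). A \<in> objects_S \<Gamma> \<and> B \<in> objects_S \<Gamma> \<and> isos_S \<Gamma> A B \<noteq> {}}"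


section \<open>The proto-exact structure\<close>

definition path_le :: "nat quiver \<Rightarrow> nat \<Rightarrow> nat \<Rightarrow> bool" where
  "path_le \<Gamma> a b \<longleftrightarrow> (b, a) \<in> (arrows \<Gamma>)\<^sup>*"

definition basic_mono :: "nat quiver \<Rightarrow> nat set \<Rightarrow> nat set \<Rightarrow> bool" where
  "basic_mono \<Gamma> J H \<longleftrightarrow> J \<subseteq> H \<and> H \<subseteq> vertices \<Gamma> \<and> (\<forall>a\<in>J. {b \<in> H. path_le \<Gamma> b a} \<subseteq> J)"

definition basic_epi :: "nat quiver \<Rightarrow> nat set \<Rightarrow> nat set \<Rightarrow> bool" where
  "basic_epi \<Gamma> H K \<longleftrightarrow> K \<subseteq> H \<and> H \<subseteq> vertices \<Gamma> \<and> (\<forall>a\<in>K. {b \<in> H. path_le \<Gamma> a b} \<subseteq> K)"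

text \<open>
  The disjoint union of the basic diagrams \<open>J\<^sub>p \<hookleftarrow> J\<^sub>p \<hookrightarrow> H\<^sub>p\<close> is the diagonal relation on the
  vertices of \<open>[J\<^sub>1, \<dots>, J\<^sub>t]\<close>, viewed as a morphism to \<open>[H\<^sub>1, \<dots>, H\<^sub>t]\<close>; likewise for
  \<open>H\<^sub>p \<hookleftarrow> K\<^sub>p \<hookrightarrow> K\<^sub>p\<close>. One labelled quiver is a disjoint union in several ways (reordering,
  splitting into components), so source and target are taken up to isomorphism.
\<close>
definition admissible_mono :: "nat quiver \<Rightarrow> obj \<Rightarrow> obj \<Rightarrow> (nat \<times> nat) rel \<Rightarrow> bool" where
  "admissible_mono \<Gamma> A B f \<longleftrightarrow>
     (\<exists>Js Hs \<alpha> \<beta>. list_all2 (basic_mono \<Gamma>) Js Hs \<and>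
        \<alpha> \<in> isos_S \<Gamma> A Js \<and> \<beta> \<in> isos_S \<Gamma> Hs B \<and> f = \<alpha> O id_S \<Gamma> Js O \<beta>)"

definition admissible_epi :: "nat quiver \<Rightarrow> obj \<Rightarrow> obj \<Rightarrow> (nat \<times> nat) rel \<Rightarrow> bool" where
  "admissible_epi \<Gamma> B C g \<longleftrightarrow>
     (\<exists>Hs Ks \<alpha> \<beta>. list_all2 (basic_epi \<Gamma>) Hs Ks \<and>
        \<alpha> \<in> isos_S \<Gamma> B Hs \<and> \<beta> \<in> isos_S \<Gamma> Ks C \<and> g = \<alpha> O id_S \<Gamma> Ks O \<beta>)"

text \<open>Both predicates concern the commutative square \<open>A \<rightarrow> B \<rightarrow> D\<close>, \<open>A \<rightarrow> C \<rightarrow> D\<close>.\<close>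

definition is_pullback ::
    "nat quiver \<Rightarrow> obj \<Rightarrow> obj \<Rightarrow> obj \<Rightarrow> obj \<Rightarrow> (nat \<times> nat) rel \<Rightarrow> (nat \<times> nat) rel \<Rightarrow>
     (nat \<times> nat) rel \<Rightarrow> (nat \<times> nat) rel \<Rightarrow> bool" where
  "is_pullback \<Gamma> A B C D ab ac bd cd \<longleftrightarrow>
     ab \<in> hom_S \<Gamma> A B \<and> ac \<in> hom_S \<Gamma> A C \<and> bd \<in> hom_S \<Gamma> B D \<and> cd \<in> hom_S \<Gamma> C D \<and>
     ab O bd = ac O cd \<and>
     (\<forall>T\<in>objects_S \<Gamma>. \<forall>u\<in>hom_S \<Gamma> T B. \<forall>v\<in>hom_S \<Gamma> T C. u O bd = v O cd \<longrightarrow>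
        (\<exists>!h. h \<in> hom_S \<Gamma> T A \<and> h O ab = u \<and> h O ac = v))"

definition is_pushout ::
    "nat quiver \<Rightarrow> obj \<Rightarrow> obj \<Rightarrow> obj \<Rightarrow> obj \<Rightarrow> (nat \<times> nat) rel \<Rightarrow> (nat \<times> nat) rel \<Rightarrow>
     (nat \<times> nat) rel \<Rightarrow> (nat \<times> nat) rel \<Rightarrow> bool" where
  "is_pushout \<Gamma> A B C D ab ac bd cd \<longleftrightarrow>
     ab \<in> hom_S \<Gamma> A B \<and> ac \<in> hom_S \<Gamma> A C \<and> bd \<in> hom_S \<Gamma> B D \<and> cd \<in> hom_S \<Gamma> C D \<and>
     ab O bd = ac O cd \<and>
     (\<forall>T\<in>objects_S \<Gamma>. \<forall>u\<in>hom_S \<Gamma> B T. \<forall>v\<in>hom_S \<Gamma> C T. ab O u = ac O v \<longrightarrow>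
        (\<exists>!h. h \<in> hom_S \<Gamma> D T \<and> bd O h = u \<and> cd O h = v))"

text \<open>The zero object is the empty disjoint union, and zero morphisms are empty relations.\<close>
definition proto_exact ::
    "nat quiver \<Rightarrow> obj \<Rightarrow> obj \<Rightarrow> obj \<Rightarrow> (nat \<times> nat) rel \<Rightarrow> (nat \<times> nat) rel \<Rightarrow> bool" where
  "proto_exact \<Gamma> A B C f g \<longleftrightarrow>
     A \<in> objects_S \<Gamma> \<and> B \<in> objects_S \<Gamma> \<and> C \<in> objects_S \<Gamma> \<and>
     admissible_mono \<Gamma> A B f \<and> admissible_epi \<Gamma> B C g \<and>
     is_pullback \<Gamma> A B [] C f {} g {} \<and> is_pushout \<Gamma> A B [] C f {} g {}"

definition ext_sequences ::
    "nat quiver \<Rightarrow> obj \<Rightarrow> obj \<Rightarrow> obj \<Rightarrow> (obj \<times> (nat \<times> nat) rel \<times> (nat \<times> nat) rel) set" where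
  "ext_sequences \<Gamma> C A B =
     {(B', f, g). proto_exact \<Gamma> A B' C f g \<and> (B', B) \<in> iso_rel_S \<Gamma>}"

definition ext_equiv ::
    "nat quiver \<Rightarrow> obj \<Rightarrow> obj \<Rightarrow> obj \<Rightarrow> (obj \<times> (nat \<times> nat) rel \<times> (nat \<times> nat) rel) rel" where
  "ext_equiv \<Gamma> C A B =
     {((B1, f1, g1), (B2, f2, g2)).
        (B1, f1, g1) \<in> ext_sequences \<Gamma> C A B \<and> (B2, f2, g2) \<in> ext_sequences \<Gamma> C A B \<and>
        (\<exists>\<phi>\<in>isos_S \<Gamma> B1 B2. f1 O \<phi> = f2 \<and> \<phi> O g2 = g1)}"

definition Ext_S ::
    "nat quiver \<Rightarrow> obj \<Rightarrow> obj \<Rightarrow> obj \<Rightarrow>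
     (obj \<times> (nat \<times> nat) rel \<times> (nat \<times> nat) rel) set set" where
  "Ext_S \<Gamma> C A B = ext_sequences \<Gamma> C A B // ext_equiv \<Gamma> C A B"


section \<open>Algebras\<close>

text \<open>
  The algebra with basis \<open>B\<close>, unit the basis element \<open>e\<close>, and product
  \<open>b\<^sub>1 b\<^sub>2 = \<Sum>\<^sub>b c b\<^sub>1 b\<^sub>2 b \<cdot> b\<close>. Elements are finitely supported functions on \<open>B\<close>, extended by 0.
\<close>
definition structure_algebra ::
    "'b set \<Rightarrow> 'b \<Rightarrow> ('b \<Rightarrow> 'b \<Rightarrow> 'b \<Rightarrow> 'k::field) \<Rightarrow> ('k, 'b \<Rightarrow> 'k) module" where
  "structure_algebra B e c =
     \<lparr> carrier = {x. finite {b. x b \<noteq> 0} \<and> {b. x b \<noteq> 0} \<subseteq> B},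
       mult = (\<lambda>x y b. if b \<in> B
                 then \<Sum>b1 | x b1 \<noteq> 0. \<Sum>b2 | y b2 \<noteq> 0. x b1 * y b2 * c b1 b2 b else 0),
       one = (\<lambda>b. if b = e then 1 else 0),
       zero = (\<lambda>b. 0),
       add = (\<lambda>x y b. x b + y b),
       smult = (\<lambda>a x b. a * x b) \<rparr>"

definition algebra_iso :: "('k, 'a) module \<Rightarrow> ('k, 'b) module \<Rightarrow> ('a \<Rightarrow> 'b) set" where
  "algebra_iso A B =
     {\<psi> \<in> ring_iso A B. \<forall>a. \<forall>x\<in>carrier A. \<psi> (a \<odot>\<^bsub>A\<^esub> x) = a \<odot>\<^bsub>B\<^esub> \<psi> x}"

definition representative :: "obj set \<Rightarrow> obj" where
  "representative K = (SOME A. A \<in> K)"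

text \<open>The basis consists of isomorphism classes; \<open>[\<Gamma>\<^sub>1]\<close> is the subobject in \<open>[\<Gamma>\<^sub>1] \<cdot> [\<Gamma>\<^sub>2]\<close>.\<close>
definition hall_algebra :: "nat quiver \<Rightarrow> ('k::field, obj set \<Rightarrow> 'k) module" where
  "hall_algebra \<Gamma> =
     structure_algebra (objects_S \<Gamma> // iso_rel_S \<Gamma>) (iso_rel_S \<Gamma> `` {[]})
       (\<lambda>K1 K2 K. of_nat (card
          (Ext_S \<Gamma> (representative K2) (representative K1) (representative K))))"

record ('k, 'v) lie_algebra =
  lcarrier :: "'v set"
  ladd :: "'v \<Rightarrow> 'v \<Rightarrow> 'v"
  lscale :: "'k \<Rightarrow> 'v \<Rightarrow> 'v"
  lbracket :: "'v \<Rightarrow> 'v \<Rightarrow> 'v"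

definition free_algebra :: "'v set \<Rightarrow> ('k::field, 'v list \<Rightarrow> 'k) module" where
  "free_algebra S = structure_algebra (lists S) [] (\<lambda>u v w. if w = u @ v then 1 else 0)"

definition free_gen :: "'v \<Rightarrow> 'v list \<Rightarrow> 'k::field" where
  "free_gen x = (\<lambda>w. if w = [x] then 1 else 0)"

definition quotient_algebra :: "('k, 'a) module \<Rightarrow> 'a set \<Rightarrow> ('k, 'a set) module" where
  "quotient_algebra A I =
     \<lparr> carrier = carrier (A Quot I),
       mult = mult (A Quot I),
       one = one (A Quot I),
       zero = zero (A Quot I),
       add = add (A Quot I),
       smult = (\<lambda>c X. \<Union>x\<in>X. I +>\<^bsub>A\<^esub> (c \<odot>\<^bsub>A\<^esub> x)) \<rparr>"

text \<open>
  The tensor algebra of \<open>L\<close> is the free algebra on the set \<open>L\<close> modulo the relations that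
  make \<open>L\<close> embed linearly (the first two families); the third family is the usual one
  defining the enveloping algebra as a quotient of the tensor algebra.
\<close>
definition enveloping_relations ::
    "('k::field, 'v) lie_algebra \<Rightarrow> ('v list \<Rightarrow> 'k) set" where
  "enveloping_relations L =
     (let F = free_algebra (lcarrier L); \<iota> = free_gen in
        {\<iota> (ladd L x y) \<ominus>\<^bsub>F\<^esub> (\<iota> x \<oplus>\<^bsub>F\<^esub> \<iota> y) | x y. x \<in> lcarrier L \<and> y \<in> lcarrier L} \<union>
        {\<iota> (lscale L a x) \<ominus>\<^bsub>F\<^esub> (a \<odot>\<^bsub>F\<^esub> \<iota> x) | a x. x \<in> lcarrier L} \<union>
        {(\<iota> x \<otimes>\<^bsub>F\<^esub> \<iota> y \<ominus>\<^bsub>F\<^esub> \<iota> y \<otimes>\<^bsub>F\<^esub> \<iota> x) \<ominus>\<^bsub>F\<^esub> \<iota> (lbracket L x y) | x y.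
           x \<in> lcarrier L \<and> y \<in> lcarrier L})"

definition universal_enveloping ::
    "('k::field, 'v) lie_algebra \<Rightarrow> ('k, ('v list \<Rightarrow> 'k) set) module" where
  "universal_enveloping L =
     (let F = free_algebra (lcarrier L)
      in quotient_algebra F (Idl\<^bsub>F\<^esub> (enveloping_relations L)))"

text \<open>
  In the standard triangular decomposition of \<open>sl\<^sub>N\<close>, with the diagonal matrices as Cartan
  subalgebra, the positive part consists of the strictly upper triangular matrices.
\<close>
definition sl_positive_part :: "nat \<Rightarrow> ('k::field, 'k mat) lie_algebra" where
  "sl_positive_part N =
     \<lparr> lcarrier = {A \<in> carrier_mat N N. \<forall>i<N. \<forall>j<N. j \<le> i \<longrightarrow> A $$ (i, j) = 0},
       ladd = (\<lambda>A B. A + B),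
       lscale = (\<lambda>a A. a \<cdot>\<^sub>m A),
       lbracket = (\<lambda>A B. A * B - B * A) \<rparr>"

end

theory Submission
  imports Defs "HOL-Library.Function_Algebras" "HOL-Combinatorics.List_Permutation"
begin

text \<open>
  The quiver \<open>\<Gamma>\<close> of \<open>X\<close> is an orientation of the line with \<open>n\<close> vertices. An object is a labelled quiver
  whose components are segments of that line, so isomorphism classes are multisets of segments. The
  segments \<open>(i, j)\<close> with \<open>0 \<le> i < j \<le> n\<close> correspond to the matrix units \<open>E\<^sub>i\<^sub>j\<close> that span the strictly
  upper triangular matrices.

  In a proto-exact sequence \<open>A \<rightarrow> B \<rightarrow> C\<close> the vertices of \<open>B\<close> are those of \<open>A\<close> together with those of \<open>C\<close>, and \<open>B\<close>
  has, besides the arrows of \<open>A\<close> and \<open>C\<close>, a set \<open>E\<close> of arrows from \<open>C\<close> to \<open>A\<close>. Equivalence classes of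
  sequences are exactly such sets, provided the glued quiver is again an object (\<open>card_Ext\<close>). Hence
  \<open>[A] [C] = \<Sum>\<^sub>E [A \<squnion>\<^sub>E C]\<close> (\<open>hall_mult\<close>). Associativity follows because either way of bracketing a
  triple product enumerates the sets of arrows going down the chain \<open>C \<rightarrow> B \<rightarrow> A\<close> (\<open>hall_assoc\<close>).

  For two segments at most one nonempty \<open>E\<close> occurs, namely a single arrow that joins adjacent segments
  into one. So \<open>[\<beta>] [\<gamma>] - [\<gamma>] [\<beta>]\<close> is plus or minus the class of the joined segment if the segments
  are adjacent, the sign being given by the direction of the arrow between them, and 0 otherwise.
  After rescaling the matrix units by suitable signs these are the commutators of \<open>E\<^sub>i\<^sub>j\<close>
  (\<open>hall_of_mat_bracket\<close>), which yields a homomorphism from the enveloping algebra to the Hall algebra.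

  It is bijective by the easy half of the Poincare-Birkhoff-Witt theorem. Segments can be ordered so
  that no arrow leads from a later segment to an earlier one (\<open>joins_key\<close>). The product of an
  increasing list of segments is then the single basis element of their disjoint union
  (\<open>hbasis_mult_sorted\<close>). So the ordered monomials, which span the enveloping algebra
  (\<open>word_reducible\<close>), are mapped bijectively to the basis of the Hall algebra, and there can be no kernel.
\<close>

section \<open>Algebras given by structure constants\<close>

definition basis_vec :: "'b \<Rightarrow> 'b \<Rightarrow> 'k::field" where
  "basis_vec b = (\<lambda>x. if x = b then 1 else 0)"

definition scale :: "'k::field \<Rightarrow> ('b \<Rightarrow> 'k) \<Rightarrow> 'b \<Rightarrow> 'k" where
  "scale a x = (\<lambda>b. a * x b)"

lemma scale_apply [simp]: "scale a x b = a * x b"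
  by (simp add: scale_def)

lemma scale_simps [simp]:
  "scale 0 x = 0" "scale a 0 = 0" "scale 1 x = x" "scale a (scale a' x) = scale (a * a') x"
  by (auto simp: fun_eq_iff)

lemma scale_distribs:
  "scale a (x + y) = scale a x + scale a y" "scale (a + a') x = scale a x + scale a' x"
  "scale a (x - y) = scale a x - scale a y" "scale (- 1) x = - x"
  by (auto simp: fun_eq_iff algebra_simps)

lemma sum_fun_apply [simp]: "(\<Sum>i\<in>I. f i) b = (\<Sum>i\<in>I. f i b)"
  by (induction I rule: infinite_finite_induct) auto

lemma scale_sum: "scale a (\<Sum>i\<in>I. f i) = (\<Sum>i\<in>I. scale a (f i))"
  by (auto simp: fun_eq_iff sum_distrib_left)

abbreviation support :: "('b \<Rightarrow> 'k::field) \<Rightarrow> 'b set" where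
  "support x \<equiv> {b. x b \<noteq> 0}"

lemma support_basis_vec [simp]: "support (basis_vec b :: 'b \<Rightarrow> 'k::field) = {b}"
  by (auto simp: basis_vec_def)

lemma structure_algebra_sel [simp]:
  "carrier (structure_algebra B e c) = {x. finite (support x) \<and> support x \<subseteq> B}"
  "one (structure_algebra B e c) = basis_vec e"
  "zero (structure_algebra B e c) = 0"
  "add (structure_algebra B e c) = (+)"
  "smult (structure_algebra B e c) = scale"
  by (auto simp: structure_algebra_def basis_vec_def scale_def fun_eq_iff)

definition finsupp :: "'b set \<Rightarrow> ('b \<Rightarrow> 'k::field) set" where
  "finsupp B = {x. finite (support x) \<and> support x \<subseteq> B}"

lemma finsupp_0 [simp]: "0 \<in> finsupp B"
  by (simp add: finsupp_def)

lemma finsupp_add: "x \<in> finsupp B \<Longrightarrow> y \<in> finsupp B \<Longrightarrow> x + y \<in> finsupp B"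
  using finite_subset[of "support (x + y)" "support x \<union> support y"]
  by (force simp: finsupp_def subset_iff)

lemma finsupp_scale: "x \<in> finsupp B \<Longrightarrow> scale a x \<in> finsupp B"
  unfolding finsupp_def by (auto intro!: finite_subset[of "support (scale a x)" "support x"])

lemma finsupp_uminus: "x \<in> finsupp B \<Longrightarrow> - x \<in> finsupp B"
  by (simp add: finsupp_def)

lemma finsupp_diff: "x \<in> finsupp B \<Longrightarrow> y \<in> finsupp B \<Longrightarrow> x - y \<in> finsupp B"
  using finsupp_add[of x B "- y"] by (simp add: finsupp_uminus)

lemma finsupp_sum: "(\<And>i. i \<in> I \<Longrightarrow> f i \<in> finsupp B) \<Longrightarrow> (\<Sum>i\<in>I. f i) \<in> finsupp B"
  by (induction I rule: infinite_finite_induct) (auto intro: finsupp_add)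

lemma finsupp_basis_vec: "b \<in> B \<Longrightarrow> basis_vec b \<in> finsupp B"
  by (simp add: finsupp_def)

lemma finsupp_expand:
  assumes "x \<in> finsupp B"
  shows "x = (\<Sum>b\<in>support x. scale (x b) (basis_vec b))"
proof
  fix b
  have "(\<Sum>b'\<in>support x. scale (x b') (basis_vec b')) b = (\<Sum>b'\<in>support x. if b' = b then x b' else 0)"
    by (auto simp: basis_vec_def intro!: sum.cong)
  also have "\<dots> = x b"
    using assms by (auto simp: finsupp_def sum.delta)
  finally show "x b = (\<Sum>b'\<in>support x. scale (x b') (basis_vec b')) b" ..
qed

lemma finsupp_induct [consumes 1, case_names zero step]:
  assumes x: "x \<in> finsupp B" and "P 0"
    and step: "\<And>a b y. b \<in> B \<Longrightarrow> y \<in> finsupp B \<Longrightarrow> P y \<Longrightarrow> P (scale a (basis_vec b) + y)"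
  shows "P x"
proof -
  have "P (\<Sum>b\<in>S. scale (x b) (basis_vec b))" if "finite S" "S \<subseteq> B" for S
    using that
  proof (induction S)
    case (insert b S)
    have "P (scale (x b) (basis_vec b) + (\<Sum>b\<in>S. scale (x b) (basis_vec b)))"
      using insert by (intro step finsupp_sum finsupp_scale finsupp_basis_vec) blast+
    then show ?case
      using insert.hyps by (subst sum.insert)
  qed (simp add: \<open>P 0\<close>)
  with x show ?thesis
    by (subst finsupp_expand[OF x]) (auto simp: finsupp_def)
qed

definition lin_ext :: "('b \<Rightarrow> 'c \<Rightarrow> 'k::field) \<Rightarrow> ('b \<Rightarrow> 'k) \<Rightarrow> 'c \<Rightarrow> 'k" where
  "lin_ext f x = (\<Sum>b\<in>support x. scale (x b) (f b))"

lemma lin_ext_superset: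
  "finite S \<Longrightarrow> support x \<subseteq> S \<Longrightarrow> lin_ext f x = (\<Sum>b\<in>S. scale (x b) (f b))"
  unfolding lin_ext_def by (rule sum.mono_neutral_left) auto

lemma lin_ext_0 [simp]: "lin_ext f 0 = 0"
  by (simp add: lin_ext_def)

lemma lin_ext_basis_vec [simp]: "lin_ext f (basis_vec b) = f b"
  by (simp add: lin_ext_def basis_vec_def)

lemma lin_ext_add:
  assumes "x \<in> finsupp B" "y \<in> finsupp B"
  shows "lin_ext f (x + y) = lin_ext f x + lin_ext f y"
proof -
  let ?S = "support x \<union> support y"
  have "finite ?S" "support (x + y) \<subseteq> ?S"
    using assms by (auto simp: finsupp_def)
  then show ?thesis
    using lin_ext_superset[of ?S x f] lin_ext_superset[of ?S y f] lin_ext_superset[of ?S "x + y" f]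
    by (simp add: scale_distribs sum.distrib)
qed

lemma lin_ext_scale:
  assumes "x \<in> finsupp B"
  shows "lin_ext f (scale a x) = scale a (lin_ext f x)"
proof -
  have "finite (support x)" "support (scale a x) \<subseteq> support x"
    using assms by (auto simp: finsupp_def)
  then show ?thesis
    using lin_ext_superset[of "support x" "scale a x" f]
    by (simp add: lin_ext_def scale_sum)
qed

lemma lin_ext_diff:
  assumes "x \<in> finsupp B" "y \<in> finsupp B"
  shows "lin_ext f (x - y) = lin_ext f x - lin_ext f y"
  using lin_ext_add[OF assms(1) finsupp_scale[OF assms(2)], of f "-1"]
    lin_ext_scale[OF assms(2), of f "-1"] by (simp add: scale_distribs)

lemma lin_ext_in:
  assumes "x \<in> finsupp B" "\<And>b. b \<in> B \<Longrightarrow> f b \<in> finsupp C"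
  shows "lin_ext f x \<in> finsupp C"
  using assms unfolding lin_ext_def
  by (auto simp: finsupp_def[of B] intro!: finsupp_sum finsupp_scale)

locale structure_constants =
  fixes B :: "'b set" and e :: 'b and c :: "'b \<Rightarrow> 'b \<Rightarrow> 'b \<Rightarrow> 'k::field"
  assumes unit_in: "e \<in> B"
    and finite_products: "b1 \<in> B \<Longrightarrow> b2 \<in> B \<Longrightarrow> finite {b \<in> B. c b1 b2 b \<noteq> 0}"
begin

abbreviation "alg \<equiv> structure_algebra B e c"

abbreviation prod_alg (infixl "\<odot>\<odot>" 70) where "x \<odot>\<odot> y \<equiv> mult alg x y"

lemma carrier_alg: "carrier alg = finsupp B"
  by (simp add: finsupp_def)

definition bprod :: "'b \<Rightarrow> 'b \<Rightarrow> 'b \<Rightarrow> 'k" where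
  "bprod b1 b2 = (\<lambda>b. if b \<in> B then c b1 b2 b else 0)"

lemma bprod_in: "b1 \<in> B \<Longrightarrow> b2 \<in> B \<Longrightarrow> bprod b1 b2 \<in> finsupp B"
  using finite_products[of b1 b2]
  by (auto simp: finsupp_def bprod_def Collect_conj_eq[symmetric] conj_commute elim!: rev_finite_subset)

lemma mult_eq_lin_ext: "x \<odot>\<odot> y = lin_ext (\<lambda>b1. lin_ext (bprod b1) y) x"
  by (auto simp: structure_algebra_def lin_ext_def bprod_def fun_eq_iff sum_distrib_left mult.assoc)

lemma mult_basis: "basis_vec b1 \<odot>\<odot> basis_vec b2 = bprod b1 b2"
  by (simp add: mult_eq_lin_ext)

lemma mult_in: "x \<in> finsupp B \<Longrightarrow> y \<in> finsupp B \<Longrightarrow> x \<odot>\<odot> y \<in> finsupp B"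
  unfolding mult_eq_lin_ext by (auto intro!: lin_ext_in[of _ B] bprod_in)

lemma mult_add_left:
  "x \<in> finsupp B \<Longrightarrow> x' \<in> finsupp B \<Longrightarrow> (x + x') \<odot>\<odot> y = x \<odot>\<odot> y + x' \<odot>\<odot> y"
  by (simp add: mult_eq_lin_ext lin_ext_add)

lemma mult_scale_left: "x \<in> finsupp B \<Longrightarrow> scale a x \<odot>\<odot> y = scale a (x \<odot>\<odot> y)"
  by (simp add: mult_eq_lin_ext lin_ext_scale)

lemma mult_add_right:
  "y \<in> finsupp B \<Longrightarrow> y' \<in> finsupp B \<Longrightarrow> x \<odot>\<odot> (y + y') = x \<odot>\<odot> y + x \<odot>\<odot> y'"
  by (simp add: mult_eq_lin_ext lin_ext_add[of y B y']) (simp add: lin_ext_def scale_distribs sum.distrib)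

lemma mult_scale_right: "y \<in> finsupp B \<Longrightarrow> x \<odot>\<odot> scale a y = scale a (x \<odot>\<odot> y)"
  by (simp add: mult_eq_lin_ext lin_ext_scale) (simp add: lin_ext_def scale_sum mult.left_commute)

lemma mult_0 [simp]: "0 \<odot>\<odot> y = 0" "x \<odot>\<odot> 0 = 0"
  by (simp_all add: mult_eq_lin_ext) (simp add: lin_ext_def)

lemma mult_sum_left:
  "(\<And>i. i \<in> I \<Longrightarrow> f i \<in> finsupp B) \<Longrightarrow> (\<Sum>i\<in>I. f i) \<odot>\<odot> y = (\<Sum>i\<in>I. f i \<odot>\<odot> y)"
  by (induction I rule: infinite_finite_induct) (auto simp: mult_add_left finsupp_sum)

lemma mult_sum_right:
  "(\<And>i. i \<in> I \<Longrightarrow> f i \<in> finsupp B) \<Longrightarrow> x \<odot>\<odot> (\<Sum>i\<in>I. f i) = (\<Sum>i\<in>I. x \<odot>\<odot> f i)"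
  by (induction I rule: infinite_finite_induct) (auto simp: mult_add_right finsupp_sum)

end

text \<open>The laws are demanded of basis elements; bilinearity carries them over to all elements.\<close>
locale unital_algebra = structure_constants +
  assumes left_unit: "b \<in> B \<Longrightarrow> basis_vec e \<odot>\<odot> basis_vec b = basis_vec b"
    and right_unit: "b \<in> B \<Longrightarrow> basis_vec b \<odot>\<odot> basis_vec e = basis_vec b"
    and basis_assoc: "b1 \<in> B \<Longrightarrow> b2 \<in> B \<Longrightarrow> b3 \<in> B \<Longrightarrow>
      basis_vec b1 \<odot>\<odot> basis_vec b2 \<odot>\<odot> basis_vec b3 =
      basis_vec b1 \<odot>\<odot> (basis_vec b2 \<odot>\<odot> basis_vec b3)"
begin

lemmas bilinear_simps = mult_add_left mult_add_right mult_scale_left mult_scale_right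
  finsupp_add finsupp_scale finsupp_basis_vec mult_in

lemma mult_assoc:
  assumes "x \<in> finsupp B" "y \<in> finsupp B" "z \<in> finsupp B"
  shows "x \<odot>\<odot> y \<odot>\<odot> z = x \<odot>\<odot> (y \<odot>\<odot> z)"
proof -
  have 1: "x \<odot>\<odot> basis_vec b2 \<odot>\<odot> basis_vec b3 = x \<odot>\<odot> (basis_vec b2 \<odot>\<odot> basis_vec b3)"
    if "x \<in> finsupp B" "b2 \<in> B" "b3 \<in> B" for x b2 b3
    using that by (induction rule: finsupp_induct) (auto simp: bilinear_simps basis_assoc)
  have 2: "x \<odot>\<odot> y \<odot>\<odot> basis_vec b3 = x \<odot>\<odot> (y \<odot>\<odot> basis_vec b3)"
    if "y \<in> finsupp B" "x \<in> finsupp B" "b3 \<in> B" for x y b3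
    using that by (induction rule: finsupp_induct) (auto simp: bilinear_simps 1)
  show ?thesis
    using assms(3,1,2) by (induction rule: finsupp_induct) (auto simp: bilinear_simps 2)
qed

lemma one_mult: "x \<in> finsupp B \<Longrightarrow> basis_vec e \<odot>\<odot> x = x"
  by (induction x rule: finsupp_induct)
    (simp_all add: bilinear_simps unit_in left_unit del: plus_fun_apply zero_fun_apply scale_apply)

lemma mult_one: "x \<in> finsupp B \<Longrightarrow> x \<odot>\<odot> basis_vec e = x"
  by (induction x rule: finsupp_induct)
    (simp_all add: bilinear_simps unit_in right_unit del: plus_fun_apply zero_fun_apply scale_apply)

sublocale ring alg
proof (rule ringI)
  show "abelian_group alg"
  proof (rule abelian_groupI)
    fix x assume "x \<in> carrier alg"
    then show "\<exists>y\<in>carrier alg. y \<oplus>\<^bsub>alg\<^esub> x = \<zero>\<^bsub>alg\<^esub>"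
      by (intro bexI[of _ "- x"]) (auto simp: finsupp_uminus)
  qed (auto simp: carrier_alg simp del: structure_algebra_sel(1) intro: finsupp_add add.assoc add.commute)
  show "monoid alg"
    by (rule monoidI)
      (auto simp: carrier_alg mult_in mult_assoc one_mult mult_one finsupp_basis_vec unit_in simp del: structure_algebra_sel(1))
qed (auto simp: carrier_alg mult_add_left mult_add_right simp del: structure_algebra_sel(1))

lemma a_inv_eq: "x \<in> finsupp B \<Longrightarrow> \<ominus>\<^bsub>alg\<^esub> x = - x"
  using minus_equality[of "- x" x]
  by (simp add: carrier_alg finsupp_uminus del: structure_algebra_sel(1))

lemma a_minus_eq: "y \<in> finsupp B \<Longrightarrow> x \<ominus>\<^bsub>alg\<^esub> y = x - y"
  by (simp add: a_minus_def a_inv_eq)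

end

section \<open>Partial isomorphisms and exact pairs\<close>

definition labelled_iso ::
    "(nat \<times> nat) quiver \<Rightarrow> (nat \<times> nat) quiver \<Rightarrow> (nat \<times> nat \<Rightarrow> nat \<times> nat) \<Rightarrow> bool" where
  "labelled_iso P Q \<phi> \<longleftrightarrow>
     bij_betw \<phi> (vertices P) (vertices Q) \<and>
     (\<forall>x\<in>vertices P. label (\<phi> x) = label x) \<and>
     (\<forall>x\<in>vertices P. \<forall>y\<in>vertices P. (x, y) \<in> arrows P \<longleftrightarrow> (\<phi> x, \<phi> y) \<in> arrows Q)"

definition isomorphic :: "(nat \<times> nat) quiver \<Rightarrow> (nat \<times> nat) quiver \<Rightarrow> bool" (infix "\<cong>\<^sub>q" 50) where
  "P \<cong>\<^sub>q Q \<longleftrightarrow> (\<exists>\<phi>. labelled_iso P Q \<phi>)"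

lemma labelled_isoI:
  assumes "inj_on \<phi> (vertices P)" "\<phi> ` vertices P = vertices Q"
    and "\<And>x. x \<in> vertices P \<Longrightarrow> label (\<phi> x) = label x"
    and "\<And>x y. x \<in> vertices P \<Longrightarrow> y \<in> vertices P \<Longrightarrow> (x, y) \<in> arrows P \<longleftrightarrow> (\<phi> x, \<phi> y) \<in> arrows Q"
  shows "labelled_iso P Q \<phi>"
  using assms unfolding labelled_iso_def bij_betw_def by blast

lemma labelled_isoD:
  assumes "labelled_iso P Q \<phi>"
  shows "bij_betw \<phi> (vertices P) (vertices Q)"
    and "inj_on \<phi> (vertices P)"
    and "\<phi> ` vertices P = vertices Q"
    and "x \<in> vertices P \<Longrightarrow> \<phi> x \<in> vertices Q"
    and "x \<in> vertices P \<Longrightarrow> label (\<phi> x) = label x"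
    and "x \<in> vertices P \<Longrightarrow> y \<in> vertices P \<Longrightarrow> (x, y) \<in> arrows P \<longleftrightarrow> (\<phi> x, \<phi> y) \<in> arrows Q"
  using assms unfolding labelled_iso_def bij_betw_def by blast+

lemma labelled_iso_id: "labelled_iso P P id"
  by (rule labelled_isoI) auto

lemma labelled_iso_comp:
  "labelled_iso P Q \<phi> \<Longrightarrow> labelled_iso Q R \<psi> \<Longrightarrow> labelled_iso P R (\<psi> \<circ> \<phi>)"
  unfolding labelled_iso_def by (auto simp: bij_betw_apply intro: bij_betw_trans)

lemma labelled_iso_inv:
  assumes "labelled_iso P Q \<phi>"
  shows "labelled_iso Q P (inv_into (vertices P) \<phi>)"
proof (rule labelled_isoI)
  note D = labelled_isoD[OF assms]
  show "inj_on (inv_into (vertices P) \<phi>) (vertices Q)"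
    using D(3) inj_on_inv_into[of "vertices Q" \<phi> "vertices P"] by simp
  show "inv_into (vertices P) \<phi> ` vertices Q = vertices P"
    using bij_betw_inv_into[OF D(1)] by (simp add: bij_betw_def)
  have *: "inv_into (vertices P) \<phi> y \<in> vertices P" "\<phi> (inv_into (vertices P) \<phi> y) = y"
    if "y \<in> vertices Q" for y
    using that D(3) by (auto simp: inv_into_into f_inv_into_f)
  show "label (inv_into (vertices P) \<phi> y) = label y" if "y \<in> vertices Q" for y
    using D(5)[OF *(1)[OF that]] *(2)[OF that] by simp
  show "(x, y) \<in> arrows Q \<longleftrightarrow>
      (inv_into (vertices P) \<phi> x, inv_into (vertices P) \<phi> y) \<in> arrows P"
    if "x \<in> vertices Q" "y \<in> vertices Q" for x y
    using D(6)[OF *(1)[OF that(1)] *(1)[OF that(2)]] *(2)[OF that(1)] *(2)[OF that(2)] by simp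
qed

lemma isomorphic_refl [simp]: "P \<cong>\<^sub>q P"
  using labelled_iso_id isomorphic_def by blast

lemma isomorphic_sym: "P \<cong>\<^sub>q Q \<Longrightarrow> Q \<cong>\<^sub>q P"
  using labelled_iso_inv isomorphic_def by blast

lemma isomorphic_trans [trans]: "P \<cong>\<^sub>q Q \<Longrightarrow> Q \<cong>\<^sub>q R \<Longrightarrow> P \<cong>\<^sub>q R"
  using labelled_iso_comp unfolding isomorphic_def by blast

abbreviation verts :: "nat quiver \<Rightarrow> obj \<Rightarrow> (nat \<times> nat) set" where
  "verts \<Gamma> A \<equiv> vertices (disjoint_union \<Gamma> A)"

abbreviation arrs :: "nat quiver \<Rightarrow> obj \<Rightarrow> (nat \<times> nat) rel" where
  "arrs \<Gamma> A \<equiv> arrows (disjoint_union \<Gamma> A)"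

lemma du_vertices [simp]:
  "(p, v) \<in> verts \<Gamma> A \<longleftrightarrow> p < length A \<and> v \<in> A ! p"
  by (simp add: disjoint_union_def full_subquiver_def)

lemma du_arrows [simp]:
  "((p, v), (q, w)) \<in> arrs \<Gamma> A \<longleftrightarrow>
     p = q \<and> p < length A \<and> v \<in> A ! p \<and> w \<in> A ! p \<and> (v, w) \<in> arrows \<Gamma>"
  by (auto simp: disjoint_union_def full_subquiver_def)

lemma du_arrows_subset:
  "arrs \<Gamma> A \<subseteq> verts \<Gamma> A \<times> verts \<Gamma> A"
  by auto

lemma hom_SI:
  assumes "\<And>x y. (x, y) \<in> f \<Longrightarrow> x \<in> verts \<Gamma> A"
    and "\<And>x y. (x, y) \<in> f \<Longrightarrow> y \<in> verts \<Gamma> B"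
    and "\<And>x y y'. (x, y) \<in> f \<Longrightarrow> (x, y') \<in> f \<Longrightarrow> y = y'"
    and "\<And>x x' y. (x, y) \<in> f \<Longrightarrow> (x', y) \<in> f \<Longrightarrow> x = x'"
    and "\<And>x y. (x, y) \<in> f \<Longrightarrow> label x = label y"
    and "\<And>x y x' y'. (x, y) \<in> f \<Longrightarrow> (x', y') \<in> f \<Longrightarrow>
      (x, x') \<in> arrs \<Gamma> A \<longleftrightarrow> (y, y') \<in> arrs \<Gamma> B"
  shows "f \<in> hom_S \<Gamma> A B"
proof -
  have "f \<subseteq> verts \<Gamma> A \<times> verts \<Gamma> B"
    using assms(1,2) by force
  moreover have "single_valued f"
    using assms(3) by (rule single_valuedI)
  moreover have "single_valued (f\<inverse>)"
    using assms(4) by (intro single_valuedI) blast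
  ultimately show ?thesis
    using assms(5,6) unfolding hom_S_def by blast
qed

lemma hom_SD:
  assumes "f \<in> hom_S \<Gamma> A B"
  shows "(x, y) \<in> f \<Longrightarrow> x \<in> verts \<Gamma> A"
    and "(x, y) \<in> f \<Longrightarrow> y \<in> verts \<Gamma> B"
    and "(x, y) \<in> f \<Longrightarrow> (x, y') \<in> f \<Longrightarrow> y = y'"
    and "(x, y) \<in> f \<Longrightarrow> (x', y) \<in> f \<Longrightarrow> x = x'"
    and "(x, y) \<in> f \<Longrightarrow> label x = label y"
    and "(x, y) \<in> f \<Longrightarrow> (x', y') \<in> f \<Longrightarrow>
      (x, x') \<in> arrs \<Gamma> A \<longleftrightarrow> (y, y') \<in> arrs \<Gamma> B"
proof -
  have f: "f \<subseteq> verts \<Gamma> A \<times> verts \<Gamma> B"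
    "single_valued f" "single_valued (f\<inverse>)" "\<forall>(x, y)\<in>f. label x = label y"
    "\<forall>(x, y)\<in>f. \<forall>(x', y')\<in>f.
       (x, x') \<in> arrs \<Gamma> A \<longleftrightarrow> (y, y') \<in> arrs \<Gamma> B"
    using assms by (simp_all add: hom_S_def)
  show "(x, y) \<in> f \<Longrightarrow> x \<in> verts \<Gamma> A"
    "(x, y) \<in> f \<Longrightarrow> y \<in> verts \<Gamma> B"
    using f(1) by blast+
  show "(x, y) \<in> f \<Longrightarrow> (x, y') \<in> f \<Longrightarrow> y = y'"
    using f(2) by (rule single_valuedD)
  show "(x, y) \<in> f \<Longrightarrow> (x', y) \<in> f \<Longrightarrow> x = x'"
    using single_valuedD[OF f(3), of y x x'] by simp
  show "(x, y) \<in> f \<Longrightarrow> label x = label y"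
    using f(4) by blast
  show "(x, y) \<in> f \<Longrightarrow> (x', y') \<in> f \<Longrightarrow>
      (x, x') \<in> arrs \<Gamma> A \<longleftrightarrow> (y, y') \<in> arrs \<Gamma> B"
    using f(5) by blast
qed

lemma hom_S_comp:
  assumes f: "f \<in> hom_S \<Gamma> A B" and g: "g \<in> hom_S \<Gamma> B C"
  shows "f O g \<in> hom_S \<Gamma> A C"
proof (rule hom_SI)
  note F = hom_SD[OF f] and G = hom_SD[OF g]
  show "x \<in> verts \<Gamma> A" if "(x, z) \<in> f O g" for x z
    using that F(1) by blast
  show "z \<in> verts \<Gamma> C" if "(x, z) \<in> f O g" for x z
    using that G(2) by blast
  show "label x = label z" if "(x, z) \<in> f O g" for x z
    using that by (elim relcompEpair) (metis F(5) G(5))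
  show "z = z'" if "(x, z) \<in> f O g" "(x, z') \<in> f O g" for x z z'
    using that F(3) G(3) by blast
  show "x = x'" if "(x, z) \<in> f O g" "(x', z) \<in> f O g" for x x' z
    using that F(4) G(4) by blast
  fix x z x' z' assume "(x, z) \<in> f O g" "(x', z') \<in> f O g"
  then obtain y y' where "(x, y) \<in> f" "(y, z) \<in> g" "(x', y') \<in> f" "(y', z') \<in> g"
    by blast
  then show "(x, x') \<in> arrs \<Gamma> A \<longleftrightarrow> (z, z') \<in> arrs \<Gamma> C"
    using F(6)[of x y x' y'] G(6)[of y z y' z'] by simp
qed

lemma hom_S_converse: "f \<in> hom_S \<Gamma> A B \<Longrightarrow> f\<inverse> \<in> hom_S \<Gamma> B A"
  by (rule hom_SI) (simp_all add: hom_SD(1-4,6), metis hom_SD(5))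

lemma hom_S_self_comp:
  assumes "f \<in> hom_S \<Gamma> A B"
  shows "f O f\<inverse> = Id_on (Domain f)" "f\<inverse> O f = Id_on (Range f)"
  using hom_SD(3,4)[OF assms] by blast+

lemma id_S_hom:
  assumes "list_all2 (\<subseteq>) Js Hs"
  shows "id_S \<Gamma> Js \<in> hom_S \<Gamma> Js Hs" "id_S \<Gamma> Js \<in> hom_S \<Gamma> Hs Js"
proof -
  have *: "verts \<Gamma> Js \<subseteq> verts \<Gamma> Hs"
    "(x, y) \<in> arrs \<Gamma> Js \<longleftrightarrow> (x, y) \<in> arrs \<Gamma> Hs"
    if "x \<in> verts \<Gamma> Js" "y \<in> verts \<Gamma> Js" for x y
    using that assms by (cases x; cases y; auto simp: list_all2_conv_all_nth subset_iff)+
  have "x \<in> verts \<Gamma> Hs" if "x \<in> verts \<Gamma> Js" for x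
    using *(1)[OF that that] that by blast
  then show "id_S \<Gamma> Js \<in> hom_S \<Gamma> Js Hs" "id_S \<Gamma> Js \<in> hom_S \<Gamma> Hs Js"
    unfolding id_S_def using *(2) by (intro hom_SI; blast)+
qed

text \<open>
  The list keeps its length, so that tags do not change; entries that become empty contribute no
  vertices.
\<close>
definition restrict_obj :: "obj \<Rightarrow> (nat \<times> nat) set \<Rightarrow> obj" where
  "restrict_obj B U = map (\<lambda>p. {v \<in> B ! p. (p, v) \<in> U}) [0..<length B]"

lemma restrict_obj_nth:
  "length (restrict_obj B U) = length B"
  "p < length B \<Longrightarrow> restrict_obj B U ! p = {v \<in> B ! p. (p, v) \<in> U}"
  by (simp_all add: restrict_obj_def)

lemma restrict_obj_subset: "list_all2 (\<subseteq>) (restrict_obj B U) B"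
  by (auto simp: list_all2_conv_all_nth restrict_obj_nth)

lemma restrict_obj_in_objects:
  assumes "B \<in> objects_S \<Gamma>"
  shows "restrict_obj B U \<in> objects_S \<Gamma>"
proof -
  have "B ! p \<subseteq> vertices \<Gamma>" if "p < length B" for p
    using assms that by (auto simp: objects_S_def in_lists_conv_set)
  from subsetD[OF this] show ?thesis
    by (auto simp: restrict_obj_def objects_S_def in_lists_conv_set)
qed

lemma restrict_obj_sel:
  assumes "U \<subseteq> verts \<Gamma> B"
  shows "verts \<Gamma> (restrict_obj B U) = U"
    and "x \<in> U \<Longrightarrow> y \<in> U \<Longrightarrow> (x, y) \<in> arrs \<Gamma> (restrict_obj B U) \<longleftrightarrow> (x, y) \<in> arrs \<Gamma> B"
proof -
  have "p < length B \<and> v \<in> B ! p" if "(p, v) \<in> U" for p v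
    using subsetD[OF assms that] by simp
  then have "(p, v) \<in> verts \<Gamma> (restrict_obj B U) \<longleftrightarrow> (p, v) \<in> U" for p v
    by (simp add: restrict_obj_nth cong: conj_cong) blast
  then show V: "verts \<Gamma> (restrict_obj B U) = U"
    by (simp only: set_eq_iff split_paired_All simp_thms)
  assume "x \<in> U" "y \<in> U"
  then have "(x, x) \<in> id_S \<Gamma> (restrict_obj B U)" "(y, y) \<in> id_S \<Gamma> (restrict_obj B U)"
    unfolding id_S_def V by (simp_all add: Id_on_iff)
  then show "(x, y) \<in> arrs \<Gamma> (restrict_obj B U) \<longleftrightarrow> (x, y) \<in> arrs \<Gamma> B"
    by (rule hom_SD(6)[OF id_S_hom(1)[OF restrict_obj_subset]])
qed

lemma empty_hom [simp]: "{} \<in> hom_S \<Gamma> A B"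
  by (simp add: hom_S_def)

lemma hom_zero [simp]: "f \<in> hom_S \<Gamma> A [] \<longleftrightarrow> f = {}" "f \<in> hom_S \<Gamma> [] A \<longleftrightarrow> f = {}"
  by (auto simp: hom_S_def disjoint_union_def)

lemma eq_graphI:
  assumes "single_valued f" "Domain f \<subseteq> V" "\<And>x. x \<in> V \<Longrightarrow> (x, \<phi> x) \<in> f"
  shows "f = (\<lambda>x. (x, \<phi> x)) ` V"
  using assms unfolding single_valued_def by fast

definition labelled_emb ::
    "(nat \<times> nat) quiver \<Rightarrow> (nat \<times> nat) quiver \<Rightarrow> (nat \<times> nat \<Rightarrow> nat \<times> nat) \<Rightarrow> bool" where
  "labelled_emb P Q \<phi> \<longleftrightarrow>
     inj_on \<phi> (vertices P) \<and> \<phi> ` vertices P \<subseteq> vertices Q \<and>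
     (\<forall>x\<in>vertices P. label (\<phi> x) = label x) \<and>
     (\<forall>x\<in>vertices P. \<forall>y\<in>vertices P. (x, y) \<in> arrows P \<longleftrightarrow> (\<phi> x, \<phi> y) \<in> arrows Q)"

lemma labelled_iso_iff_emb:
  "labelled_iso P Q \<phi> \<longleftrightarrow> labelled_emb P Q \<phi> \<and> \<phi> ` vertices P = vertices Q"
  unfolding labelled_iso_def labelled_emb_def bij_betw_def by blast

lemma labelled_embD:
  assumes "labelled_emb P Q \<phi>"
  shows "inj_on \<phi> (vertices P)"
    and "x \<in> vertices P \<Longrightarrow> \<phi> x \<in> vertices Q"
    and "x \<in> vertices P \<Longrightarrow> label (\<phi> x) = label x"
    and "x \<in> vertices P \<Longrightarrow> y \<in> vertices P \<Longrightarrow> (x, y) \<in> arrows P \<longleftrightarrow> (\<phi> x, \<phi> y) \<in> arrows Q"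
  using assms unfolding labelled_emb_def by blast+

lemma labelled_emb_comp:
  assumes "labelled_emb P Q \<phi>" "labelled_emb Q R \<psi>"
  shows "labelled_emb P R (\<psi> \<circ> \<phi>)"
proof -
  note D = labelled_embD[OF assms(1)] and D' = labelled_embD[OF assms(2)]
  have "inj_on (\<psi> \<circ> \<phi>) (vertices P)"
    using D(1,2) D'(1) by (metis comp_inj_on image_subsetI inj_on_subset)
  then show ?thesis
    unfolding labelled_emb_def using D(2-4) D'(2-4) by (simp add: image_subset_iff)
qed

lemma Range_graph: "Range ((\<lambda>x. (x, F x)) ` V) = F ` V"
  and Domain_graph: "Domain ((\<lambda>x. (x, F x)) ` V) = V"
  by (auto simp: Range_iff)

lemma graph_relcomp:
  "(\<And>x. x \<in> V \<Longrightarrow> F x \<in> W) \<Longrightarrow> (\<lambda>x. (x, F x)) ` V O (\<lambda>x. (x, G x)) ` W = (\<lambda>x. (x, G (F x))) ` V"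
  by auto

lemma graph_eq_iff: "(\<lambda>x. (x, F x)) ` V = (\<lambda>x. (x, G x)) ` V \<longleftrightarrow> (\<forall>x\<in>V. F x = G x)"
  by (auto simp: image_iff)

lemma graph_cong:
  "(\<And>x. x \<in> V \<Longrightarrow> F x = G x) \<Longrightarrow> (\<lambda>x. (x, F x)) ` V = (\<lambda>x. (x, G x)) ` V"
  by simp

lemma graph_hom:
  assumes "labelled_emb (disjoint_union \<Gamma> A) (disjoint_union \<Gamma> B) F"
  shows "(\<lambda>x. (x, F x)) ` verts \<Gamma> A \<in> hom_S \<Gamma> A B" (is "?f \<in> _")
proof (rule hom_SI)
  note D = labelled_embD[OF assms]
  show "x \<in> verts \<Gamma> A" "y \<in> verts \<Gamma> B"
    "label x = label y" if "(x, y) \<in> ?f" for x y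
    using that D(2,3) by auto
  show "y = y'" if "(x, y) \<in> ?f" "(x, y') \<in> ?f" for x y y'
    using that by blast
  show "x = x'" if "(x, y) \<in> ?f" "(x', y) \<in> ?f" for x x' y
    using that inj_onD[OF D(1), of x x'] by blast
  show "(x, x') \<in> arrs \<Gamma> A \<longleftrightarrow> (y, y') \<in> arrs \<Gamma> B"
    if "(x, y) \<in> ?f" "(x', y') \<in> ?f" for x y x' y'
    using that D(4) by blast
qed

lemma total_hom_graph:
  assumes f: "f \<in> hom_S \<Gamma> A B" and dom: "Domain f = verts \<Gamma> A"
  obtains F where "labelled_emb (disjoint_union \<Gamma> A) (disjoint_union \<Gamma> B) F"
    "f = (\<lambda>x. (x, F x)) ` verts \<Gamma> A"
proof -
  note H = hom_SD[OF f]
  have "\<forall>x\<in>verts \<Gamma> A. \<exists>y. (x, y) \<in> f"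
    using dom by blast
  then obtain F where F: "\<And>x. x \<in> verts \<Gamma> A \<Longrightarrow> (x, F x) \<in> f"
    by metis
  have sv: "single_valued f"
    using H(3) by (rule single_valuedI)
  have "f = (\<lambda>x. (x, F x)) ` verts \<Gamma> A"
    by (rule eq_graphI) (use sv dom F in auto)
  moreover have "labelled_emb (disjoint_union \<Gamma> A) (disjoint_union \<Gamma> B) F"
    unfolding labelled_emb_def
  proof (intro conjI ballI)
    show "inj_on F (verts \<Gamma> A)"
      by (rule inj_onI) (metis F H(4))
    show "F ` verts \<Gamma> A \<subseteq> verts \<Gamma> B"
      using F H(2) by blast
    show "label (F x) = label x" if "x \<in> verts \<Gamma> A" for x
      using H(5)[OF F[OF that]] by simp
    show "(x, y) \<in> arrs \<Gamma> A \<longleftrightarrow> (F x, F y) \<in> arrs \<Gamma> B"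
      if "x \<in> verts \<Gamma> A" "y \<in> verts \<Gamma> A" for x y
      using H(6)[OF F[OF that(1)] F[OF that(2)]] .
  qed
  ultimately show thesis using that by blast
qed

text \<open>
  A partial isomorphism with a two-sided inverse is defined on all of \<open>A\<close> and reaches all of \<open>B\<close>,
  since the composites are full identities.
\<close>
lemma isos_S_iff:
  "f \<in> isos_S \<Gamma> A B \<longleftrightarrow>
    (\<exists>\<phi>. labelled_iso (disjoint_union \<Gamma> A) (disjoint_union \<Gamma> B) \<phi> \<and>
         f = (\<lambda>x. (x, \<phi> x)) ` verts \<Gamma> A)" (is "_ = ?R")
proof
  assume "f \<in> isos_S \<Gamma> A B"
  then obtain g where f: "f \<in> hom_S \<Gamma> A B" and g: "g \<in> hom_S \<Gamma> B A"
    and fg: "f O g = id_S \<Gamma> A" and gf: "g O f = id_S \<Gamma> B"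
    unfolding isos_S_def by blast
  have "Domain (f O g) = verts \<Gamma> A" "Range (g O f) = verts \<Gamma> B"
    unfolding fg gf id_S_def by blast+
  then have dom: "verts \<Gamma> A \<subseteq> Domain f" "verts \<Gamma> B \<subseteq> Range f"
    by blast+
  have "Domain f \<subseteq> verts \<Gamma> A" and ran: "Range f \<subseteq> verts \<Gamma> B"
    using hom_SD(1,2)[OF f] by blast+
  with dom have "Domain f = verts \<Gamma> A"
    by (simp only: subset_antisym)
  from total_hom_graph[OF f this] obtain F
    where F: "labelled_emb (disjoint_union \<Gamma> A) (disjoint_union \<Gamma> B) F"
      and f_eq: "f = (\<lambda>x. (x, F x)) ` verts \<Gamma> A" .
  have "F ` verts \<Gamma> A = verts \<Gamma> B"
    using dom(2) ran unfolding f_eq Range_graph by (rule subset_antisym[rotated])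
  with F f_eq show ?R
    unfolding labelled_iso_iff_emb by blast
next
  assume ?R
  then obtain \<phi> where \<phi>: "labelled_iso (disjoint_union \<Gamma> A) (disjoint_union \<Gamma> B) \<phi>"
    and f: "f = (\<lambda>x. (x, \<phi> x)) ` verts \<Gamma> A"
    by blast
  have f_hom: "f \<in> hom_S \<Gamma> A B"
    unfolding f by (rule graph_hom) (use \<phi> in \<open>simp add: labelled_iso_iff_emb\<close>)
  moreover have "f O f\<inverse> = id_S \<Gamma> A" "f\<inverse> O f = id_S \<Gamma> B"
    unfolding hom_S_self_comp[OF f_hom] id_S_def
    by (simp_all only: f Domain_graph Range_graph labelled_isoD(3)[OF \<phi>])
  ultimately show "f \<in> isos_S \<Gamma> A B"
    unfolding isos_S_def using hom_S_converse[OF f_hom] by blast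
qed

lemma labelled_emb_restrict:
  assumes "labelled_emb P (disjoint_union \<Gamma> B) \<phi>"
  shows "labelled_iso P (disjoint_union \<Gamma> (restrict_obj B (\<phi> ` vertices P))) \<phi>"
proof -
  note D = labelled_embD[OF assms]
  have sub: "\<phi> ` vertices P \<subseteq> verts \<Gamma> B"
    using D(2) by blast
  show ?thesis
  proof (rule labelled_isoI)
    show "\<phi> ` vertices P = verts \<Gamma> (restrict_obj B (\<phi> ` vertices P))"
      by (rule restrict_obj_sel(1)[OF sub, symmetric])
    show "(x, y) \<in> arrows P \<longleftrightarrow> (\<phi> x, \<phi> y) \<in> arrs \<Gamma> (restrict_obj B (\<phi> ` vertices P))"
      if "x \<in> vertices P" "y \<in> vertices P" for x y
      using D(4)[OF that] restrict_obj_sel(2)[OF sub imageI[OF that(1)] imageI[OF that(2)]] by simp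
  qed (use D in simp_all)
qed

lemma isos_S_nonempty: "isos_S \<Gamma> A B \<noteq> {} \<longleftrightarrow> disjoint_union \<Gamma> A \<cong>\<^sub>q disjoint_union \<Gamma> B"
  unfolding isomorphic_def ex_in_conv[symmetric] isos_S_iff by simp

lemma iso_rel_S_iff:
  "(A, B) \<in> iso_rel_S \<Gamma> \<longleftrightarrow>
     A \<in> objects_S \<Gamma> \<and> B \<in> objects_S \<Gamma> \<and> disjoint_union \<Gamma> A \<cong>\<^sub>q disjoint_union \<Gamma> B"
  by (simp add: iso_rel_S_def isos_S_nonempty)

lemma isos_SD:
  assumes "f \<in> isos_S \<Gamma> A B"
  shows "f \<in> hom_S \<Gamma> A B" "Domain f = verts \<Gamma> A"
    "Range f = verts \<Gamma> B"
proof -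
  show "f \<in> hom_S \<Gamma> A B"
    using assms by (simp add: isos_S_def)
  from assms obtain \<phi> where \<phi>: "labelled_iso (disjoint_union \<Gamma> A) (disjoint_union \<Gamma> B) \<phi>"
    and f: "f = (\<lambda>x. (x, \<phi> x)) ` verts \<Gamma> A"
    unfolding isos_S_iff by blast
  show "Domain f = verts \<Gamma> A"
    unfolding f by blast
  show "Range f = verts \<Gamma> B"
    unfolding f labelled_isoD(3)[OF \<phi>, symmetric] by blast
qed

lemma isos_S_converse:
  assumes "f \<in> isos_S \<Gamma> A B"
  shows "f\<inverse> \<in> isos_S \<Gamma> B A"
proof -
  note D = isos_SD[OF assms]
  have "f O f\<inverse> = id_S \<Gamma> A" "f\<inverse> O f = id_S \<Gamma> B"
    unfolding id_S_def hom_S_self_comp[OF D(1)] by (simp_all only: D(2,3))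
  then show ?thesis
    unfolding isos_S_def using D(1) hom_S_converse[OF D(1)] by blast
qed

text \<open>
  The elementary content of a proto-exact sequence: \<open>f\<close> identifies \<open>A\<close> with a set of vertices of \<open>B\<close> that
  no arrow leaves, and \<open>g\<close> identifies the remaining vertices with \<open>C\<close>.
\<close>
definition exact_pair ::
    "nat quiver \<Rightarrow> obj \<Rightarrow> obj \<Rightarrow> obj \<Rightarrow> (nat \<times> nat) rel \<Rightarrow> (nat \<times> nat) rel \<Rightarrow> bool" where
  "exact_pair \<Gamma> A B C f g \<longleftrightarrow>
     f \<in> hom_S \<Gamma> A B \<and> g \<in> hom_S \<Gamma> B C \<and>
     Domain f = verts \<Gamma> A \<and> Range g = verts \<Gamma> C \<and>
     Range f \<inter> Domain g = {} \<and> Range f \<union> Domain g = verts \<Gamma> B \<and>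
     (\<forall>x\<in>Range f. \<forall>y\<in>Domain g. (x, y) \<notin> arrs \<Gamma> B)"

text \<open>
  An arrow \<open>v \<rightarrow> w\<close> is a path, so \<open>w \<preceq> v\<close>; the condition on basic monomorphisms thus makes the image
  closed under arrows.
\<close>
lemma admissible_monoD:
  assumes "admissible_mono \<Gamma> A B f"
  shows "f \<in> hom_S \<Gamma> A B" "Domain f = verts \<Gamma> A"
    "\<lbrakk>x \<in> Range f; (x, y) \<in> arrs \<Gamma> B\<rbrakk> \<Longrightarrow> y \<in> Range f"
proof -
  from assms obtain Js Hs \<alpha> \<beta> where JH: "list_all2 (basic_mono \<Gamma>) Js Hs"
    and \<alpha>: "\<alpha> \<in> isos_S \<Gamma> A Js" and \<beta>: "\<beta> \<in> isos_S \<Gamma> Hs B" and f: "f = \<alpha> O id_S \<Gamma> Js O \<beta>"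
    unfolding admissible_mono_def by blast
  have sub: "list_all2 (\<subseteq>) Js Hs"
    using JH by (rule list_all2_mono) (simp add: basic_mono_def)
  then have VJ: "verts \<Gamma> Js \<subseteq> verts \<Gamma> Hs"
    by (auto simp: list_all2_conv_all_nth subset_iff)
  show "f \<in> hom_S \<Gamma> A B"
    unfolding f using isos_SD(1)[OF \<alpha>] isos_SD(1)[OF \<beta>] id_S_hom(1)[OF sub] hom_S_comp by blast
  show "Domain f = verts \<Gamma> A"
  proof
    show "Domain f \<subseteq> verts \<Gamma> A"
      unfolding f using isos_SD(2)[OF \<alpha>] by blast
    show "verts \<Gamma> A \<subseteq> Domain f"
    proof
      fix x assume "x \<in> verts \<Gamma> A"
      then obtain y where y: "(x, y) \<in> \<alpha>" "y \<in> verts \<Gamma> Js"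
        using isos_SD(2,3)[OF \<alpha>] by blast
      then obtain z where "(y, z) \<in> \<beta>"
        using VJ isos_SD(2)[OF \<beta>] by blast
      with y show "x \<in> Domain f"
        unfolding f id_S_def by blast
    qed
  qed
  assume x: "x \<in> Range f" and xy: "(x, y) \<in> arrs \<Gamma> B"
  obtain \<phi> where \<phi>: "labelled_iso (disjoint_union \<Gamma> Hs) (disjoint_union \<Gamma> B) \<phi>"
    and \<beta>_eq: "\<beta> = (\<lambda>x. (x, \<phi> x)) ` verts \<Gamma> Hs"
    using \<beta> unfolding isos_S_iff by blast
  obtain x' where x': "x' \<in> verts \<Gamma> Js" "x = \<phi> x'"
    using x unfolding f \<beta>_eq id_S_def by blast
  have "y \<in> verts \<Gamma> B"
    using xy du_arrows_subset by blast
  then obtain y' where y': "y' \<in> verts \<Gamma> Hs" "y = \<phi> y'"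
    using labelled_isoD(3)[OF \<phi>] by blast
  have xy': "(x', y') \<in> arrs \<Gamma> Hs"
    using xy x' y' VJ labelled_isoD(6)[OF \<phi>] by blast
  obtain p v where p: "x' = (p, v)"
    by fastforce
  with xy' obtain w where w: "y' = (p, w)" "p < length Hs" "w \<in> Hs ! p" "(v, w) \<in> arrows \<Gamma>"
    by (cases y') auto
  have "basic_mono \<Gamma> (Js ! p) (Hs ! p)"
    using JH w(2) by (simp add: list_all2_conv_all_nth)
  moreover have "v \<in> Js ! p" "path_le \<Gamma> w v"
    using x'(1) p w(4) by (auto simp: path_le_def)
  ultimately have "w \<in> Js ! p"
    using w(3) unfolding basic_mono_def by blast
  then have "y' \<in> verts \<Gamma> Js"
    using w x'(1) p by simp
  then obtain x'' where "(x'', y') \<in> \<alpha>" "(y', y') \<in> id_S \<Gamma> Js"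
    using isos_SD(3)[OF \<alpha>] unfolding id_S_def by blast
  moreover have "(y', y) \<in> \<beta>"
    unfolding \<beta>_eq y'(2) using y'(1) by blast
  ultimately show "y \<in> Range f"
    unfolding f by blast
qed

lemma admissible_epiD:
  assumes "admissible_epi \<Gamma> B C g"
  shows "g \<in> hom_S \<Gamma> B C" "Range g = verts \<Gamma> C"
proof -
  from assms obtain Hs Ks \<alpha> \<beta> where HK: "list_all2 (basic_epi \<Gamma>) Hs Ks"
    and \<alpha>: "\<alpha> \<in> isos_S \<Gamma> B Hs" and \<beta>: "\<beta> \<in> isos_S \<Gamma> Ks C" and g: "g = \<alpha> O id_S \<Gamma> Ks O \<beta>"
    unfolding admissible_epi_def by blast
  have sub: "list_all2 (\<subseteq>) Ks Hs"
    using HK by (auto simp: basic_epi_def list_all2_conv_all_nth)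
  then have VK: "verts \<Gamma> Ks \<subseteq> verts \<Gamma> Hs"
    by (auto simp: list_all2_conv_all_nth subset_iff)
  show "g \<in> hom_S \<Gamma> B C"
    unfolding g using isos_SD(1)[OF \<alpha>] isos_SD(1)[OF \<beta>] id_S_hom(2)[OF sub] hom_S_comp by blast
  show "Range g = verts \<Gamma> C"
  proof
    show "Range g \<subseteq> verts \<Gamma> C"
      unfolding g using isos_SD(3)[OF \<beta>] by blast
    show "verts \<Gamma> C \<subseteq> Range g"
    proof
      fix x assume "x \<in> verts \<Gamma> C"
      then obtain y where y: "(y, x) \<in> \<beta>" "y \<in> verts \<Gamma> Ks"
        using isos_SD(2,3)[OF \<beta>] by blast
      then obtain z where "(z, y) \<in> \<alpha>"
        using VK isos_SD(3)[OF \<alpha>] by blast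
      with y show "x \<in> Range g"
        unfolding g id_S_def by blast
    qed
  qed
qed

text \<open>
  That \<open>B\<close> has no vertices besides those of \<open>A\<close> and \<open>C\<close> is read off from the pullback: the inclusion of
  a vertex outside the domain of \<open>g\<close> is killed by \<open>g\<close>, hence factors through \<open>f\<close>.
\<close>
lemma proto_exact_imp_exact_pair:
  assumes "proto_exact \<Gamma> A B C f g"
  shows "exact_pair \<Gamma> A B C f g"
proof -
  have mono: "admissible_mono \<Gamma> A B f" and epi: "admissible_epi \<Gamma> B C g" and B: "B \<in> objects_S \<Gamma>"
    and pb: "is_pullback \<Gamma> A B [] C f {} g {}"
    using assms by (auto simp: proto_exact_def)
  note M = admissible_monoD[OF mono] and E = admissible_epiD[OF epi]
  have fg: "f O g = {}"
    using pb by (simp add: is_pullback_def)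
  then have disj: "Range f \<inter> Domain g = {}"
    by blast
  have "y \<in> Range f \<union> Domain g" if y: "y \<in> verts \<Gamma> B" for y
  proof (rule ccontr)
    assume not: "y \<notin> Range f \<union> Domain g"
    obtain p v where pv: "y = (p, v)" "p < length B" "v \<in> B ! p"
      using y by (cases y) auto
    have T: "[{v}] \<in> objects_S \<Gamma>"
      using pv B by (auto simp: objects_S_def in_lists_conv_set)
    have u: "{((0, v), y)} \<in> hom_S \<Gamma> [{v}] B"
      using pv by (auto simp: hom_S_def single_valued_def)
    have zero: "{((0 :: nat, v), y)} O g = {} O {}"
      using not by blast
    have "\<forall>T\<in>objects_S \<Gamma>. \<forall>u\<in>hom_S \<Gamma> T B. \<forall>v\<in>hom_S \<Gamma> T []. u O g = v O {} \<longrightarrow>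
        (\<exists>!h. h \<in> hom_S \<Gamma> T A \<and> h O f = u \<and> h O {} = v)"
      using pb unfolding is_pullback_def by (elim conjE)
    from ex1_implies_ex[OF this[rule_format, OF T u empty_hom zero]]
    obtain h where "h O f = {((0 :: nat, v), y)}"
      by (elim exE conjE)
    then show False
      using not by blast
  qed
  moreover have "Range f \<union> Domain g \<subseteq> verts \<Gamma> B"
    using hom_SD(2)[OF M(1)] hom_SD(1)[OF E(1)] by blast
  ultimately have "Range f \<union> Domain g = verts \<Gamma> B"
    by blast
  moreover have "(x, y) \<notin> arrs \<Gamma> B" if "x \<in> Range f" "y \<in> Domain g" for x y
  proof
    assume "(x, y) \<in> arrs \<Gamma> B"
    then have "y \<in> Range f"
      using M(3) that(1) by blast
    with disj that(2) show False by blast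
  qed
  ultimately show ?thesis
    unfolding exact_pair_def using M(1,2) E disj by simp
qed

lemma relcomp_Id_on:
  "Range r \<subseteq> V \<Longrightarrow> r O Id_on V = r" "Domain r \<subseteq> V \<Longrightarrow> Id_on V O r = r"
  by auto

text \<open>
  The factorisations are \<open>u O f\<inverse>\<close> and \<open>g\<inverse> O u\<close>: a morphism killed by \<open>g\<close> has its range in that of \<open>f\<close>,
  and dually.
\<close>
lemma exact_pair_squares:
  assumes "exact_pair \<Gamma> A B C f g"
  shows "is_pullback \<Gamma> A B [] C f {} g {}" "is_pushout \<Gamma> A B [] C f {} g {}"
proof -
  note X = assms[unfolded exact_pair_def]
  have f: "f \<in> hom_S \<Gamma> A B" and g: "g \<in> hom_S \<Gamma> B C" and fg: "f O g = {}"
    using X by auto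
  have dom: "Domain f = verts \<Gamma> A" "Range g = verts \<Gamma> C"
    using X by auto
  note ff = hom_S_self_comp[OF f, unfolded dom] and gg = hom_S_self_comp[OF g, unfolded dom]
  have homD: "h O Id_on (verts \<Gamma> A') = h" "Id_on (verts \<Gamma> T) O h = h"
    if "h \<in> hom_S \<Gamma> T A'" for h T A'
  proof -
    have "Range h \<subseteq> verts \<Gamma> A'" "Domain h \<subseteq> verts \<Gamma> T"
      using hom_SD(1,2)[OF that] by blast+
    then show "h O Id_on (verts \<Gamma> A') = h" "Id_on (verts \<Gamma> T) O h = h"
      by (simp_all add: relcomp_Id_on)
  qed
  show "is_pullback \<Gamma> A B [] C f {} g {}"
    unfolding is_pullback_def
  proof (intro conjI ballI impI)
    fix T u v
    assume u: "u \<in> hom_S \<Gamma> T B" and v: "v \<in> hom_S \<Gamma> T []" and uv: "u O g = v O {}"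
    have "Range u \<subseteq> Range f"
    proof -
      have "Range u \<subseteq> verts \<Gamma> B"
        using hom_SD(2)[OF u] by blast
      moreover have "Range u \<inter> Domain g = {}"
        using uv by blast
      ultimately show ?thesis
        using X by blast
    qed
    then have "u O Id_on (Range f) = u"
      by (rule relcomp_Id_on)
    then have "(u O f\<inverse>) O f = u"
      by (simp add: O_assoc ff(2))
    moreover have "h = u O f\<inverse>" if "h \<in> hom_S \<Gamma> T A" "h O f = u" for h
      using that homD(1)[OF that(1)] ff(1) by (metis O_assoc)
    moreover have "u O f\<inverse> \<in> hom_S \<Gamma> T A"
      using u f hom_S_comp hom_S_converse by blast
    ultimately show "\<exists>!h. h \<in> hom_S \<Gamma> T A \<and> h O f = u \<and> h O {} = v"
      using v by (metis hom_zero(1) relcomp_empty2)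
  qed (use f g fg in auto)
  show "is_pushout \<Gamma> A B [] C f {} g {}"
    unfolding is_pushout_def
  proof (intro conjI ballI impI)
    fix T u v
    assume u: "u \<in> hom_S \<Gamma> B T" and v: "v \<in> hom_S \<Gamma> [] T" and uv: "f O u = {} O v"
    have "Domain u \<subseteq> Domain g"
    proof -
      have "Domain u \<subseteq> verts \<Gamma> B"
        using hom_SD(1)[OF u] by blast
      moreover have "Domain u \<inter> Range f = {}"
        using uv by blast
      ultimately show ?thesis
        using X by blast
    qed
    then have "Id_on (Domain g) O u = u"
      by (rule relcomp_Id_on)
    then have "g O (g\<inverse> O u) = u"
      by (simp add: O_assoc[symmetric] gg(1))
    moreover have "h = g\<inverse> O u" if "h \<in> hom_S \<Gamma> C T" "g O h = u" for h
      using that homD(2)[OF that(1)] gg(2) by (metis O_assoc)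
    moreover have "g\<inverse> O u \<in> hom_S \<Gamma> C T"
      using u g hom_S_comp hom_S_converse by blast
    ultimately show "\<exists>!h. h \<in> hom_S \<Gamma> C T \<and> g O h = u \<and> {} O h = v"
      using v by (metis hom_zero(2) relcomp_empty1)
  qed (use f g fg in auto)
qed

section \<open>Gluing\<close>

text \<open>
  With \<open>E\<close> a set of arrows from \<open>Q\<close> to \<open>P\<close>, this is the middle term of an extension of \<open>Q\<close> by \<open>P\<close>.
\<close>
definition glue ::
    "(nat \<times> nat) quiver \<Rightarrow> (nat \<times> nat) quiver \<Rightarrow> (nat \<times> nat) rel \<Rightarrow> (nat \<times> nat) quiver" where
  "glue P Q E = \<lparr> vertices = vertices P \<union> vertices Q, arrows = arrows P \<union> arrows Q \<union> E \<rparr>"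

lemma glue_sel [simp]:
  "vertices (glue P Q E) = vertices P \<union> vertices Q"
  "arrows (glue P Q E) = arrows P \<union> arrows Q \<union> E"
  by (simp_all add: glue_def)

definition wf_quiver :: "'a quiver \<Rightarrow> bool" where
  "wf_quiver P \<longleftrightarrow> arrows P \<subseteq> vertices P \<times> vertices P"

lemma wf_quiver_du [simp]: "wf_quiver (disjoint_union \<Gamma> A)"
  using du_arrows_subset by (simp add: wf_quiver_def)

definition separated :: "(nat \<times> nat) quiver \<Rightarrow> (nat \<times> nat) quiver \<Rightarrow> bool" where
  "separated P Q \<longleftrightarrow> wf_quiver P \<and> wf_quiver Q \<and> vertices P \<inter> vertices Q = {}"

lemma glue_arrows:
  assumes "separated P Q" "E \<subseteq> vertices Q \<times> vertices P"
  shows "x \<in> vertices P \<Longrightarrow> y \<in> vertices P \<Longrightarrow> (x, y) \<in> arrows (glue P Q E) \<longleftrightarrow> (x, y) \<in> arrows P"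
    and "x \<in> vertices Q \<Longrightarrow> y \<in> vertices Q \<Longrightarrow> (x, y) \<in> arrows (glue P Q E) \<longleftrightarrow> (x, y) \<in> arrows Q"
    and "x \<in> vertices Q \<Longrightarrow> y \<in> vertices P \<Longrightarrow> (x, y) \<in> arrows (glue P Q E) \<longleftrightarrow> (x, y) \<in> E"
    and "x \<in> vertices P \<Longrightarrow> y \<in> vertices Q \<Longrightarrow> (x, y) \<notin> arrows (glue P Q E)"
  using assms unfolding separated_def wf_quiver_def glue_sel by blast+

lemma glue_iso:
  fixes P Q :: "(nat \<times> nat) quiver" and F G :: "nat \<times> nat \<Rightarrow> nat \<times> nat"
  defines "\<theta> \<equiv> \<lambda>z. if z \<in> vertices P then F z else G z"
  assumes sep: "separated P Q"
    and F: "labelled_emb P R F" and G: "labelled_emb Q R G"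
    and disj: "F ` vertices P \<inter> G ` vertices Q = {}"
    and cover: "F ` vertices P \<union> G ` vertices Q = vertices R"
    and no_arrow: "\<And>x y. x \<in> vertices P \<Longrightarrow> y \<in> vertices Q \<Longrightarrow> (F x, G y) \<notin> arrows R"
    and E: "E \<subseteq> vertices Q \<times> vertices P"
      "\<And>x y. x \<in> vertices Q \<Longrightarrow> y \<in> vertices P \<Longrightarrow> (x, y) \<in> E \<longleftrightarrow> (G x, F y) \<in> arrows R"
  shows "labelled_iso (glue P Q E) R \<theta>"
proof (rule labelled_isoI)
  note DF = labelled_embD[OF F] and DG = labelled_embD[OF G] and A = glue_arrows[OF sep E(1)]
  have \<theta>P: "\<theta> z = F z" if "z \<in> vertices P" for z
    using that by (simp add: \<theta>_def)
  have \<theta>Q: "\<theta> z = G z" if "z \<in> vertices Q" for z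
    using that sep by (auto simp: \<theta>_def separated_def)
  have imP: "\<theta> ` vertices P = F ` vertices P" and imQ: "\<theta> ` vertices Q = G ` vertices Q"
    using \<theta>P \<theta>Q by (meson image_cong)+
  have "inj_on \<theta> (vertices P \<union> vertices Q)"
    unfolding inj_on_Un
  proof (intro conjI)
    show "inj_on \<theta> (vertices P)"
      using DF(1) inj_on_cong[of "vertices P" \<theta> F] \<theta>P by blast
    show "inj_on \<theta> (vertices Q)"
      using DG(1) inj_on_cong[of "vertices Q" \<theta> G] \<theta>Q by blast
    have "\<theta> ` (vertices P - vertices Q) \<subseteq> F ` vertices P" "\<theta> ` (vertices Q - vertices P) \<subseteq> G ` vertices Q"
      using imP imQ by blast+
    with disj show "\<theta> ` (vertices P - vertices Q) \<inter> \<theta> ` (vertices Q - vertices P) = {}"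
      by blast
  qed
  then show "inj_on \<theta> (vertices (glue P Q E))"
    by simp
  show "\<theta> ` vertices (glue P Q E) = vertices R"
    using imP imQ cover by (simp add: image_Un)
  show "label (\<theta> x) = label x" if "x \<in> vertices (glue P Q E)" for x
    using that DF(3) DG(3) \<theta>P \<theta>Q by (metis UnE glue_sel(1))
  fix x y assume "x \<in> vertices (glue P Q E)" "y \<in> vertices (glue P Q E)"
  then consider "x \<in> vertices P" "y \<in> vertices P" | "x \<in> vertices Q" "y \<in> vertices Q"
    | "x \<in> vertices Q" "y \<in> vertices P" | "x \<in> vertices P" "y \<in> vertices Q"
    unfolding glue_sel by blast
  then show "(x, y) \<in> arrows (glue P Q E) \<longleftrightarrow> (\<theta> x, \<theta> y) \<in> arrows R"
  proof cases
    case 1 then show ?thesis using A(1) DF(4) \<theta>P by metis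
  next
    case 2 then show ?thesis using A(2) DG(4) \<theta>Q by metis
  next
    case 3 then show ?thesis using A(3) E(2) \<theta>P \<theta>Q by metis
  next
    case 4 then show ?thesis using A(4) no_arrow \<theta>P \<theta>Q by metis
  qed
qed

lemma glue_isoD:
  assumes sep: "separated P Q" and E: "E \<subseteq> vertices Q \<times> vertices P"
    and \<theta>: "labelled_iso (glue P Q E) R \<theta>"
  shows "labelled_emb P R \<theta>" "labelled_emb Q R \<theta>"
    and "\<theta> ` vertices P \<inter> \<theta> ` vertices Q = {}"
    and "\<theta> ` vertices P \<union> \<theta> ` vertices Q = vertices R"
    and "x \<in> vertices P \<Longrightarrow> y \<in> vertices Q \<Longrightarrow> (\<theta> x, \<theta> y) \<notin> arrows R"
    and "x \<in> vertices Q \<Longrightarrow> y \<in> vertices P \<Longrightarrow> (x, y) \<in> E \<longleftrightarrow> (\<theta> x, \<theta> y) \<in> arrows R"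
proof -
  note D = labelled_isoD[OF \<theta>, unfolded glue_sel(1)] and A = glue_arrows[OF sep E]
  have inj: "inj_on \<theta> (vertices P)" "inj_on \<theta> (vertices Q)"
    using D(2) by (auto simp: inj_on_Un)
  show "labelled_emb P R \<theta>"
    unfolding labelled_emb_def using inj D(4,5,6) A(1) by (auto simp del: glue_sel)
  show "labelled_emb Q R \<theta>"
    unfolding labelled_emb_def using inj D(4,5,6) A(2) by (auto simp del: glue_sel)
  show "\<theta> ` vertices P \<inter> \<theta> ` vertices Q = {}"
    using inj_on_image_Int[OF D(2), of "vertices P" "vertices Q"] sep by (simp add: separated_def)
  show "\<theta> ` vertices P \<union> \<theta> ` vertices Q = vertices R"
    using D(3) by (simp add: image_Un)
  show "x \<in> vertices P \<Longrightarrow> y \<in> vertices Q \<Longrightarrow> (\<theta> x, \<theta> y) \<notin> arrows R"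
    using A(4) D(6) by (metis UnCI)
  show "x \<in> vertices Q \<Longrightarrow> y \<in> vertices P \<Longrightarrow> (x, y) \<in> E \<longleftrightarrow> (\<theta> x, \<theta> y) \<in> arrows R"
    using A(3) D(6) by (metis UnCI)
qed

lemma glue_exact_pair:
  assumes sep: "separated P Q" and E: "E \<subseteq> vertices Q \<times> vertices P"
    and \<theta>: "labelled_iso (glue P Q E) (disjoint_union \<Gamma> B) \<theta>"
    and \<phi>1: "labelled_iso (disjoint_union \<Gamma> A) P \<phi>1"
    and \<phi>2: "labelled_iso (disjoint_union \<Gamma> C) Q \<phi>2"
  shows "exact_pair \<Gamma> A B C
    ((\<lambda>x. (x, (\<theta> \<circ> \<phi>1) x)) ` verts \<Gamma> A)
    (((\<lambda>x. (x, (\<theta> \<circ> \<phi>2) x)) ` verts \<Gamma> C)\<inverse>)" (is "exact_pair _ _ _ _ ?f ?g")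
proof -
  note D = glue_isoD[OF sep E \<theta>]
  have e1: "labelled_emb (disjoint_union \<Gamma> A) P \<phi>1" and e2: "labelled_emb (disjoint_union \<Gamma> C) Q \<phi>2"
    using \<phi>1 \<phi>2 by (simp_all add: labelled_iso_iff_emb)
  have f: "?f \<in> hom_S \<Gamma> A B"
    by (rule graph_hom, rule labelled_emb_comp[OF e1 D(1)])
  have g: "?g \<in> hom_S \<Gamma> B C"
    by (rule hom_S_converse, rule graph_hom, rule labelled_emb_comp[OF e2 D(2)])
  have rf: "Range ?f = \<theta> ` vertices P"
    unfolding Range_graph labelled_isoD(3)[OF \<phi>1, symmetric] image_comp ..
  have dg: "Domain ?g = \<theta> ` vertices Q"
    unfolding Domain_converse Range_graph labelled_isoD(3)[OF \<phi>2, symmetric] image_comp ..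
  have "Domain ?f = verts \<Gamma> A" "Range ?g = verts \<Gamma> C"
    by (simp_all only: Range_converse Domain_graph)
  with f g D(3,4,5) show ?thesis
    unfolding exact_pair_def rf dg by (simp add: ball_simps)
qed

text \<open>
  Fix copies \<open>P\<close> of \<open>A\<close> and \<open>Q\<close> of \<open>C\<close> with disjoint vertices. The maps of an exact pair then assemble to
  an isomorphism \<open>\<theta>\<close> from a gluing of \<open>P\<close> and \<open>Q\<close> to the middle term, where \<open>E\<close> is pulled back along \<open>\<theta>\<close>.
  Together with \<open>glue_exact_pair\<close> this turns exact pairs into pairs \<open>(E, \<theta>)\<close>.
\<close>
lemma exact_pair_glue:
  assumes ex: "exact_pair \<Gamma> A B C f g" and sep: "separated P Q"
    and \<phi>1: "labelled_iso (disjoint_union \<Gamma> A) P \<phi>1"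
    and \<phi>2: "labelled_iso (disjoint_union \<Gamma> C) Q \<phi>2"
  obtains E \<theta> where "E \<subseteq> vertices Q \<times> vertices P" "labelled_iso (glue P Q E) (disjoint_union \<Gamma> B) \<theta>"
    "f = (\<lambda>x. (x, (\<theta> \<circ> \<phi>1) x)) ` verts \<Gamma> A"
    "g = ((\<lambda>x. (x, (\<theta> \<circ> \<phi>2) x)) ` verts \<Gamma> C)\<inverse>"
proof -
  note X = ex[unfolded exact_pair_def]
  have f: "f \<in> hom_S \<Gamma> A B" "Domain f = verts \<Gamma> A"
    and g: "g\<inverse> \<in> hom_S \<Gamma> C B" "Domain (g\<inverse>) = verts \<Gamma> C"
    using X hom_S_converse by auto
  obtain F where F: "labelled_emb (disjoint_union \<Gamma> A) (disjoint_union \<Gamma> B) F"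
    and f_eq: "f = (\<lambda>x. (x, F x)) ` verts \<Gamma> A"
    using total_hom_graph[OF f] .
  obtain G where G: "labelled_emb (disjoint_union \<Gamma> C) (disjoint_union \<Gamma> B) G"
    and g_eq: "g\<inverse> = (\<lambda>x. (x, G x)) ` verts \<Gamma> C"
    using total_hom_graph[OF g] .
  define \<psi>1 where "\<psi>1 = inv_into (verts \<Gamma> A) \<phi>1"
  define \<psi>2 where "\<psi>2 = inv_into (verts \<Gamma> C) \<phi>2"
  have \<psi>1: "labelled_iso P (disjoint_union \<Gamma> A) \<psi>1" and \<psi>2: "labelled_iso Q (disjoint_union \<Gamma> C) \<psi>2"
    unfolding \<psi>1_def \<psi>2_def using \<phi>1 \<phi>2 by (simp_all add: labelled_iso_inv)
  have inv1: "\<psi>1 (\<phi>1 x) = x" if "x \<in> verts \<Gamma> A" for x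
    unfolding \<psi>1_def using labelled_isoD(2)[OF \<phi>1] that by simp
  have inv2: "\<psi>2 (\<phi>2 x) = x" if "x \<in> verts \<Gamma> C" for x
    unfolding \<psi>2_def using labelled_isoD(2)[OF \<phi>2] that by simp
  define E where "E = {(x, y). x \<in> vertices Q \<and> y \<in> vertices P \<and>
    ((G \<circ> \<psi>2) x, (F \<circ> \<psi>1) y) \<in> arrs \<Gamma> B}"
  define \<theta> where "\<theta> = (\<lambda>z. if z \<in> vertices P then (F \<circ> \<psi>1) z else (G \<circ> \<psi>2) z)"
  have imF: "(F \<circ> \<psi>1) ` vertices P = Range f" and imG: "(G \<circ> \<psi>2) ` vertices Q = Domain g"
  proof -
    have "Range f = F ` verts \<Gamma> A"
      unfolding f_eq Range_graph ..
    then show "(F \<circ> \<psi>1) ` vertices P = Range f"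
      using labelled_isoD(3)[OF \<psi>1] by (metis image_comp)
    have "Domain g = Range (g\<inverse>)"
      by blast
    also have "\<dots> = G ` verts \<Gamma> C"
      unfolding g_eq Range_graph ..
    finally show "(G \<circ> \<psi>2) ` vertices Q = Domain g"
      using labelled_isoD(3)[OF \<psi>2] by (metis image_comp)
  qed
  have E_sub: "E \<subseteq> vertices Q \<times> vertices P"
    unfolding E_def by blast
  have iso: "labelled_iso (glue P Q E) (disjoint_union \<Gamma> B) \<theta>"
    unfolding \<theta>_def
  proof (rule glue_iso[OF sep _ _ _ _ _ E_sub])
    show "labelled_emb P (disjoint_union \<Gamma> B) (F \<circ> \<psi>1)" "labelled_emb Q (disjoint_union \<Gamma> B) (G \<circ> \<psi>2)"
      using \<psi>1 \<psi>2 by (simp_all add: labelled_iso_iff_emb labelled_emb_comp[OF _ F] labelled_emb_comp[OF _ G])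
    show "(F \<circ> \<psi>1) ` vertices P \<inter> (G \<circ> \<psi>2) ` vertices Q = {}"
      "(F \<circ> \<psi>1) ` vertices P \<union> (G \<circ> \<psi>2) ` vertices Q = verts \<Gamma> B"
      unfolding imF imG using X by blast+
    show "((F \<circ> \<psi>1) x, (G \<circ> \<psi>2) y) \<notin> arrs \<Gamma> B"
      if "x \<in> vertices P" "y \<in> vertices Q" for x y
    proof -
      have "(F \<circ> \<psi>1) x \<in> Range f" "(G \<circ> \<psi>2) y \<in> Domain g"
        using that imF imG by blast+
      with X show ?thesis by blast
    qed
  qed (simp add: E_def)
  have "f = (\<lambda>x. (x, (\<theta> \<circ> \<phi>1) x)) ` verts \<Gamma> A"
    unfolding f_eq
  proof (rule graph_cong)
    fix x assume "x \<in> verts \<Gamma> A"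
    then show "F x = (\<theta> \<circ> \<phi>1) x"
      using inv1 labelled_isoD(4)[OF \<phi>1] by (simp add: \<theta>_def)
  qed
  moreover have g_eq': "g\<inverse> = (\<lambda>x. (x, (\<theta> \<circ> \<phi>2) x)) ` verts \<Gamma> C"
    unfolding g_eq
  proof (rule graph_cong)
    fix x assume x: "x \<in> verts \<Gamma> C"
    have "\<phi>2 x \<notin> vertices P"
      using labelled_isoD(4)[OF \<phi>2 x] sep unfolding separated_def by blast
    then show "G x = (\<theta> \<circ> \<phi>2) x"
      using inv2[OF x] by (simp add: \<theta>_def)
  qed
  have "g = ((\<lambda>x. (x, (\<theta> \<circ> \<phi>2) x)) ` verts \<Gamma> C)\<inverse>"
    unfolding g_eq'[symmetric] by (rule converse_converse[symmetric])
  ultimately show thesis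
    using that[OF E_sub iso] by blast
qed

text \<open>
  Admissibility of \<open>J \<subseteq> H\<close> refers to paths of the whole quiver, which may leave \<open>H\<close>. On a convex \<open>H\<close> it is
  the same to be closed under single arrows inside \<open>H\<close>.
\<close>
definition path_convex :: "nat quiver \<Rightarrow> nat set \<Rightarrow> bool" where
  "path_convex \<Gamma> H \<longleftrightarrow>
     (\<forall>J a b. J \<subseteq> H \<longrightarrow> (\<forall>x\<in>J. \<forall>y\<in>H. (x, y) \<in> arrows \<Gamma> \<longrightarrow> y \<in> J) \<longrightarrow>
        a \<in> J \<longrightarrow> b \<in> H \<longrightarrow> (a, b) \<in> (arrows \<Gamma>)\<^sup>* \<longrightarrow> b \<in> J)"

text \<open>
  The middle term is taken as it stands; only \<open>A\<close> and \<open>C\<close> are replaced by the sublists of \<open>B\<close> that they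
  occupy. The isomorphisms that the definition of admissibility allows for are then \<open>f\<close> and \<open>g\<close> themselves.
\<close>
lemma exact_pair_imp_proto_exact:
  assumes ex: "exact_pair \<Gamma> A B C f g"
    and obj: "A \<in> objects_S \<Gamma>" "B \<in> objects_S \<Gamma>" "C \<in> objects_S \<Gamma>"
    and convex: "\<And>H. H \<in> set B \<Longrightarrow> path_convex \<Gamma> H"
  shows "proto_exact \<Gamma> A B C f g"
proof -
  note X = ex[unfolded exact_pair_def]
  have f: "f \<in> hom_S \<Gamma> A B" and g: "g \<in> hom_S \<Gamma> B C"
    using X by auto
  have sub: "Range f \<subseteq> verts \<Gamma> B" "Domain g \<subseteq> verts \<Gamma> B"
    using X by auto
  define Js where "Js = restrict_obj B (Range f)"
  define Ks where "Ks = restrict_obj B (Domain g)"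
  note VJ = restrict_obj_sel(1)[OF sub(1), folded Js_def]
    and VK = restrict_obj_sel(1)[OF sub(2), folded Ks_def]
  have verts: "B ! p \<subseteq> vertices \<Gamma>" "path_convex \<Gamma> (B ! p)" if "p < length B" for p
    using obj(2) convex that by (auto simp: objects_S_def in_lists_conv_set)
  have closed: "w \<in> Js ! p" if "p < length B" "v \<in> Js ! p" "w \<in> B ! p" "(v, w) \<in> arrows \<Gamma>" for p v w
  proof -
    have v: "v \<in> B ! p" "(p, v) \<in> Range f"
      using that by (auto simp: Js_def restrict_obj_nth)
    have "((p, v), (p, w)) \<in> arrs \<Gamma> B"
      using that v by simp
    then have "(p, w) \<notin> Domain g"
      using X v(2) by blast
    moreover have "(p, w) \<in> verts \<Gamma> B"
      using that by simp
    ultimately have "(p, w) \<in> Range f"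
      using X by blast
    with that show ?thesis
      by (simp add: Js_def restrict_obj_nth)
  qed
  have path_closed: "w \<in> Js ! p" if "p < length B" "v \<in> Js ! p" "w \<in> B ! p" "(v, w) \<in> (arrows \<Gamma>)\<^sup>*" for p v w
  proof -
    have "Js ! p \<subseteq> B ! p"
      using that(1) by (auto simp: Js_def restrict_obj_nth)
    with verts(2)[OF that(1)] closed[OF that(1)] that(2-4) show ?thesis
      unfolding path_convex_def by meson
  qed
  have mono: "list_all2 (basic_mono \<Gamma>) Js B"
    unfolding list_all2_conv_all_nth
  proof (intro conjI allI impI)
    show "length Js = length B"
      by (simp add: Js_def restrict_obj_nth)
    fix p assume "p < length Js"
    then have p: "p < length B"
      by (simp add: Js_def restrict_obj_nth)
    have "Js ! p \<subseteq> B ! p"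
      using p by (auto simp: Js_def restrict_obj_nth)
    then show "basic_mono \<Gamma> (Js ! p) (B ! p)"
      unfolding basic_mono_def path_le_def using verts(1)[OF p] path_closed[OF p] by blast
  qed
  have JK: "v \<in> Ks ! p \<longleftrightarrow> v \<notin> Js ! p" if "p < length B" "v \<in> B ! p" for p v
  proof -
    have "(p, v) \<in> verts \<Gamma> B"
      using that by simp
    then have "(p, v) \<in> Domain g \<longleftrightarrow> (p, v) \<notin> Range f"
      using X by blast
    with that show ?thesis
      by (simp add: Js_def Ks_def restrict_obj_nth)
  qed
  have epi: "list_all2 (basic_epi \<Gamma>) B Ks"
    unfolding list_all2_conv_all_nth
  proof (intro conjI allI impI)
    show "length B = length Ks"
      by (simp add: Ks_def restrict_obj_nth)
    fix p assume p: "p < length B"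
    have KB: "Ks ! p \<subseteq> B ! p"
      using p by (auto simp: Ks_def restrict_obj_nth)
    have "b \<in> Ks ! p" if "a \<in> Ks ! p" "b \<in> B ! p" "(b, a) \<in> (arrows \<Gamma>)\<^sup>*" for a b
    proof -
      have "a \<in> B ! p"
        using KB that(1) by blast
      then show ?thesis
        using path_closed[OF p _ _ that(3)] JK[OF p] that(1,2) by blast
    qed
    then show "basic_epi \<Gamma> (B ! p) (Ks ! p)"
      unfolding basic_epi_def path_le_def using KB verts(1)[OF p] by blast
  qed
  have id_B: "id_S \<Gamma> B \<in> isos_S \<Gamma> B B"
  proof -
    have "id_S \<Gamma> B \<in> hom_S \<Gamma> B B"
      by (rule id_S_hom) (simp add: list_all2_refl)
    moreover have "id_S \<Gamma> B O id_S \<Gamma> B = id_S \<Gamma> B"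
      unfolding id_S_def by blast
    ultimately show ?thesis
      unfolding isos_S_def by blast
  qed
  have fJ: "f \<in> isos_S \<Gamma> A Js"
  proof -
    obtain F where F: "labelled_emb (disjoint_union \<Gamma> A) (disjoint_union \<Gamma> B) F"
      "f = (\<lambda>x. (x, F x)) ` verts \<Gamma> A"
      using total_hom_graph[OF f] X by blast
    from labelled_emb_restrict[OF F(1)] F(2) show ?thesis
      unfolding isos_S_iff Js_def F(2) Range_graph by blast
  qed
  have gK: "g \<in> isos_S \<Gamma> Ks C"
  proof -
    have g': "g\<inverse> \<in> hom_S \<Gamma> C B" "Domain (g\<inverse>) = verts \<Gamma> C"
      using hom_S_converse[OF g] X by simp_all
    obtain G where G: "labelled_emb (disjoint_union \<Gamma> C) (disjoint_union \<Gamma> B) G"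
      "g\<inverse> = (\<lambda>x. (x, G x)) ` verts \<Gamma> C"
      by (rule total_hom_graph[OF g'])
    have "Domain g = G ` verts \<Gamma> C"
      unfolding Range_converse[symmetric] G(2) Range_graph ..
    then have "g\<inverse> \<in> isos_S \<Gamma> C Ks"
      using labelled_emb_restrict[OF G(1)] G(2) unfolding isos_S_iff Ks_def by auto
    from isos_S_converse[OF this] show ?thesis
      by simp
  qed
  have "f = f O id_S \<Gamma> Js O id_S \<Gamma> B"
  proof -
    have "Range f \<subseteq> verts \<Gamma> B"
      using X by blast
    then show ?thesis
      by (simp add: id_S_def relcomp_Id_on VJ O_assoc[symmetric])
  qed
  then have "admissible_mono \<Gamma> A B f"
    unfolding admissible_mono_def using mono fJ id_B by blast
  moreover have "g = id_S \<Gamma> B O id_S \<Gamma> Ks O g"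
  proof -
    have "Domain g \<subseteq> verts \<Gamma> B"
      using X by blast
    then show ?thesis
      by (simp add: id_S_def relcomp_Id_on VK)
  qed
  then have "admissible_epi \<Gamma> B C g"
    unfolding admissible_epi_def using epi gK id_B by blast
  ultimately show ?thesis
    unfolding proto_exact_def using obj exact_pair_squares[OF ex] by blast
qed

section \<open>Counting extensions\<close>

text \<open>
  The arrows of the middle term that lead from the quotient to the subobject, seen on the chosen copies
  of \<open>C\<close> and \<open>A\<close>. This is the invariant that classifies extensions.
\<close>
definition link ::
    "nat quiver \<Rightarrow> (nat \<times> nat \<Rightarrow> nat \<times> nat) \<Rightarrow> (nat \<times> nat \<Rightarrow> nat \<times> nat) \<Rightarrow>
     obj \<times> (nat \<times> nat) rel \<times> (nat \<times> nat) rel \<Rightarrow> (nat \<times> nat) rel" where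
  "link \<Gamma> \<phi>1 \<phi>2 = (\<lambda>(B, f, g). {(\<phi>2 c, \<phi>1 a) | c a.
     \<exists>x y. (x, c) \<in> g \<and> (a, y) \<in> f \<and> (x, y) \<in> arrows (disjoint_union \<Gamma> B)})"

lemma link_glue:
  assumes sep: "separated P Q" and E: "E \<subseteq> vertices Q \<times> vertices P"
    and \<theta>: "labelled_iso (glue P Q E) (disjoint_union \<Gamma> B) \<theta>"
    and \<phi>1: "labelled_iso (disjoint_union \<Gamma> A) P \<phi>1"
    and \<phi>2: "labelled_iso (disjoint_union \<Gamma> C) Q \<phi>2"
  shows "link \<Gamma> \<phi>1 \<phi>2 (B, (\<lambda>x. (x, (\<theta> \<circ> \<phi>1) x)) ` vertices (disjoint_union \<Gamma> A),
    ((\<lambda>x. (x, (\<theta> \<circ> \<phi>2) x)) ` vertices (disjoint_union \<Gamma> C))\<inverse>) = E" (is "?L = E")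
proof -
  note D1 = labelled_isoD[OF \<phi>1] and D2 = labelled_isoD[OF \<phi>2]
  have key: "(\<phi>2 c, \<phi>1 a) \<in> E \<longleftrightarrow> (\<theta> (\<phi>2 c), \<theta> (\<phi>1 a)) \<in> arrows (disjoint_union \<Gamma> B)"
    if "c \<in> vertices (disjoint_union \<Gamma> C)" "a \<in> vertices (disjoint_union \<Gamma> A)" for a c
    using glue_isoD(6)[OF sep E \<theta> D2(4)[OF that(1)] D1(4)[OF that(2)]] .
  have L: "?L = {(\<phi>2 c, \<phi>1 a) | c a. c \<in> vertices (disjoint_union \<Gamma> C) \<and>
      a \<in> vertices (disjoint_union \<Gamma> A) \<and> (\<theta> (\<phi>2 c), \<theta> (\<phi>1 a)) \<in> arrows (disjoint_union \<Gamma> B)}"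
    unfolding link_def split by (simp only: image_iff converse_iff prod.inject comp_apply) blast
  show ?thesis
  proof
    show "?L \<subseteq> E"
      unfolding L using key by blast
    show "E \<subseteq> ?L"
    proof
      fix e assume e: "e \<in> E"
      with E obtain c a where ca: "e = (\<phi>2 c, \<phi>1 a)" "c \<in> vertices (disjoint_union \<Gamma> C)"
        "a \<in> vertices (disjoint_union \<Gamma> A)"
        unfolding D1(3)[symmetric] D2(3)[symmetric] by blast
      with key e show "e \<in> ?L"
        unfolding L by blast
    qed
  qed
qed

lemma card_quotient_kernel:
  "card (S // {(s, s'). s \<in> S \<and> s' \<in> S \<and> h s = h s'}) = card (h ` S)"
proof -
  have "S // {(s, s'). s \<in> S \<and> s' \<in> S \<and> h s = h s'} = (\<lambda>t. {s \<in> S. h s = t}) ` h ` S"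
  proof -
    have "{(s, s'). s \<in> S \<and> s' \<in> S \<and> h s = h s'} `` {s} = {s' \<in> S. h s' = h s}" if "s \<in> S" for s
      using that by auto
    then show ?thesis
      by (simp add: quotient_def image_image UNION_singleton_eq_range)
  qed
  moreover have "inj_on (\<lambda>t. {s \<in> S. h s = t}) (h ` S)"
    by (auto simp: inj_on_def)
  ultimately show ?thesis
    by (simp add: card_image)
qed

text \<open>
  Middle terms of extensions are only determined up to isomorphism, so it is enough that every object
  has one presentation by convex sets.
\<close>
locale convex_quiver =
  fixes \<Gamma> :: "nat quiver"
  assumes finite_vertices: "finite (vertices \<Gamma>)"
    and convex_decomposition: "A \<in> objects_S \<Gamma> \<Longrightarrow>
      \<exists>B\<in>objects_S \<Gamma>. (\<forall>H\<in>set B. path_convex \<Gamma> H) \<and> disjoint_union \<Gamma> A \<cong>\<^sub>q disjoint_union \<Gamma> B"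
begin

abbreviation "du \<equiv> disjoint_union \<Gamma>"

definition valid :: "(nat \<times> nat) quiver \<Rightarrow> bool" where
  "valid Q \<longleftrightarrow> (\<exists>B\<in>objects_S \<Gamma>. du B \<cong>\<^sub>q Q)"

definition extensions :: "(nat \<times> nat) quiver \<Rightarrow> (nat \<times> nat) quiver \<Rightarrow> (nat \<times> nat) rel set" where
  "extensions P Q = {E. E \<subseteq> vertices Q \<times> vertices P \<and> valid (glue P Q E)}"

text \<open>
  Every admissible set of arrows is realised by a sequence: present the glued quiver by convex sets,
  on which every exact pair is proto-exact.
\<close>
lemma link_ext_sequences:
  assumes sep: "separated P Q" and B: "B \<in> objects_S \<Gamma>"
    and A: "A \<in> objects_S \<Gamma>" and C: "C \<in> objects_S \<Gamma>"
    and \<phi>1: "labelled_iso (du A) P \<phi>1" and \<phi>2: "labelled_iso (du C) Q \<phi>2"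
  shows "link \<Gamma> \<phi>1 \<phi>2 ` ext_sequences \<Gamma> C A B = {E \<in> extensions P Q. glue P Q E \<cong>\<^sub>q du B}"
proof
  show "link \<Gamma> \<phi>1 \<phi>2 ` ext_sequences \<Gamma> C A B \<subseteq> {E \<in> extensions P Q. glue P Q E \<cong>\<^sub>q du B}"
  proof
    fix E assume "E \<in> link \<Gamma> \<phi>1 \<phi>2 ` ext_sequences \<Gamma> C A B"
    then obtain B' f g where E: "E = link \<Gamma> \<phi>1 \<phi>2 (B', f, g)"
      and ex: "proto_exact \<Gamma> A B' C f g" and iso: "(B', B) \<in> iso_rel_S \<Gamma>"
      unfolding ext_sequences_def by blast
    obtain E' \<theta> where E': "E' \<subseteq> vertices Q \<times> vertices P" "labelled_iso (glue P Q E') (du B') \<theta>"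
      and fg: "f = (\<lambda>x. (x, (\<theta> \<circ> \<phi>1) x)) ` vertices (du A)"
        "g = ((\<lambda>x. (x, (\<theta> \<circ> \<phi>2) x)) ` vertices (du C))\<inverse>"
      using exact_pair_glue[OF proto_exact_imp_exact_pair[OF ex] sep \<phi>1 \<phi>2] .
    have "E = E'"
      unfolding E fg by (rule link_glue[OF sep E' \<phi>1 \<phi>2])
    moreover have "glue P Q E' \<cong>\<^sub>q du B"
      using E'(2) iso isomorphic_trans unfolding iso_rel_S_iff isomorphic_def[of "glue P Q E'" "du B'"] 
      by (metis isomorphic_def)
    ultimately show "E \<in> {E \<in> extensions P Q. glue P Q E \<cong>\<^sub>q du B}"
      using E'(1) B isomorphic_sym unfolding extensions_def valid_def by blast
  qed
  show "{E \<in> extensions P Q. glue P Q E \<cong>\<^sub>q du B} \<subseteq> link \<Gamma> \<phi>1 \<phi>2 ` ext_sequences \<Gamma> C A B"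
  proof
    fix E assume "E \<in> {E \<in> extensions P Q. glue P Q E \<cong>\<^sub>q du B}"
    then have E: "E \<subseteq> vertices Q \<times> vertices P" and iso: "glue P Q E \<cong>\<^sub>q du B"
      by (simp_all add: extensions_def)
    obtain B' where B': "B' \<in> objects_S \<Gamma>" "\<And>H. H \<in> set B' \<Longrightarrow> path_convex \<Gamma> H" "du B \<cong>\<^sub>q du B'"
      using convex_decomposition[OF B] by blast
    then obtain \<theta> where \<theta>: "labelled_iso (glue P Q E) (du B') \<theta>"
      using isomorphic_trans[OF iso B'(3)] unfolding isomorphic_def by blast
    define f where "f = (\<lambda>x. (x, (\<theta> \<circ> \<phi>1) x)) ` vertices (du A)"
    define g where "g = ((\<lambda>x. (x, (\<theta> \<circ> \<phi>2) x)) ` vertices (du C))\<inverse>"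
    have "exact_pair \<Gamma> A B' C f g"
      unfolding f_def g_def by (rule glue_exact_pair[OF sep E \<theta> \<phi>1 \<phi>2])
    then have "proto_exact \<Gamma> A B' C f g"
      using A B'(1) C B'(2) by (rule exact_pair_imp_proto_exact)
    moreover have "(B', B) \<in> iso_rel_S \<Gamma>"
      unfolding iso_rel_S_iff using B B'(1) isomorphic_sym[OF B'(3)] by blast
    ultimately have "(B', f, g) \<in> ext_sequences \<Gamma> C A B"
      by (simp add: ext_sequences_def)
    moreover have "link \<Gamma> \<phi>1 \<phi>2 (B', f, g) = E"
      unfolding f_def g_def by (rule link_glue[OF sep E \<theta> \<phi>1 \<phi>2])
    ultimately show "E \<in> link \<Gamma> \<phi>1 \<phi>2 ` ext_sequences \<Gamma> C A B"
      by blast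
  qed
qed

text \<open>
  If the links agree, both middle terms are isomorphic to the same gluing by \<open>\<theta>1\<close> and \<open>\<theta>2\<close>, and \<open>\<theta>2\<close>
  after the inverse of \<open>\<theta>1\<close> is an equivalence. Conversely an equivalence preserves arrows.
\<close>
lemma ext_equiv_iff_link:
  assumes sep: "separated P Q"
    and \<phi>1: "labelled_iso (du A) P \<phi>1" and \<phi>2: "labelled_iso (du C) Q \<phi>2"
  shows "ext_equiv \<Gamma> C A B = {(s, s'). s \<in> ext_sequences \<Gamma> C A B \<and> s' \<in> ext_sequences \<Gamma> C A B \<and>
    link \<Gamma> \<phi>1 \<phi>2 s = link \<Gamma> \<phi>1 \<phi>2 s'}"
proof -
  have "(\<exists>\<phi>\<in>isos_S \<Gamma> B1 B2. f1 O \<phi> = f2 \<and> \<phi> O g2 = g1) \<longleftrightarrow>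
      link \<Gamma> \<phi>1 \<phi>2 (B1, f1, g1) = link \<Gamma> \<phi>1 \<phi>2 (B2, f2, g2)" (is "?equiv \<longleftrightarrow> ?link")
    if s: "(B1, f1, g1) \<in> ext_sequences \<Gamma> C A B" "(B2, f2, g2) \<in> ext_sequences \<Gamma> C A B"
    for B1 f1 g1 B2 f2 g2
  proof -
    have ex: "exact_pair \<Gamma> A B1 C f1 g1" "exact_pair \<Gamma> A B2 C f2 g2"
      using s proto_exact_imp_exact_pair unfolding ext_sequences_def by blast+
    obtain E1 \<theta>1 where 1: "E1 \<subseteq> vertices Q \<times> vertices P" "labelled_iso (glue P Q E1) (du B1) \<theta>1"
      and fg1: "f1 = (\<lambda>x. (x, (\<theta>1 \<circ> \<phi>1) x)) ` vertices (du A)"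
        "g1 = ((\<lambda>x. (x, (\<theta>1 \<circ> \<phi>2) x)) ` vertices (du C))\<inverse>"
      using exact_pair_glue[OF ex(1) sep \<phi>1 \<phi>2] .
    obtain E2 \<theta>2 where 2: "E2 \<subseteq> vertices Q \<times> vertices P" "labelled_iso (glue P Q E2) (du B2) \<theta>2"
      and fg2: "f2 = (\<lambda>x. (x, (\<theta>2 \<circ> \<phi>1) x)) ` vertices (du A)"
        "g2 = ((\<lambda>x. (x, (\<theta>2 \<circ> \<phi>2) x)) ` vertices (du C))\<inverse>"
      using exact_pair_glue[OF ex(2) sep \<phi>1 \<phi>2] .
    have link: "link \<Gamma> \<phi>1 \<phi>2 (B1, f1, g1) = E1" "link \<Gamma> \<phi>1 \<phi>2 (B2, f2, g2) = E2"
      unfolding fg1 fg2 by (rule link_glue[OF sep 1 \<phi>1 \<phi>2], rule link_glue[OF sep 2 \<phi>1 \<phi>2])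
    \<comment> \<open>An equivalence is an isomorphism of the middle terms that carries \<open>\<theta>1\<close> to \<open>\<theta>2\<close>.\<close>
    have graph: "(f1 O \<phi> = f2 \<and> \<phi> O g2 = g1) \<longleftrightarrow> (\<forall>z\<in>vertices P \<union> vertices Q. \<psi> (\<theta>1 z) = \<theta>2 z)"
      if \<psi>: "labelled_iso (du B1) (du B2) \<psi>" and \<phi>: "\<phi> = (\<lambda>x. (x, \<psi> x)) ` vertices (du B1)" for \<phi> \<psi>
    proof -
      have iso: "\<phi> \<in> isos_S \<Gamma> B1 B2"
        unfolding isos_S_iff using \<psi> \<phi> by blast
      have A: "(\<theta>1 \<circ> \<phi>1) a \<in> vertices (du B1)" if "a \<in> vertices (du A)" for a
        using labelled_isoD(4)[OF 1(2)] labelled_isoD(4)[OF \<phi>1 that] by simp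
      have C: "(\<theta>1 \<circ> \<phi>2) c \<in> vertices (du B1)" if "c \<in> vertices (du C)" for c
        using labelled_isoD(4)[OF 1(2)] labelled_isoD(4)[OF \<phi>2 that] by simp
      have "f1 O \<phi> = (\<lambda>x. (x, \<psi> ((\<theta>1 \<circ> \<phi>1) x))) ` vertices (du A)"
        unfolding fg1 \<phi> by (rule graph_relcomp[OF A])
      then have "f1 O \<phi> = f2 \<longleftrightarrow> (\<forall>a\<in>vertices (du A). \<psi> (\<theta>1 (\<phi>1 a)) = \<theta>2 (\<phi>1 a))"
        by (simp only: fg2 graph_eq_iff comp_apply)
      moreover have "\<phi> O g2 = g1 \<longleftrightarrow> (\<forall>c\<in>vertices (du C). \<psi> (\<theta>1 (\<phi>2 c)) = \<theta>2 (\<phi>2 c))"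
      proof -
        note comp = hom_S_self_comp[OF isos_SD(1)[OF iso], unfolded isos_SD(2,3)[OF iso]]
        have dom: "Domain g1 \<subseteq> vertices (du B1)" "Domain g2 \<subseteq> vertices (du B2)"
          using ex unfolding exact_pair_def by blast+
        have "\<phi> O g2 = g1 \<longleftrightarrow> \<phi>\<inverse> O g1 = g2"
        proof
          assume "\<phi> O g2 = g1"
          then show "\<phi>\<inverse> O g1 = g2"
            using O_assoc[of "\<phi>\<inverse>" \<phi> g2] comp(2) relcomp_Id_on(2)[OF dom(2)] by simp
        next
          assume "\<phi>\<inverse> O g1 = g2"
          then show "\<phi> O g2 = g1"
            using O_assoc[of \<phi> "\<phi>\<inverse>" g1] comp(1) relcomp_Id_on(2)[OF dom(1)] by simp
        qed
        also have "\<dots> \<longleftrightarrow> g1\<inverse> O \<phi> = g2\<inverse>"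
          using converse_inject[of "\<phi>\<inverse> O g1" g2] by (simp only: converse_relcomp converse_converse)
        also have "g1\<inverse> O \<phi> = (\<lambda>x. (x, \<psi> ((\<theta>1 \<circ> \<phi>2) x))) ` vertices (du C)"
          unfolding fg1 \<phi> converse_converse by (rule graph_relcomp[OF C])
        finally show ?thesis
          by (simp only: fg2 graph_eq_iff comp_apply converse_converse)
      qed
      moreover have "vertices P \<union> vertices Q = \<phi>1 ` vertices (du A) \<union> \<phi>2 ` vertices (du C)"
        using labelled_isoD(3)[OF \<phi>1] labelled_isoD(3)[OF \<phi>2] by simp
      ultimately show ?thesis
        by (simp only: ball_Un ball_simps)
    qed
    have "?equiv \<longleftrightarrow> (\<exists>\<psi>. labelled_iso (du B1) (du B2) \<psi> \<and> (\<forall>z\<in>vertices P \<union> vertices Q. \<psi> (\<theta>1 z) = \<theta>2 z))"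
    proof
      assume ?equiv
      then show "\<exists>\<psi>. labelled_iso (du B1) (du B2) \<psi> \<and> (\<forall>z\<in>vertices P \<union> vertices Q. \<psi> (\<theta>1 z) = \<theta>2 z)"
      proof
        fix \<phi> assume \<phi>: "f1 O \<phi> = f2 \<and> \<phi> O g2 = g1" "\<phi> \<in> isos_S \<Gamma> B1 B2"
        from \<phi>(2) obtain \<psi> where \<psi>: "labelled_iso (du B1) (du B2) \<psi>"
          "\<phi> = (\<lambda>x. (x, \<psi> x)) ` vertices (du B1)"
          unfolding isos_S_iff by blast
        with graph[OF \<psi>] \<phi>(1) show ?thesis
          by blast
      qed
    next
      assume "\<exists>\<psi>. labelled_iso (du B1) (du B2) \<psi> \<and> (\<forall>z\<in>vertices P \<union> vertices Q. \<psi> (\<theta>1 z) = \<theta>2 z)"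
      then obtain \<psi> where \<psi>: "labelled_iso (du B1) (du B2) \<psi>" "\<forall>z\<in>vertices P \<union> vertices Q. \<psi> (\<theta>1 z) = \<theta>2 z"
        by blast
      let ?\<phi> = "(\<lambda>x. (x, \<psi> x)) ` vertices (du B1)"
      have "?\<phi> \<in> isos_S \<Gamma> B1 B2"
        unfolding isos_S_iff using \<psi>(1) by blast
      with graph[OF \<psi>(1) HOL.refl] \<psi>(2) show ?equiv
        by blast
    qed
    also have "\<dots> \<longleftrightarrow> E1 = E2"
    proof
      assume "\<exists>\<psi>. labelled_iso (du B1) (du B2) \<psi> \<and> (\<forall>z\<in>vertices P \<union> vertices Q. \<psi> (\<theta>1 z) = \<theta>2 z)"
      then obtain \<psi> where \<psi>: "labelled_iso (du B1) (du B2) \<psi>"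
        "\<And>z. z \<in> vertices P \<union> vertices Q \<Longrightarrow> \<psi> (\<theta>1 z) = \<theta>2 z"
        by blast
      have "(x, y) \<in> E1 \<longleftrightarrow> (x, y) \<in> E2" if "x \<in> vertices Q" "y \<in> vertices P" for x y
        using glue_isoD(6)[OF sep 1 that] glue_isoD(6)[OF sep 2 that] that
          labelled_isoD(6)[OF \<psi>(1), of "\<theta>1 x" "\<theta>1 y"] \<psi>(2)[of x] \<psi>(2)[of y]
          labelled_isoD(4)[OF 1(2), of x] labelled_isoD(4)[OF 1(2), of y] by simp
      then show "E1 = E2"
        using 1(1) 2(1) by blast
    next
      assume "E1 = E2"
      let ?\<psi> = "\<theta>2 \<circ> inv_into (vertices (glue P Q E1)) \<theta>1"
      have "labelled_iso (du B1) (du B2) ?\<psi>"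
        using labelled_iso_inv[OF 1(2)] 2(2) \<open>E1 = E2\<close> labelled_iso_comp by blast
      moreover have "?\<psi> (\<theta>1 z) = \<theta>2 z" if "z \<in> vertices P \<union> vertices Q" for z
        using labelled_isoD(2)[OF 1(2)] that by simp
      ultimately show "\<exists>\<psi>. labelled_iso (du B1) (du B2) \<psi> \<and> (\<forall>z\<in>vertices P \<union> vertices Q. \<psi> (\<theta>1 z) = \<theta>2 z)"
        by blast
    qed
    finally show ?thesis
      unfolding link .
  qed
  then have key: "((B1, f1, g1), (B2, f2, g2)) \<in> ext_equiv \<Gamma> C A B \<longleftrightarrow>
      (B1, f1, g1) \<in> ext_sequences \<Gamma> C A B \<and> (B2, f2, g2) \<in> ext_sequences \<Gamma> C A B \<and>
      link \<Gamma> \<phi>1 \<phi>2 (B1, f1, g1) = link \<Gamma> \<phi>1 \<phi>2 (B2, f2, g2)" for B1 f1 g1 B2 f2 g2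
    unfolding ext_equiv_def mem_Collect_eq split by blast
  show ?thesis
    by (simp only: set_eq_iff split_paired_All mem_Collect_eq split key simp_thms)
qed

text \<open>A class of extensions is determined by its link, and every admissible link occurs.\<close>
lemma card_Ext:
  assumes sep: "separated P Q" and B: "B \<in> objects_S \<Gamma>"
    and A: "A \<in> objects_S \<Gamma>" "du A \<cong>\<^sub>q P" and C: "C \<in> objects_S \<Gamma>" "du C \<cong>\<^sub>q Q"
  shows "card (Ext_S \<Gamma> C A B) = card {E \<in> extensions P Q. glue P Q E \<cong>\<^sub>q du B}"
proof -
  obtain \<phi>1 \<phi>2 where \<phi>: "labelled_iso (du A) P \<phi>1" "labelled_iso (du C) Q \<phi>2"
    using A C unfolding isomorphic_def by blast
  show ?thesis
    unfolding Ext_S_def ext_equiv_iff_link[OF sep \<phi>] card_quotient_kernel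
      link_ext_sequences[OF sep B A(1) C(1) \<phi>] ..
qed

end

section \<open>Associativity of the Hall algebra\<close>

definition retag :: "(nat \<Rightarrow> nat) \<Rightarrow> (nat \<times> nat) quiver \<Rightarrow> (nat \<times> nat) quiver" where
  "retag t Q = \<lparr> vertices = map_prod t id ` vertices Q,
     arrows = map_prod (map_prod t id) (map_prod t id) ` arrows Q \<rparr>"

lemma retag_iso:
  assumes "inj t"
  shows "labelled_iso Q (retag t Q) (map_prod t id)"
proof (rule labelled_isoI)
  have inj: "inj (map_prod t (id :: nat \<Rightarrow> nat))"
    using assms by (simp add: prod.inj_map)
  then show "inj_on (map_prod t id) (vertices Q)"
    by (rule inj_on_subset) simp
  show "map_prod t id ` vertices Q = vertices (retag t Q)"
    by (simp add: retag_def)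
  have "inj (map_prod (map_prod t (id :: nat \<Rightarrow> nat)) (map_prod t (id :: nat \<Rightarrow> nat)))"
    using inj by (simp add: prod.inj_map)
  from inj_image_mem_iff[OF this, of "(x, y)" "arrows Q" for x y]
  show "(x, y) \<in> arrows Q \<longleftrightarrow> (map_prod t id x, map_prod t id y) \<in> arrows (retag t Q)" for x y
    by (simp add: retag_def)
qed (simp add: snd_map_prod)

lemma wf_quiver_retag: "wf_quiver Q \<Longrightarrow> wf_quiver (retag t Q)"
  by (force simp: wf_quiver_def retag_def)

context convex_quiver
begin

definition cls :: "(nat \<times> nat) quiver \<Rightarrow> obj set" where
  "cls Q = {B \<in> objects_S \<Gamma>. du B \<cong>\<^sub>q Q}"

abbreviation iso_classes :: "obj set set" where
  "iso_classes \<equiv> objects_S \<Gamma> // iso_rel_S \<Gamma>"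

definition hall_const :: "obj set \<Rightarrow> obj set \<Rightarrow> obj set \<Rightarrow> 'k::field" where
  "hall_const K1 K2 K =
     of_nat (card (Ext_S \<Gamma> (representative K2) (representative K1) (representative K)))"

lemma cls_eqI: "P \<cong>\<^sub>q Q \<Longrightarrow> cls P = cls Q"
  unfolding cls_def using isomorphic_trans isomorphic_sym by blast

lemma cls_eqD:
  assumes "cls P = cls Q" "valid P" shows "P \<cong>\<^sub>q Q"
proof -
  obtain B where "B \<in> objects_S \<Gamma>" "du B \<cong>\<^sub>q P"
    using assms(2) valid_def by blast
  then have "B \<in> cls P"
    by (simp add: cls_def)
  then have "B \<in> cls Q"
    by (simp add: assms(1))
  then show ?thesis
    using \<open>du B \<cong>\<^sub>q P\<close> isomorphic_sym isomorphic_trans unfolding cls_def by blast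
qed

lemma iso_class_eq_cls: "A \<in> objects_S \<Gamma> \<Longrightarrow> iso_rel_S \<Gamma> `` {A} = cls (du A)"
  unfolding cls_def Image_singleton iso_rel_S_iff using isomorphic_sym by blast

lemma valid_du: "A \<in> objects_S \<Gamma> \<Longrightarrow> valid (du A)"
  unfolding valid_def using isomorphic_refl by blast

lemma valid_isomorphic: "valid P \<Longrightarrow> P \<cong>\<^sub>q Q \<Longrightarrow> valid Q"
  unfolding valid_def using isomorphic_trans by blast

lemma cls_in_iso_classes: "valid Q \<Longrightarrow> cls Q \<in> iso_classes"
proof -
  assume "valid Q"
  then obtain B where "B \<in> objects_S \<Gamma>" "cls Q = cls (du B)"
    unfolding valid_def using cls_eqI by blast
  then show ?thesis
    using quotientI[of B "objects_S \<Gamma>" "iso_rel_S \<Gamma>"] by (simp add: iso_class_eq_cls)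
qed

lemma classes_cases:
  assumes "K \<in> iso_classes"
  obtains A where "A \<in> objects_S \<Gamma>" "K = cls (du A)"
  using assms iso_class_eq_cls by (metis quotientE)

lemma representative_cls:
  assumes "valid Q"
  shows "representative (cls Q) \<in> objects_S \<Gamma>" "du (representative (cls Q)) \<cong>\<^sub>q Q"
proof -
  have "\<exists>B. B \<in> cls Q"
    using assms unfolding valid_def cls_def by blast
  then have "representative (cls Q) \<in> cls Q"
    unfolding representative_def by (rule someI_ex)
  then show "representative (cls Q) \<in> objects_S \<Gamma>" "du (representative (cls Q)) \<cong>\<^sub>q Q"
    by (simp_all add: cls_def)
qed

lemma finite_vertices_du:
  assumes "A \<in> objects_S \<Gamma>"
  shows "finite (vertices (du A))"
proof -
  have "vertices (du A) \<subseteq> {..<length A} \<times> vertices \<Gamma>"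
    using assms nth_mem[of _ A] by (fastforce simp: objects_S_def in_lists_conv_set)
  then show ?thesis
    using finite_vertices finite_subset by blast
qed

lemma finite_vertices_valid:
  assumes "valid Q"
  shows "finite (vertices Q)"
proof -
  obtain A \<phi> where "A \<in> objects_S \<Gamma>" "labelled_iso (du A) Q \<phi>"
    using assms unfolding valid_def isomorphic_def by blast
  then show ?thesis
    using finite_vertices_du[of A] labelled_isoD(3)[of "du A" Q \<phi>] by (metis finite_imageI)
qed

lemma finite_extensions: "valid P \<Longrightarrow> valid Q \<Longrightarrow> finite (extensions P Q)"
  unfolding extensions_def
  by (rule finite_subset[of _ "Pow (vertices Q \<times> vertices P)"]) (auto simp: finite_vertices_valid)

lemma hall_const_cls:
  assumes "separated P Q" "valid P" "valid Q" "valid R"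
  shows "hall_const (cls P) (cls Q) (cls R) = of_nat (card {E \<in> extensions P Q. cls (glue P Q E) = cls R})"
proof -
  let ?B = "representative (cls R)"
  have "glue P Q E \<cong>\<^sub>q du ?B \<longleftrightarrow> cls (glue P Q E) = cls R" if "E \<in> extensions P Q" for E
  proof -
    have "valid (glue P Q E)"
      using that by (simp add: extensions_def)
    then show ?thesis
      using cls_eqI cls_eqD representative_cls(2)[OF assms(4)] isomorphic_sym isomorphic_trans by blast
  qed
  then have "{E \<in> extensions P Q. glue P Q E \<cong>\<^sub>q du ?B} = {E \<in> extensions P Q. cls (glue P Q E) = cls R}"
    by blast
  moreover note card_Ext[OF assms(1) representative_cls(1)[OF assms(4)]
      representative_cls[OF assms(2)] representative_cls[OF assms(3)]]
  ultimately show ?thesis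
    unfolding hall_const_def by simp
qed

text \<open>
  Gluing needs disjoint vertex sets. Representatives of three classes are kept apart by the residues of
  their tags modulo 3.
\<close>
lemma obtain_separated:
  assumes "K1 \<in> iso_classes" "K2 \<in> iso_classes" "K3 \<in> iso_classes"
  obtains P Q R where "valid P" "valid Q" "valid R" "K1 = cls P" "K2 = cls Q" "K3 = cls R"
    "separated P Q" "separated P R" "separated Q R"
proof -
  have *: "\<exists>P. valid P \<and> K = cls P \<and> wf_quiver P \<and> (\<forall>x\<in>vertices P. fst x mod 3 = r)"
    if K: "K \<in> iso_classes" and r: "r < 3" for K r
  proof -
    obtain A where A: "A \<in> objects_S \<Gamma>" "K = cls (du A)"
      using K by (rule classes_cases)
    let ?t = "\<lambda>p. 3 * p + r"
    have "inj ?t"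
      by (auto simp: inj_def)
    then have "du A \<cong>\<^sub>q retag ?t (du A)"
      unfolding isomorphic_def using retag_iso by blast
    moreover have "\<forall>x\<in>vertices (retag ?t (du A)). fst x mod 3 = r"
      using r by (auto simp: retag_def)
    ultimately show ?thesis
      using A valid_du valid_isomorphic cls_eqI wf_quiver_retag wf_quiver_du by blast
  qed
  obtain P where P: "valid P" "K1 = cls P" "wf_quiver P" "\<forall>x\<in>vertices P. fst x mod 3 = 0"
    using *[OF assms(1), of 0] by auto
  obtain Q where Q: "valid Q" "K2 = cls Q" "wf_quiver Q" "\<forall>x\<in>vertices Q. fst x mod 3 = 1"
    using *[OF assms(2), of 1] by auto
  obtain R where R: "valid R" "K3 = cls R" "wf_quiver R" "\<forall>x\<in>vertices R. fst x mod 3 = 2"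
    using *[OF assms(3), of 2] by auto
  have "vertices P \<inter> vertices Q = {}" "vertices P \<inter> vertices R = {}" "vertices Q \<inter> vertices R = {}"
    using P(4) Q(4) R(4) by fastforce+
  with P Q R that show thesis
    unfolding separated_def by blast
qed

text \<open>
  Validity passes to full subquivers, because an entry of a list may be replaced by any of its subsets.
\<close>
lemma valid_emb:
  assumes R: "valid R" and \<phi>: "labelled_emb P R \<phi>"
  shows "valid P"
proof -
  obtain B where B: "B \<in> objects_S \<Gamma>" "R \<cong>\<^sub>q du B"
    using R isomorphic_sym unfolding valid_def by blast
  then obtain \<psi> where "labelled_iso R (du B) \<psi>"
    unfolding isomorphic_def by blast
  then have "labelled_emb P (du B) (\<psi> \<circ> \<phi>)"
    using \<phi> labelled_emb_comp unfolding labelled_iso_iff_emb by blast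
  then have "P \<cong>\<^sub>q du (restrict_obj B ((\<psi> \<circ> \<phi>) ` vertices P))"
    using labelled_emb_restrict unfolding isomorphic_def by blast
  then show ?thesis
    unfolding valid_def using restrict_obj_in_objects[OF B(1)] isomorphic_sym by blast
qed

lemma structure_constants_hall:
  "structure_constants iso_classes (cls (du [])) (hall_const :: obj set \<Rightarrow> obj set \<Rightarrow> obj set \<Rightarrow> 'k::field)"
proof
  show "cls (du []) \<in> iso_classes"
    by (rule cls_in_iso_classes) (simp add: valid_du objects_S_def)
  fix K1 K2 assume "K1 \<in> iso_classes" "K2 \<in> iso_classes"
  then obtain P Q where PQ: "valid P" "valid Q" "K1 = cls P" "K2 = cls Q" "separated P Q"
    using obtain_separated by metis
  have "{K \<in> iso_classes. hall_const K1 K2 K \<noteq> (0::'k)} \<subseteq> (\<lambda>E. cls (glue P Q E)) ` extensions P Q"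
  proof
    fix K assume "K \<in> {K \<in> iso_classes. hall_const K1 K2 K \<noteq> (0::'k)}"
    then have K: "K \<in> iso_classes" "hall_const K1 K2 K \<noteq> (0::'k)"
      by auto
    obtain A where A: "A \<in> objects_S \<Gamma>" "K = cls (du A)"
      using K(1) by (rule classes_cases)
    have "{E \<in> extensions P Q. cls (glue P Q E) = cls (du A)} \<noteq> {}"
    proof
      assume "{E \<in> extensions P Q. cls (glue P Q E) = cls (du A)} = {}"
      with K(2) A(2) PQ(3,4) hall_const_cls[OF PQ(5,1,2) valid_du[OF A(1)], where 'a = 'k]
      show False by simp
    qed
    with A(2) show "K \<in> (\<lambda>E. cls (glue P Q E)) ` extensions P Q"
      by blast
  qed
  then show "finite {K \<in> iso_classes. hall_const K1 K2 K \<noteq> (0::'k)}"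
    using finite_extensions[OF PQ(1,2)] finite_surj by blast
qed

sublocale H: structure_constants iso_classes "cls (du [])" "hall_const :: obj set \<Rightarrow> obj set \<Rightarrow> obj set \<Rightarrow> 'k::field"
  by (rule structure_constants_hall)


text \<open>
  Grouping the sets \<open>E\<close> by the class of the glued quiver gives back the structure constants.
\<close>
lemma hall_mult:
  assumes "separated P Q" "valid P" "valid Q"
  shows "H.prod_alg (basis_vec (cls P)) (basis_vec (cls Q)) =
    (\<Sum>E\<in>extensions P Q. basis_vec (cls (glue P Q E)) :: obj set \<Rightarrow> 'k::field)"
proof
  fix K
  have glue_in: "cls (glue P Q E) \<in> iso_classes" if "E \<in> extensions P Q" for E
    using that cls_in_iso_classes by (simp add: extensions_def)
  show "H.prod_alg (basis_vec (cls P)) (basis_vec (cls Q)) K =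
    (\<Sum>E\<in>extensions P Q. basis_vec (cls (glue P Q E)) :: obj set \<Rightarrow> 'k) K"
  proof (cases "K \<in> iso_classes")
    case True
    then obtain A where A: "A \<in> objects_S \<Gamma>" "K = cls (du A)"
      by (rule classes_cases)
    have "hall_const (cls P) (cls Q) K = (of_nat (card {E \<in> extensions P Q. cls (glue P Q E) = K}) :: 'k)"
      unfolding A(2) by (rule hall_const_cls[OF assms valid_du[OF A(1)]])
    also have "\<dots> = (\<Sum>E\<in>{E \<in> extensions P Q. cls (glue P Q E) = K}. 1)"
      by simp
    also have "\<dots> = (\<Sum>E\<in>extensions P Q. if cls (glue P Q E) = K then 1 else 0)"
      by (rule sum.inter_filter[OF finite_extensions[OF assms(2,3)]])
    finally show ?thesis
      using True unfolding H.mult_basis H.bprod_def by (simp add: basis_vec_def eq_commute)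
  next
    case False
    then have "basis_vec (cls (glue P Q E)) K = (0::'k)" if "E \<in> extensions P Q" for E
      using glue_in[OF that] by (auto simp: basis_vec_def)
    then show ?thesis
      using False unfolding H.mult_basis H.bprod_def by simp
  qed
qed

text \<open>Threefold extensions: \<open>G\<close> may lead from \<open>R\<close> to \<open>Q\<close> and \<open>P\<close>, and from \<open>Q\<close> to \<open>P\<close>.\<close>
definition glue3 ::
    "(nat \<times> nat) quiver \<Rightarrow> (nat \<times> nat) quiver \<Rightarrow> (nat \<times> nat) quiver \<Rightarrow> (nat \<times> nat) rel \<Rightarrow>
     (nat \<times> nat) quiver" where
  "glue3 P Q R G = \<lparr> vertices = vertices P \<union> vertices Q \<union> vertices R,
     arrows = arrows P \<union> arrows Q \<union> arrows R \<union> G \<rparr>"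

definition extensions3 ::
    "(nat \<times> nat) quiver \<Rightarrow> (nat \<times> nat) quiver \<Rightarrow> (nat \<times> nat) quiver \<Rightarrow> (nat \<times> nat) rel set" where
  "extensions3 P Q R =
     {G. G \<subseteq> vertices Q \<times> vertices P \<union> vertices R \<times> vertices P \<union> vertices R \<times> vertices Q \<and>
         valid (glue3 P Q R G)}"

lemma glue_glue:
  "glue (glue P Q E1) R E2 = glue3 P Q R (E1 \<union> E2)"
  "glue P (glue Q R E1) E2 = glue3 P Q R (E1 \<union> E2)"
  by (auto simp: glue_def glue3_def)

lemma separated_glue:
  assumes "separated P Q" "separated P R" "separated Q R"
  shows "E \<subseteq> vertices Q \<times> vertices P \<Longrightarrow> separated (glue P Q E) R"
    and "E \<subseteq> vertices R \<times> vertices Q \<Longrightarrow> separated P (glue Q R E)"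
  using assms unfolding separated_def wf_quiver_def glue_sel by blast+

text \<open>
  The two partial gluings inside a threefold one are full subquivers, hence valid. So no condition is
  lost when a threefold extension is built in two steps.
\<close>
lemma valid_glue3:
  assumes sep: "separated P Q" "separated P R" "separated Q R"
    and G: "G \<in> extensions3 P Q R"
  shows "valid (glue P Q (G \<inter> vertices Q \<times> vertices P))"
    and "valid (glue Q R (G \<inter> vertices R \<times> vertices Q))"
proof -
  have val: "valid (glue3 P Q R G)"
    and sub: "G \<subseteq> vertices Q \<times> vertices P \<union> vertices R \<times> vertices P \<union> vertices R \<times> vertices Q"
    using G by (simp_all add: extensions3_def)
  have emb: "labelled_emb P' (glue3 P Q R G) id"
    if "vertices P' \<subseteq> vertices P \<union> vertices Q \<union> vertices R"
      "\<And>x y. x \<in> vertices P' \<Longrightarrow> y \<in> vertices P' \<Longrightarrow>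
         (x, y) \<in> arrows P' \<longleftrightarrow> (x, y) \<in> arrows P \<union> arrows Q \<union> arrows R \<union> G" for P'
    using that unfolding labelled_emb_def glue3_def by (simp add: image_subset_iff subset_iff)
  have wf: "arrows P \<subseteq> vertices P \<times> vertices P" "arrows Q \<subseteq> vertices Q \<times> vertices Q"
    "arrows R \<subseteq> vertices R \<times> vertices R"
    and disj: "vertices P \<inter> vertices Q = {}" "vertices P \<inter> vertices R = {}" "vertices Q \<inter> vertices R = {}"
    using sep by (simp_all add: separated_def wf_quiver_def)
  show "valid (glue P Q (G \<inter> vertices Q \<times> vertices P))"
  proof (rule valid_emb[OF val emb])
    fix x y
    assume "x \<in> vertices (glue P Q (G \<inter> vertices Q \<times> vertices P))"
      "y \<in> vertices (glue P Q (G \<inter> vertices Q \<times> vertices P))"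
    then have "x \<notin> vertices R"
      using disj by auto
    then have "(x, y) \<notin> arrows R" "(x, y) \<in> G \<longleftrightarrow> (x, y) \<in> G \<inter> vertices Q \<times> vertices P"
      using wf sub by blast+
    then show "(x, y) \<in> arrows (glue P Q (G \<inter> vertices Q \<times> vertices P)) \<longleftrightarrow>
        (x, y) \<in> arrows P \<union> arrows Q \<union> arrows R \<union> G"
      unfolding glue_sel by blast
  qed simp
  show "valid (glue Q R (G \<inter> vertices R \<times> vertices Q))"
  proof (rule valid_emb[OF val emb])
    fix x y
    assume "x \<in> vertices (glue Q R (G \<inter> vertices R \<times> vertices Q))"
      "y \<in> vertices (glue Q R (G \<inter> vertices R \<times> vertices Q))"
    then have "x \<notin> vertices P" "y \<notin> vertices P"
      using disj by auto
    then have "(x, y) \<notin> arrows P" "(x, y) \<in> G \<longleftrightarrow> (x, y) \<in> G \<inter> vertices R \<times> vertices Q"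
      using wf sub by blast+
    then show "(x, y) \<in> arrows (glue Q R (G \<inter> vertices R \<times> vertices Q)) \<longleftrightarrow>
        (x, y) \<in> arrows P \<union> arrows Q \<union> arrows R \<union> G"
      unfolding glue_sel by blast
  qed auto
qed

lemma sum_split_subset:
  assumes X: "\<And>E. E \<in> X \<Longrightarrow> E \<subseteq> U \<and> finite (Y E) \<and> (\<forall>E'\<in>Y E. E' \<subseteq> V \<and> E \<union> E' \<in> Z)"
    and Z: "\<And>G. G \<in> Z \<Longrightarrow> G \<subseteq> U \<union> V \<and> G \<inter> U \<in> X \<and> G \<inter> V \<in> Y (G \<inter> U)"
    and "finite X" "U \<inter> V = {}"
  shows "(\<Sum>E\<in>X. \<Sum>E'\<in>Y E. f (E \<union> E')) = (\<Sum>G\<in>Z. f G)"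
proof -
  have "(\<Sum>E\<in>X. \<Sum>E'\<in>Y E. f (E \<union> E')) = (\<Sum>(E, E')\<in>(SIGMA E:X. Y E). f (E \<union> E'))"
    using assms by (intro sum.Sigma) auto
  also have "\<dots> = (\<Sum>G\<in>Z. f G)"
  proof (rule sum.reindex_bij_witness[where j = "\<lambda>(E, E'). E \<union> E'" and i = "\<lambda>G. (G \<inter> U, G \<inter> V)"])
    fix z assume "z \<in> (SIGMA E:X. Y E)"
    then obtain E E' where z: "z = (E, E')" "E \<in> X" "E' \<in> Y E"
      by blast
    then have "E \<subseteq> U" "E' \<subseteq> V" "E \<union> E' \<in> Z"
      using X by blast+
    moreover from this have "(E \<union> E') \<inter> U = E" "(E \<union> E') \<inter> V = E'"
      using \<open>U \<inter> V = {}\<close> by blast+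
    ultimately show "((case z of (E, E') \<Rightarrow> E \<union> E') \<inter> U, (case z of (E, E') \<Rightarrow> E \<union> E') \<inter> V) = z"
      "(case z of (E, E') \<Rightarrow> E \<union> E') \<in> Z"
      by (simp_all add: z(1))
  qed (use Z in auto)
  finally show ?thesis .
qed

text \<open>
  Both sides sum over threefold extensions. On the left \<open>G\<close> is cut into the arrows between \<open>Q\<close> and \<open>P\<close> and
  those that start in \<open>R\<close>, on the right into the arrows between \<open>R\<close> and \<open>Q\<close> and those that end in \<open>P\<close>.
\<close>
lemma hall_assoc:
  assumes sep: "separated P Q" "separated P R" "separated Q R"
    and val: "valid P" "valid Q" "valid R"
  defines "b \<equiv> \<lambda>P. basis_vec (cls P) :: obj set \<Rightarrow> 'k::field"
  shows "H.prod_alg (H.prod_alg (b P) (b Q)) (b R) = H.prod_alg (b P) (H.prod_alg (b Q) (b R))"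
proof -
  have b_in: "b P' \<in> finsupp iso_classes" if "valid P'" for P'
    using that by (simp add: b_def finsupp_basis_vec cls_in_iso_classes)
  have ext: "valid (glue P' Q' E)" "E \<subseteq> vertices Q' \<times> vertices P'" if "E \<in> extensions P' Q'" for P' Q' E
    using that by (simp_all add: extensions_def)
  have disj: "vertices P \<inter> vertices Q = {}" "vertices P \<inter> vertices R = {}" "vertices Q \<inter> vertices R = {}"
    using sep by (simp_all add: separated_def)
  have ext3: "valid (glue3 P Q R G)"
    "G \<subseteq> vertices Q \<times> vertices P \<union> vertices R \<times> vertices P \<union> vertices R \<times> vertices Q"
    if "G \<in> extensions3 P Q R" for G
    using that by (simp_all add: extensions3_def)
  have "H.prod_alg (H.prod_alg (b P) (b Q)) (b R) =
      (\<Sum>E\<in>extensions P Q. H.prod_alg (b (glue P Q E)) (b R))"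
    unfolding b_def hall_mult[OF sep(1) val(1,2)]
    by (rule H.mult_sum_left) (simp add: b_in[unfolded b_def] ext)
  also have "\<dots> = (\<Sum>E\<in>extensions P Q. \<Sum>E'\<in>extensions (glue P Q E) R. b (glue3 P Q R (E \<union> E')))"
    unfolding b_def
    by (rule sum.cong[OF HOL.refl])
      (simp only: hall_mult[OF separated_glue(1)[OF sep ext(2)] ext(1) val(3)] glue_glue)
  also have "\<dots> = (\<Sum>G\<in>extensions3 P Q R. b (glue3 P Q R G))"
  proof (rule sum_split_subset[where U = "vertices Q \<times> vertices P"
        and V = "vertices R \<times> (vertices P \<union> vertices Q)"])
    fix G assume G: "G \<in> extensions3 P Q R"
    let ?U = "vertices Q \<times> vertices P" and ?V = "vertices R \<times> (vertices P \<union> vertices Q)"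
    have sub: "G \<subseteq> ?U \<union> ?V"
      using ext3(2)[OF G] by blast
    then have "G \<inter> ?U \<union> G \<inter> ?V = G"
      by blast
    with sub ext3(1)[OF G] valid_glue3(1)[OF sep G]
    show "G \<subseteq> ?U \<union> ?V \<and> G \<inter> ?U \<in> extensions P Q \<and> G \<inter> ?V \<in> extensions (glue P Q (G \<inter> ?U)) R"
      by (simp add: extensions_def glue_glue)
  next
    fix E assume E: "E \<in> extensions P Q"
    have "E' \<subseteq> vertices R \<times> (vertices P \<union> vertices Q) \<and> E \<union> E' \<in> extensions3 P Q R"
      if "E' \<in> extensions (glue P Q E) R" for E'
    proof -
      have "E' \<subseteq> vertices R \<times> (vertices P \<union> vertices Q)" "valid (glue3 P Q R (E \<union> E'))"
        using ext[OF that] by (simp_all add: glue_glue)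
      moreover have "E \<union> E' \<subseteq> vertices Q \<times> vertices P \<union> vertices R \<times> vertices P \<union> vertices R \<times> vertices Q"
        using Un_mono[OF ext(2)[OF E] calculation(1)] by (simp only: Sigma_Un_distrib2 Un_ac)
      ultimately show ?thesis
        unfolding extensions3_def mem_Collect_eq by (intro conjI)
    qed
    from ballI[OF this] show "E \<subseteq> vertices Q \<times> vertices P \<and> finite (extensions (glue P Q E) R) \<and>
        (\<forall>E'\<in>extensions (glue P Q E) R. E' \<subseteq> vertices R \<times> (vertices P \<union> vertices Q) \<and>
           E \<union> E' \<in> extensions3 P Q R)"
      by (intro conjI ext(2)[OF E] finite_extensions[OF ext(1)[OF E] val(3)])
  next
    show "finite (extensions P Q)"
      by (rule finite_extensions[OF val(1,2)])
    show "vertices Q \<times> vertices P \<inter> vertices R \<times> (vertices P \<union> vertices Q) = {}"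
      unfolding Times_Int_Times disj(3) by simp
  qed
  finally have left: "H.prod_alg (H.prod_alg (b P) (b Q)) (b R) = (\<Sum>G\<in>extensions3 P Q R. b (glue3 P Q R G))" .
  have "H.prod_alg (b P) (H.prod_alg (b Q) (b R)) =
      (\<Sum>E\<in>extensions Q R. H.prod_alg (b P) (b (glue Q R E)))"
    unfolding b_def hall_mult[OF sep(3) val(2,3)]
    by (rule H.mult_sum_right) (simp add: b_in[unfolded b_def] ext)
  also have "\<dots> = (\<Sum>E\<in>extensions Q R. \<Sum>E'\<in>extensions P (glue Q R E). b (glue3 P Q R (E \<union> E')))"
    unfolding b_def
    by (rule sum.cong[OF HOL.refl])
      (simp only: hall_mult[OF separated_glue(2)[OF sep ext(2)] val(1) ext(1)] glue_glue)
  also have "\<dots> = (\<Sum>G\<in>extensions3 P Q R. b (glue3 P Q R G))"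
  proof (rule sum_split_subset[where U = "vertices R \<times> vertices Q"
        and V = "(vertices Q \<union> vertices R) \<times> vertices P"])
    fix G assume G: "G \<in> extensions3 P Q R"
    let ?U = "vertices R \<times> vertices Q" and ?V = "(vertices Q \<union> vertices R) \<times> vertices P"
    have sub: "G \<subseteq> ?U \<union> ?V"
      using ext3(2)[OF G] by blast
    then have "G \<inter> ?U \<union> G \<inter> ?V = G"
      by blast
    with sub ext3(1)[OF G] valid_glue3(2)[OF sep G]
    show "G \<subseteq> ?U \<union> ?V \<and> G \<inter> ?U \<in> extensions Q R \<and> G \<inter> ?V \<in> extensions P (glue Q R (G \<inter> ?U))"
      by (simp add: extensions_def glue_glue)
  next
    fix E assume E: "E \<in> extensions Q R"
    have "E' \<subseteq> (vertices Q \<union> vertices R) \<times> vertices P \<and> E \<union> E' \<in> extensions3 P Q R"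
      if "E' \<in> extensions P (glue Q R E)" for E'
    proof -
      have "E' \<subseteq> (vertices Q \<union> vertices R) \<times> vertices P" "valid (glue3 P Q R (E \<union> E'))"
        using ext[OF that] by (simp_all add: glue_glue)
      moreover have "E \<union> E' \<subseteq> vertices Q \<times> vertices P \<union> vertices R \<times> vertices P \<union> vertices R \<times> vertices Q"
        using Un_mono[OF ext(2)[OF E] calculation(1)] by (simp only: Sigma_Un_distrib1 Un_ac)
      ultimately show ?thesis
        unfolding extensions3_def mem_Collect_eq by (intro conjI)
    qed
    from ballI[OF this] show "E \<subseteq> vertices R \<times> vertices Q \<and> finite (extensions P (glue Q R E)) \<and>
        (\<forall>E'\<in>extensions P (glue Q R E). E' \<subseteq> (vertices Q \<union> vertices R) \<times> vertices P \<and>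
           E \<union> E' \<in> extensions3 P Q R)"
      by (intro conjI ext(2)[OF E] finite_extensions[OF val(1) ext(1)[OF E]])
  next
    show "finite (extensions Q R)"
      by (rule finite_extensions[OF val(2,3)])
    show "vertices R \<times> vertices Q \<inter> (vertices Q \<union> vertices R) \<times> vertices P = {}"
      unfolding Times_Int_Times Int_commute[of "vertices Q" "vertices P"] disj(1) by simp
  qed
  finally show ?thesis
    unfolding left ..
qed

lemma hall_unit:
  assumes "valid P" "wf_quiver P"
  shows "H.prod_alg (basis_vec (cls (du []))) (basis_vec (cls P)) = (basis_vec (cls P) :: obj set \<Rightarrow> 'k::field)"
    and "H.prod_alg (basis_vec (cls P)) (basis_vec (cls (du []))) = (basis_vec (cls P) :: obj set \<Rightarrow> 'k::field)"
proof -
  have empty: "vertices (du []) = {}" "arrows (du []) = {}"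
    by (simp_all add: disjoint_union_def)
  have val: "valid (du [])"
    by (simp add: valid_du objects_S_def)
  have sep: "separated (du []) P" "separated P (du [])"
    using assms(2) empty by (simp_all add: separated_def)
  have glue: "glue (du []) P {} = P" "glue P (du []) {} = P"
    by (simp_all add: glue_def empty)
  have ext: "extensions (du []) P = {{}}" "extensions P (du []) = {{}}"
    using assms(1) empty by (auto simp: extensions_def glue)
  show "H.prod_alg (basis_vec (cls (du []))) (basis_vec (cls P)) = (basis_vec (cls P) :: obj set \<Rightarrow> 'k::field)"
    unfolding hall_mult[OF sep(1) val assms(1)] ext using glue by simp
  show "H.prod_alg (basis_vec (cls P)) (basis_vec (cls (du []))) = (basis_vec (cls P) :: obj set \<Rightarrow> 'k::field)"
    unfolding hall_mult[OF sep(2) assms(1) val] ext using glue by simp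
qed

sublocale H: unital_algebra iso_classes "cls (du [])" "hall_const :: obj set \<Rightarrow> obj set \<Rightarrow> obj set \<Rightarrow> 'k::field"
proof
  show "H.prod_alg (basis_vec (cls (du []))) (basis_vec K) = (basis_vec K :: obj set \<Rightarrow> 'k)"
    "H.prod_alg (basis_vec K) (basis_vec (cls (du []))) = (basis_vec K :: obj set \<Rightarrow> 'k)"
    if K: "K \<in> iso_classes" for K
  proof -
    obtain P Q R where "valid P" "valid Q" "valid R" "K = cls P" "K = cls Q" "K = cls R"
      "separated P Q" "separated P R" "separated Q R"
      by (rule obtain_separated[OF K K K])
    then show "H.prod_alg (basis_vec (cls (du []))) (basis_vec K) = (basis_vec K :: obj set \<Rightarrow> 'k)"
      "H.prod_alg (basis_vec K) (basis_vec (cls (du []))) = (basis_vec K :: obj set \<Rightarrow> 'k)"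
      using hall_unit[of P] by (simp_all add: separated_def)
  qed
  show "H.prod_alg (H.prod_alg (basis_vec K1) (basis_vec K2)) (basis_vec K3) =
      (H.prod_alg (basis_vec K1) (H.prod_alg (basis_vec K2) (basis_vec K3)) :: obj set \<Rightarrow> 'k)"
    if K: "K1 \<in> iso_classes" "K2 \<in> iso_classes" "K3 \<in> iso_classes" for K1 K2 K3
  proof -
    obtain P Q R where "valid P" "valid Q" "valid R" "K1 = cls P" "K2 = cls Q" "K3 = cls R"
      "separated P Q" "separated P R" "separated Q R"
      by (rule obtain_separated[OF K])
    then show ?thesis
      using hall_assoc[of P Q R] by simp
  qed
qed

lemma hall_algebra_eq: "hall_algebra \<Gamma> = H.alg"
proof -
  have "iso_rel_S \<Gamma> `` {[]} = cls (du [])"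
    by (rule iso_class_eq_cls) (simp add: objects_S_def)
  then show ?thesis
    unfolding hall_algebra_def hall_const_def by simp
qed

end

section \<open>Segments of an oriented line\<close>

lemma glue_cong:
  assumes sep: "separated P Q" "separated P' Q'" and iso: "P \<cong>\<^sub>q P'" "Q \<cong>\<^sub>q Q'"
  shows "glue P Q {} \<cong>\<^sub>q glue P' Q' {}"
proof -
  obtain F G where F: "labelled_iso P P' F" and G: "labelled_iso Q Q' G"
    using iso unfolding isomorphic_def by blast
  note DF = labelled_isoD[OF F] and DG = labelled_isoD[OF G]
  note A = glue_arrows[OF sep(2) empty_subsetI]
  have "labelled_iso (glue P Q {}) (glue P' Q' {}) (\<lambda>z. if z \<in> vertices P then F z else G z)"
  proof (rule glue_iso[OF sep(1)])
    show "labelled_emb P (glue P' Q' {}) F"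
      unfolding labelled_emb_def using DF(2,5,6) DF(4) A(1) by (simp add: image_subset_iff del: glue_sel(2))
    show "labelled_emb Q (glue P' Q' {}) G"
      unfolding labelled_emb_def using DG(2,5,6) DG(4) A(2) by (simp add: image_subset_iff del: glue_sel(2))
    show "F ` vertices P \<inter> G ` vertices Q = {}" "F ` vertices P \<union> G ` vertices Q = vertices (glue P' Q' {})"
      unfolding DF(3) DG(3) using sep(2) by (simp_all add: separated_def)
    show "(F x, G y) \<notin> arrows (glue P' Q' {})" if "x \<in> vertices P" "y \<in> vertices Q" for x y
      using A(4) DF(4) DG(4) that by blast
    show "(x, y) \<in> {} \<longleftrightarrow> (G x, F y) \<in> arrows (glue P' Q' {})"
      if "x \<in> vertices Q" "y \<in> vertices P" for x y
      using A(3) DF(4) DG(4) that by blast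
  qed simp
  then show ?thesis
    unfolding isomorphic_def by blast
qed

abbreviation shift :: "nat \<Rightarrow> (nat \<times> nat) quiver \<Rightarrow> (nat \<times> nat) quiver" where
  "shift d \<equiv> retag ((+) d)"

lemma shift_vertices [simp]: "(p, v) \<in> vertices (shift d Q) \<longleftrightarrow> d \<le> p \<and> (p - d, v) \<in> vertices Q"
  by (force simp: retag_def image_iff)

lemma shift_arrows [simp]:
  "((p, v), (q, w)) \<in> arrows (shift d Q) \<longleftrightarrow> d \<le> p \<and> d \<le> q \<and> ((p - d, v), (q - d, w)) \<in> arrows Q"
proof
  assume "d \<le> p \<and> d \<le> q \<and> ((p - d, v), (q - d, w)) \<in> arrows Q"
  then show "((p, v), (q, w)) \<in> arrows (shift d Q)"
    unfolding retag_def by (auto intro!: image_eqI[of _ _ "((p - d, v), (q - d, w))"])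
qed (auto simp: retag_def)

lemma shift_isomorphic: "Q \<cong>\<^sub>q shift d Q"
  unfolding isomorphic_def using retag_iso[of "(+) d" Q] by auto

lemma separated_shift: "separated (disjoint_union \<Gamma> A) (shift (length A) (disjoint_union \<Gamma> B))"
proof -
  have "verts \<Gamma> A \<inter> vertices (shift (length A) (disjoint_union \<Gamma> B)) = {}"
    by auto
  then show ?thesis
    by (simp add: separated_def wf_quiver_retag)
qed

lemma glue_du: "glue (disjoint_union \<Gamma> A) (shift (length A) (disjoint_union \<Gamma> B)) {} = disjoint_union \<Gamma> (A @ B)"
proof -
  have "vertices (glue (disjoint_union \<Gamma> A) (shift (length A) (disjoint_union \<Gamma> B)) {}) =
      verts \<Gamma> (A @ B)"
    by (auto simp: nth_append split: if_splits)
  moreover have "arrows (glue (disjoint_union \<Gamma> A) (shift (length A) (disjoint_union \<Gamma> B)) {}) =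
      arrs \<Gamma> (A @ B)"
    by (auto simp: nth_append split: if_splits)
  ultimately show ?thesis
    by (simp add: glue_def disjoint_union_def)
qed

lemma du_append_cong:
  "disjoint_union \<Gamma> A \<cong>\<^sub>q disjoint_union \<Gamma> A' \<Longrightarrow> disjoint_union \<Gamma> B \<cong>\<^sub>q disjoint_union \<Gamma> B' \<Longrightarrow>
   disjoint_union \<Gamma> (A @ B) \<cong>\<^sub>q disjoint_union \<Gamma> (A' @ B')"
  unfolding glue_du[symmetric]
  by (intro glue_cong separated_shift)
    (blast intro: isomorphic_trans isomorphic_sym shift_isomorphic)+

lemma du_permute:
  assumes "mset A = mset B"
  shows "disjoint_union \<Gamma> A \<cong>\<^sub>q disjoint_union \<Gamma> B"
proof -
  obtain f where f: "bij_betw f {..<length A} {..<length B}" "\<And>i. i < length A \<Longrightarrow> A ! i = B ! f i"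
    using permutation_Ex_bij[OF assms] by blast
  have inj: "f p = f q \<longleftrightarrow> p = q" if "p < length A" "q < length A" for p q
    using f(1) that by (auto simp: bij_betw_def inj_on_def)
  have lt: "f p < length B" if "p < length A" for p
    using f(1) that by (auto simp: bij_betw_def)
  have "labelled_iso (disjoint_union \<Gamma> A) (disjoint_union \<Gamma> B) (map_prod f id)"
  proof (rule labelled_isoI)
    show "inj_on (map_prod f id) (verts \<Gamma> A)"
      using inj by (auto simp: inj_on_def)
    show "map_prod f id ` verts \<Gamma> A = verts \<Gamma> B"
    proof
      show "map_prod f id ` verts \<Gamma> A \<subseteq> verts \<Gamma> B"
        using f(2) lt by auto
      show "verts \<Gamma> B \<subseteq> map_prod f id ` verts \<Gamma> A"
      proof
        fix x assume x: "x \<in> verts \<Gamma> B"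
        obtain q v where qv: "x = (q, v)" "q < length B" "v \<in> B ! q"
          using x by (cases x) auto
        then obtain p where "p < length A" "q = f p"
          using f(1) by (auto simp: bij_betw_def)
        with qv f(2) show "x \<in> map_prod f id ` verts \<Gamma> A"
          by (intro image_eqI[of _ _ "(p, v)"]) auto
      qed
    qed
    show "(x, y) \<in> arrs \<Gamma> A \<longleftrightarrow>
        (map_prod f id x, map_prod f id y) \<in> arrs \<Gamma> B"
      if "x \<in> verts \<Gamma> A" "y \<in> verts \<Gamma> A" for x y
      using that f(2) inj lt by (cases x; cases y) auto
  qed (simp add: snd_map_prod)
  then show ?thesis
    unfolding isomorphic_def by blast
qed

lemma du_split:
  assumes "H1 \<inter> H2 = {}"
    and "\<And>v w. v \<in> H1 \<Longrightarrow> w \<in> H2 \<Longrightarrow> (v, w) \<notin> arrows \<Gamma> \<and> (w, v) \<notin> arrows \<Gamma>"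
  shows "disjoint_union \<Gamma> [H1 \<union> H2] \<cong>\<^sub>q disjoint_union \<Gamma> [H1, H2]"
proof -
  have "labelled_iso (disjoint_union \<Gamma> [H1 \<union> H2]) (disjoint_union \<Gamma> [H1, H2])
      (\<lambda>x. (if snd x \<in> H1 then 0 else 1, snd x))"
  proof (rule labelled_isoI)
    show "inj_on (\<lambda>x. (if snd x \<in> H1 then 0 else 1, snd x)) (verts \<Gamma> [H1 \<union> H2])"
      by (auto simp: inj_on_def)
    show "(\<lambda>x. (if snd x \<in> H1 then 0 else 1, snd x)) ` verts \<Gamma> [H1 \<union> H2] =
        verts \<Gamma> [H1, H2]" (is "?f ` ?V = ?W")
    proof
      show "?f ` ?V \<subseteq> ?W"
        by auto
      show "?W \<subseteq> ?f ` ?V"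
      proof
        fix x assume x: "x \<in> ?W"
        obtain p v where pv: "x = (p, v)"
          by (cases x)
        with x have "(p = 0 \<and> v \<in> H1) \<or> (p = 1 \<and> v \<in> H2)"
          by (auto simp: less_Suc_eq)
        with pv assms(1) show "x \<in> ?f ` ?V"
          by (intro image_eqI[of _ _ "(0, v)"]) auto
      qed
    qed
    show "(x, y) \<in> arrs \<Gamma> [H1 \<union> H2] \<longleftrightarrow>
        (?f x, ?f y) \<in> arrs \<Gamma> [H1, H2]" if "x \<in> ?V" "y \<in> ?V" for x y
      using that assms by (cases x; cases y) auto
  qed auto
  then show ?thesis
    unfolding isomorphic_def by blast
qed

lemma du_empty_summand: "disjoint_union \<Gamma> [{}] \<cong>\<^sub>q disjoint_union \<Gamma> []"
proof -
  have "labelled_iso (disjoint_union \<Gamma> [{}]) (disjoint_union \<Gamma> []) id"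
    by (rule labelled_isoI) auto
  then show ?thesis
    unfolding isomorphic_def by blast
qed

text \<open>
  The positions \<open>1, \<dots>, n\<close> given by \<open>\<tau>\<close> are the vertices of the Dynkin diagram of type A.
\<close>
locale line_quiver =
  fixes \<Gamma> :: "nat quiver" and n :: nat and \<tau> :: "nat \<Rightarrow> nat"
  assumes tau: "bij_betw \<tau> (vertices \<Gamma>) {1..n}"
    and adjacent: "i \<in> vertices \<Gamma> \<Longrightarrow> j \<in> vertices \<Gamma> \<Longrightarrow>
      (i, j) \<in> arrows \<Gamma> \<or> (j, i) \<in> arrows \<Gamma> \<longleftrightarrow> adjacent_A (\<tau> i) (\<tau> j)"
    and antisym_arrows: "(i, j) \<in> arrows \<Gamma> \<Longrightarrow> (j, i) \<notin> arrows \<Gamma>"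
    and wf: "wf_quiver \<Gamma>"
begin

definition vert :: "nat \<Rightarrow> nat" where
  "vert = inv_into (vertices \<Gamma>) \<tau>"

text \<open>The orientation of the edge between the positions \<open>j\<close> and \<open>j + 1\<close>.\<close>
definition up :: "nat \<Rightarrow> bool" where
  "up j \<longleftrightarrow> (vert j, vert (Suc j)) \<in> arrows \<Gamma>"

lemma vert: "1 \<le> j \<Longrightarrow> j \<le> n \<Longrightarrow> vert j \<in> vertices \<Gamma>" "1 \<le> j \<Longrightarrow> j \<le> n \<Longrightarrow> \<tau> (vert j) = j"
  unfolding vert_def using bij_betw_imp_surj_on[OF tau] by (simp_all add: inv_into_into f_inv_into_f)

lemma vert_tau [simp]: "v \<in> vertices \<Gamma> \<Longrightarrow> vert (\<tau> v) = v"
  unfolding vert_def using bij_betw_imp_inj_on[OF tau] by simp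

lemma tau_range: "v \<in> vertices \<Gamma> \<Longrightarrow> 1 \<le> \<tau> v \<and> \<tau> v \<le> n"
  using bij_betw_apply[OF tau] by simp

lemma tau_inj: "v \<in> vertices \<Gamma> \<Longrightarrow> w \<in> vertices \<Gamma> \<Longrightarrow> \<tau> v = \<tau> w \<Longrightarrow> v = w"
  using bij_betw_imp_inj_on[OF tau] by (simp add: inj_on_def)

lemma arrow_iff:
  assumes "v \<in> vertices \<Gamma>" "w \<in> vertices \<Gamma>"
  shows "(v, w) \<in> arrows \<Gamma> \<longleftrightarrow>
    (\<tau> w = Suc (\<tau> v) \<and> up (\<tau> v)) \<or> (\<tau> v = Suc (\<tau> w) \<and> \<not> up (\<tau> w))"
proof -
  have adj: "(v, w) \<in> arrows \<Gamma> \<or> (w, v) \<in> arrows \<Gamma> \<longleftrightarrow> \<tau> v = Suc (\<tau> w) \<or> \<tau> w = Suc (\<tau> v)"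
    using adjacent[OF assms] by (simp add: adjacent_A_def)
  have 1: "up (\<tau> v) \<longleftrightarrow> (v, w) \<in> arrows \<Gamma>" if "\<tau> w = Suc (\<tau> v)"
    unfolding up_def that[symmetric] using assms by simp
  have 2: "up (\<tau> w) \<longleftrightarrow> (w, v) \<in> arrows \<Gamma>" if "\<tau> v = Suc (\<tau> w)"
    unfolding up_def that[symmetric] using assms by simp
  show ?thesis
    using adj 1 2 antisym_arrows by fastforce
qed

lemma arrow_vertices: "(v, w) \<in> arrows \<Gamma> \<Longrightarrow> v \<in> vertices \<Gamma> \<and> w \<in> vertices \<Gamma>"
  using wf unfolding wf_quiver_def by blast

lemma finite_vertices: "finite (vertices \<Gamma>)"
  using tau bij_betw_finite by blast

text \<open>
  The pair \<open>(i, j)\<close> stands for the positions \<open>i + 1, \<dots>, j\<close>. With this half-open convention adjacent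
  segments share an index, just as \<open>E\<^sub>i\<^sub>j E\<^sub>j\<^sub>k = E\<^sub>i\<^sub>k\<close> does.
\<close>
definition seg :: "nat \<times> nat \<Rightarrow> nat set" where
  "seg \<beta> = {v \<in> vertices \<Gamma>. fst \<beta> < \<tau> v \<and> \<tau> v \<le> snd \<beta>}"

definition roots :: "(nat \<times> nat) set" where
  "roots = {(i, j). i < j \<and> j \<le> n}"

lemma seg_subset: "seg \<beta> \<subseteq> vertices \<Gamma>"
  by (auto simp: seg_def)

lemma vert_in_seg:
  assumes "fst \<beta> < k" "k \<le> snd \<beta>" "\<beta> \<in> roots"
  shows "vert k \<in> seg \<beta>"
  using assms vert[of k] by (auto simp: seg_def roots_def)

lemma seg_inj:
  assumes "\<beta> \<in> roots" "\<gamma> \<in> roots" "seg \<beta> = seg \<gamma>"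
  shows "\<beta> = \<gamma>"
proof -
  have *: "\<tau> ` seg \<delta> = {fst \<delta><..snd \<delta>}" if "\<delta> \<in> roots" for \<delta>
  proof
    show "{fst \<delta><..snd \<delta>} \<subseteq> \<tau> ` seg \<delta>"
    proof
      fix k assume k: "k \<in> {fst \<delta><..snd \<delta>}"
      then have "vert k \<in> seg \<delta>" "\<tau> (vert k) = k"
        using that by (auto simp: vert_in_seg vert roots_def)
      then show "k \<in> \<tau> ` seg \<delta>"
        by force
    qed
  qed (auto simp: seg_def)
  have "{fst \<beta><..snd \<beta>} = {fst \<gamma><..snd \<gamma>}"
    using *[OF assms(1)] *[OF assms(2)] assms(3) by simp
  moreover have "fst \<beta> < snd \<beta>" "fst \<gamma> < snd \<gamma>"
    using assms(1,2) by (auto simp: roots_def)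
  ultimately have "fst \<beta> = fst \<gamma> \<and> snd \<beta> = snd \<gamma>"
    by (simp add: Ioc_inj)
  then show ?thesis
    by (simp add: prod_eq_iff)
qed

text \<open>
  A directed path cannot turn back on a line: that would need both orientations of an edge.
\<close>
lemma path_monotone:
  assumes "(a, b) \<in> (arrows \<Gamma>)\<^sup>*" "a \<in> vertices \<Gamma>"
  shows "b \<in> vertices \<Gamma> \<and>
    ((\<tau> a \<le> \<tau> b \<and> (\<forall>k. \<tau> a \<le> k \<and> k < \<tau> b \<longrightarrow> up k)) \<or>
     (\<tau> b \<le> \<tau> a \<and> (\<forall>k. \<tau> b \<le> k \<and> k < \<tau> a \<longrightarrow> \<not> up k)))"
  using assms
proof (induction rule: rtrancl_induct)
  case (step b c)
  then have b: "b \<in> vertices \<Gamma>" and c: "c \<in> vertices \<Gamma>"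
    using arrow_vertices by blast+
  from step.hyps(2) arrow_iff[OF b c]
  consider "\<tau> c = Suc (\<tau> b)" "up (\<tau> b)" | "\<tau> b = Suc (\<tau> c)" "\<not> up (\<tau> c)"
    by blast
  then show ?case
  proof cases
    case 1
    have "\<tau> a \<le> \<tau> b \<and> (\<forall>k. \<tau> a \<le> k \<and> k < \<tau> b \<longrightarrow> up k)"
      using step.IH[OF step.prems] 1(2) by (metis order_refl leD le_neq_implies_less)
    with 1 c show ?thesis
      by (auto simp: less_Suc_eq)
  next
    case 2
    have "\<tau> b \<le> \<tau> a \<and> (\<forall>k. \<tau> b \<le> k \<and> k < \<tau> a \<longrightarrow> \<not> up k)"
    proof (cases "\<tau> a < \<tau> b")
      case True
      then have "up (\<tau> c)"
        using step.IH[OF step.prems] 2(1) by auto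
      with 2(2) show ?thesis by blast
    qed (use step.IH[OF step.prems] in auto)
    moreover have "k = \<tau> c \<or> \<tau> b \<le> k" if "\<tau> c \<le> k" for k
      using that 2(1) by linarith
    ultimately show ?thesis
      using 2 c by auto
  qed
qed auto

text \<open>
  By monotonicity a path between two vertices of a segment stays inside it, and closure under arrows can
  be followed along the path.
\<close>
lemma path_convex_seg: "path_convex \<Gamma> (seg \<beta>)"
  unfolding path_convex_def
proof (intro allI impI)
  fix J a b
  assume J: "J \<subseteq> seg \<beta>" and closed: "\<forall>x\<in>J. \<forall>y\<in>seg \<beta>. (x, y) \<in> arrows \<Gamma> \<longrightarrow> y \<in> J"
    and a: "a \<in> J" and b: "b \<in> seg \<beta>" and ab: "(a, b) \<in> (arrows \<Gamma>)\<^sup>*"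
  have av: "a \<in> vertices \<Gamma>" "b \<in> vertices \<Gamma>" "a \<in> seg \<beta>"
    using J a b seg_subset by blast+
  from path_monotone[OF ab av(1)]
  consider "\<tau> a \<le> \<tau> b" "\<And>k. \<tau> a \<le> k \<Longrightarrow> k < \<tau> b \<Longrightarrow> up k"
    | "\<tau> b \<le> \<tau> a" "\<And>k. \<tau> b \<le> k \<Longrightarrow> k < \<tau> a \<Longrightarrow> \<not> up k"
    by blast
  then show "b \<in> J"
  proof cases
    case 1
    have "vert k \<in> J" if "\<tau> a \<le> k" "k \<le> \<tau> b" for k
      using that
    proof (induction k rule: dec_induct)
      case (step k)
      have k: "1 \<le> k" "Suc k \<le> n"
        using step.hyps step.prems tau_range[OF av(1)] tau_range[OF av(2)] by linarith+
      have "(vert k, vert (Suc k)) \<in> arrows \<Gamma>"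
        using 1(2)[of k] step.hyps step.prems by (simp add: up_def)
      moreover have "vert (Suc k) \<in> seg \<beta>"
        using vert[of "Suc k"] k av(3) b step.hyps step.prems by (auto simp: seg_def)
      ultimately show ?case
        using closed step by (meson Suc_leD)
    qed (use a av in simp)
    from this[of "\<tau> b"] 1(1) av(2) show ?thesis by simp
  next
    case 2
    have "vert k \<in> J" if "k \<le> \<tau> a" "\<tau> b \<le> k" for k
      using that
    proof (induction k rule: inc_induct)
      case (step k)
      have k: "1 \<le> k" "Suc k \<le> n"
        using step.hyps step.prems tau_range[OF av(1)] tau_range[OF av(2)] by linarith+
      have "(vert (Suc k), vert k) \<in> arrows \<Gamma>"
        using 2(2)[of k] step.hyps step.prems k by (subst arrow_iff) (auto simp: vert)
      moreover have "vert k \<in> seg \<beta>"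
        using vert[of k] k av(3) b step.hyps step.prems by (auto simp: seg_def)
      ultimately show ?case
        using closed step by (meson le_SucI)
    qed (use a av in simp)
    from this[of "\<tau> b"] 2(1) av(2) show ?thesis by simp
  qed
qed

abbreviation "dul w \<equiv> disjoint_union \<Gamma> (map seg w)"

text \<open>
  Split off the maximal run of consecutive positions that starts at the lowest position occupied by \<open>H\<close>,
  and proceed with the rest.
\<close>
lemma subset_decomposition:
  assumes "H \<subseteq> vertices \<Gamma>"
  shows "\<exists>w. set w \<subseteq> roots \<and> disjoint_union \<Gamma> [H] \<cong>\<^sub>q dul w"
  using assms
proof (induction "card H" arbitrary: H rule: less_induct)
  case less
  have finH: "finite H"
    using less.prems finite_vertices finite_subset by blast
  show ?case
  proof (cases "H = {}")
    case True
    then show ?thesis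
      using du_empty_summand by (intro exI[of _ "[]"]) simp
  next
    case False
    define m where "m = Min (\<tau> ` H)"
    have m: "m \<in> \<tau> ` H" "\<And>v. v \<in> H \<Longrightarrow> m \<le> \<tau> v"
      using finH False by (auto simp: m_def)
    define k where "k = (LEAST k. m < k \<and> k \<notin> \<tau> ` H)"
    have "m < Suc n" "Suc n \<notin> \<tau> ` H"
      using m(1) less.prems tau_range by fastforce+
    then have k: "m < k" "k \<notin> \<tau> ` H" and k_le: "k \<le> Suc n"
      unfolding k_def using LeastI[of "\<lambda>k. m < k \<and> k \<notin> \<tau> ` H" "Suc n"]
        Least_le[of "\<lambda>k. m < k \<and> k \<notin> \<tau> ` H" "Suc n"] by blast+
    have run: "l \<in> \<tau> ` H" if "m \<le> l" "l < k" for l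
      using not_less_Least[OF that(2)[unfolded k_def]] that(1) m(1) by (cases "l = m") simp_all
    define H1 H2 where "H1 = {v \<in> H. \<tau> v < k}" and "H2 = {v \<in> H. k < \<tau> v}"
    have H: "H = H1 \<union> H2" "H1 \<inter> H2 = {}"
      unfolding H1_def H2_def using k(2) by (auto simp: not_less_iff_gr_or_eq image_iff)
    have m1: "1 \<le> m"
      using m(1) less.prems tau_range by fastforce
    have H1: "H1 = seg (m - 1, k - 1)"
    proof
      show "H1 \<subseteq> seg (m - 1, k - 1)"
        using m(2) m1 k(1) less.prems by (fastforce simp: H1_def seg_def)
      show "seg (m - 1, k - 1) \<subseteq> H1"
      proof
        fix v assume v: "v \<in> seg (m - 1, k - 1)"
        then have "v \<in> vertices \<Gamma>" "m \<le> \<tau> v" "\<tau> v < k"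
          using m1 k(1) by (auto simp: seg_def)
        then show "v \<in> H1"
          using run[of "\<tau> v"] tau_inj less.prems by (auto simp: H1_def)
      qed
    qed
    have "m \<in> \<tau> ` H1"
      using m(1) k(1) by (auto simp: H1_def)
    then have "H2 \<subset> H"
      using H by blast
    then have "card H2 < card H"
      using finH psubset_card_mono by blast
    then obtain w where w: "set w \<subseteq> roots" "disjoint_union \<Gamma> [H2] \<cong>\<^sub>q dul w"
      using less.hyps less.prems H(1) by (meson sup.boundedE)
    have "disjoint_union \<Gamma> [H] \<cong>\<^sub>q disjoint_union \<Gamma> ([H1] @ [H2])"
      unfolding H(1) append_Cons append_Nil
    proof (rule du_split[OF H(2)])
      fix v w assume "v \<in> H1" "w \<in> H2"
      then have "v \<in> vertices \<Gamma>" "w \<in> vertices \<Gamma>" "\<tau> v < k" "k < \<tau> w"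
        using less.prems by (auto simp: H1_def H2_def)
      then show "(v, w) \<notin> arrows \<Gamma> \<and> (w, v) \<notin> arrows \<Gamma>"
        by (auto simp: arrow_iff)
    qed
    also have "\<dots> \<cong>\<^sub>q disjoint_union \<Gamma> ([seg (m - 1, k - 1)] @ map seg w)"
      unfolding H1 by (intro du_append_cong isomorphic_refl w(2))
    finally have "disjoint_union \<Gamma> [H] \<cong>\<^sub>q dul ((m - 1, k - 1) # w)"
      by simp
    moreover have "(m - 1, k - 1) \<in> roots"
      using m1 k(1) k_le by (auto simp: roots_def)
    ultimately show ?thesis
      using w(1) by (intro exI[of _ "(m - 1, k - 1) # w"]) simp
  qed
qed

lemma object_decomposition:
  assumes "A \<in> objects_S \<Gamma>"
  obtains w where "set w \<subseteq> roots" "disjoint_union \<Gamma> A \<cong>\<^sub>q dul w"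
proof -
  have "\<exists>w. set w \<subseteq> roots \<and> disjoint_union \<Gamma> A \<cong>\<^sub>q dul w"
    using assms
  proof (induction A)
    case Nil
    then show ?case by (intro exI[of _ "[]"]) simp
  next
    case (Cons H A)
    then obtain w where w: "set w \<subseteq> roots" "disjoint_union \<Gamma> A \<cong>\<^sub>q dul w"
      by (auto simp: objects_S_def)
    obtain u where u: "set u \<subseteq> roots" "disjoint_union \<Gamma> [H] \<cong>\<^sub>q dul u"
      using subset_decomposition[of H] Cons.prems by (auto simp: objects_S_def)
    have "disjoint_union \<Gamma> ([H] @ A) \<cong>\<^sub>q disjoint_union \<Gamma> (map seg u @ map seg w)"
      by (rule du_append_cong[OF u(2) w(2)])
    then show ?case
      using u(1) w(1) by (intro exI[of _ "u @ w"]) simp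
  qed
  then show thesis using that by blast
qed

lemma dul_object: "map seg w \<in> objects_S \<Gamma>"
  by (auto simp: objects_S_def dest: subsetD[OF seg_subset])

sublocale convex_quiver \<Gamma>
proof
  fix A assume "A \<in> objects_S \<Gamma>"
  then obtain w where "set w \<subseteq> roots" "disjoint_union \<Gamma> A \<cong>\<^sub>q dul w"
    by (rule object_decomposition)
  then show "\<exists>B\<in>objects_S \<Gamma>. (\<forall>H\<in>set B. path_convex \<Gamma> H) \<and> disjoint_union \<Gamma> A \<cong>\<^sub>q disjoint_union \<Gamma> B"
    using dul_object path_convex_seg by (intro bexI[of _ "map seg w"]) auto
qed (rule finite_vertices)

end

section \<open>Products of segments\<close>

context convex_quiver
begin

lemma du_arrowD:
  assumes "(x, y) \<in> arrows (du B)"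
  shows "fst x = fst y" "(label x, label y) \<in> arrows \<Gamma>"
  using assms by (cases x; cases y; simp)+

lemma valid_arrow_label:
  assumes "valid R" "x \<in> vertices R" "y \<in> vertices R" "(x, y) \<in> arrows R"
  shows "(label x, label y) \<in> arrows \<Gamma>"
proof -
  obtain B \<phi> where \<phi>: "labelled_iso R (du B) \<phi>"
    using assms(1) isomorphic_sym unfolding valid_def isomorphic_def by blast
  have "(\<phi> x, \<phi> y) \<in> arrows (du B)"
    using labelled_isoD(6)[OF \<phi>] assms by blast
  from du_arrowD(2)[OF this] show ?thesis
    using labelled_isoD(5)[OF \<phi>] assms(2,3) by simp
qed

text \<open>
  In a disjoint union of sets of labels a vertex has at most one neighbour of each label. This is what
  restricts the possible gluings.
\<close>
lemma valid_unique_neighbour: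
  assumes R: "valid R" and V: "x \<in> vertices R" "y \<in> vertices R" "y' \<in> vertices R"
    and xy: "(x, y) \<in> arrows R \<or> (y, x) \<in> arrows R" "(x, y') \<in> arrows R \<or> (y', x) \<in> arrows R"
    and label: "label y = label y'"
  shows "y = y'"
proof -
  obtain B \<phi> where \<phi>: "labelled_iso R (du B) \<phi>"
    using R isomorphic_sym unfolding valid_def isomorphic_def by blast
  note D = labelled_isoD[OF \<phi>]
  have "fst (\<phi> x) = fst (\<phi> y)" "fst (\<phi> x) = fst (\<phi> y')"
    using xy D(6)[OF V(1,2)] D(6)[OF V(2,1)] D(6)[OF V(1,3)] D(6)[OF V(3,1)] du_arrowD(1) by metis+
  then have "\<phi> y = \<phi> y'"
    using D(5)[OF V(2)] D(5)[OF V(3)] label by (simp add: prod_eq_iff)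
  then show ?thesis
    using D(2) V by (simp add: inj_on_def)
qed

end

context line_quiver
begin

text \<open>
  The segments are adjacent and the edge between them is oriented from \<open>\<gamma>\<close> to \<open>\<beta>\<close>, so that \<open>\<gamma>\<close> as a
  quotient can be glued to \<open>\<beta>\<close> as a subobject.
\<close>
definition joins :: "nat \<times> nat \<Rightarrow> nat \<times> nat \<Rightarrow> bool" where
  "joins \<gamma> \<beta> \<longleftrightarrow> (snd \<gamma> = fst \<beta> \<and> up (fst \<beta>)) \<or> (snd \<beta> = fst \<gamma> \<and> \<not> up (fst \<gamma>))"

text \<open>
  The segments are ordered by a difference of potentials. Three points \<open>i < j < k\<close> have to satisfy
  \<open>\<xi>\<^sub>i - \<xi>\<^sub>j < \<xi>\<^sub>j - \<xi>\<^sub>k\<close> or the reverse inequality according to the orientation at \<open>j\<close>. The sign of \<open>\<xi>\<^sub>j\<close>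
  records this orientation, and absolute values that increase to 1 at a geometric rate make \<open>2 \<xi>\<^sub>j\<close>
  dominate (\<open>xi_between\<close>).
\<close>
definition xi :: "nat \<Rightarrow> real" where
  "xi j = (if up j then 1 else - 1) * (1 - (1 / 2) ^ j)"

definition key :: "nat \<times> nat \<Rightarrow> real" where
  "key \<beta> = xi (fst \<beta>) - xi (snd \<beta>)"

text \<open>
  With \<open>h = 1 / 2\<close> the claim is \<open>2 h\<^sup>j < h\<^sup>i + h\<^sup>k\<close>, and already \<open>2 h\<^sup>j \<le> h\<^sup>i\<close>.
\<close>
lemma xi_between:
  assumes "i < j" "j < k"
  shows "\<bar>xi i\<bar> + \<bar>xi k\<bar> < 2 * \<bar>xi j\<bar>"
proof -
  define h :: real where "h = 1 / 2"
  have abs: "\<bar>xi l\<bar> = 1 - h ^ l" for l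
    by (simp add: xi_def abs_mult power_le_one h_def)
  have "h ^ (j - 1) \<le> h ^ i"
    using assms(1) by (intro power_decreasing) (auto simp: h_def)
  also have "h ^ (j - 1) = 2 * h ^ j"
    using assms(1) by (cases j) (auto simp: h_def)
  finally have "2 * h ^ j \<le> h ^ i" .
  moreover have "h ^ k > 0"
    by (simp add: h_def)
  ultimately show ?thesis
    using abs[of i] abs[of j] abs[of k] by linarith
qed

lemma joins_key:
  assumes "\<gamma> \<in> roots" "\<beta> \<in> roots" "joins \<gamma> \<beta>"
  shows "key \<gamma> < key \<beta>"
proof -
  obtain i j k where ijk: "i < j" "j < k"
    and cases: "(\<gamma> = (i, j) \<and> \<beta> = (j, k) \<and> up j) \<or> (\<gamma> = (j, k) \<and> \<beta> = (i, j) \<and> \<not> up j)"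
    using assms unfolding roots_def joins_def by auto
  have "xi j \<ge> 0 \<longleftrightarrow> up j"
  proof -
    have "(1 / 2 :: real) ^ j < 1"
      using ijk(1) by (simp add: power_less_one_iff)
    then show ?thesis
      by (simp add: xi_def)
  qed
  with cases xi_between[OF ijk] show ?thesis
    unfolding key_def by auto
qed

text \<open>
  Let a gluing of \<open>\<beta>\<close> with a disjoint union contain an arrow from \<open>c\<close> to \<open>a\<close>. If the label of \<open>a\<close> occurred
  in the segment of \<open>c\<close>, then \<open>c\<close> would have two neighbours with this label, one in each of the glued
  quivers. So the label of \<open>a\<close> lies just outside the segment of \<open>c\<close>, and likewise with \<open>a\<close> and \<open>c\<close>
  exchanged: the segments are adjacent and the arrow joins their ends.
\<close>
lemma extension_edge:
  fixes \<beta> :: "nat \<times> nat" and w :: "(nat \<times> nat) list"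
  defines "P \<equiv> dul [\<beta>]" and "Q \<equiv> shift 1 (dul w)"
  assumes \<beta>: "\<beta> \<in> roots" and w: "set w \<subseteq> roots"
    and E: "E \<in> extensions P Q" and ca: "(c, a) \<in> E"
  obtains q where "q < length w" "joins (w ! q) \<beta>"
    "snd (w ! q) = fst \<beta> \<longrightarrow> c = (Suc q, vert (fst \<beta>)) \<and> a = (0, vert (Suc (fst \<beta>)))"
    "snd \<beta> = fst (w ! q) \<longrightarrow> c = (Suc q, vert (Suc (snd \<beta>))) \<and> a = (0, vert (snd \<beta>))"
proof -
  have sep: "separated P Q"
    using separated_shift[of \<Gamma> "[seg \<beta>]" "map seg w"] by (simp add: P_def Q_def)
  have val: "valid (glue P Q E)" and sub: "E \<subseteq> vertices Q \<times> vertices P"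
    using E by (simp_all add: extensions_def)
  obtain p v where c: "c = (p, v)" by fastforce
  obtain p' u where a: "a = (p', u)" by fastforce
  have "c \<in> vertices Q" "a \<in> vertices P"
    using sub ca by blast+
  define q where "q = p - 1"
  have q: "p = Suc q" "q < length w" "v \<in> seg (w ! q)" and p': "p' = 0" "u \<in> seg \<beta>"
    using \<open>c \<in> vertices Q\<close> \<open>a \<in> vertices P\<close> by (auto simp: P_def Q_def c a q_def)
  let ?\<gamma> = "w ! q"
  have \<gamma>: "?\<gamma> \<in> roots"
    using w q(2) nth_mem by blast
  have uv: "u \<in> vertices \<Gamma>" "v \<in> vertices \<Gamma>"
    using q p' seg_subset by blast+
  have inR: "c \<in> vertices (glue P Q E)" "a \<in> vertices (glue P Q E)"
    using \<open>c \<in> vertices Q\<close> \<open>a \<in> vertices P\<close> by simp_all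
  have ca_arrow: "(c, a) \<in> arrows (glue P Q E)"
    using ca by simp
  have arrow: "(v, u) \<in> arrows \<Gamma>"
    using valid_arrow_label[OF val inR ca_arrow] by (simp add: a c)
  have "u \<notin> seg ?\<gamma>"
  proof
    assume u: "u \<in> seg ?\<gamma>"
    have x: "(Suc q, u) \<in> vertices Q" "(c, (Suc q, u)) \<in> arrows Q"
      using u q arrow by (simp_all add: Q_def c)
    then have "a = (Suc q, u)"
      by (intro valid_unique_neighbour[OF val inR(1) inR(2)]) (use ca_arrow in \<open>simp_all add: a\<close>)
    with p' a show False by simp
  qed
  moreover have "v \<notin> seg \<beta>"
  proof
    assume v: "v \<in> seg \<beta>"
    have x: "(0, v) \<in> vertices P" "((0, v), a) \<in> arrows P"
      using v p' arrow by (simp_all add: P_def a)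
    then have "c = (0, v)"
      by (intro valid_unique_neighbour[OF val inR(2) inR(1)]) (use ca_arrow in \<open>simp_all add: c\<close>)
    with q c show False by simp
  qed
  moreover have "(\<tau> u = Suc (\<tau> v) \<and> up (\<tau> v)) \<or> (\<tau> v = Suc (\<tau> u) \<and> \<not> up (\<tau> u))"
    using arrow arrow_iff uv by blast
  ultimately have cases: "(\<tau> u = Suc (\<tau> v) \<and> up (\<tau> v) \<and> snd ?\<gamma> = \<tau> v \<and> fst \<beta> = \<tau> v) \<or>
      (\<tau> v = Suc (\<tau> u) \<and> \<not> up (\<tau> u) \<and> fst ?\<gamma> = \<tau> u \<and> snd \<beta> = \<tau> u)"
    using uv q(3) p'(2) unfolding seg_def by auto
  have lt: "fst \<beta> < snd \<beta>" "fst ?\<gamma> < snd ?\<gamma>"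
    using \<beta> \<gamma> by (auto simp: roots_def)
  from cases show thesis
  proof
    assume 1: "\<tau> u = Suc (\<tau> v) \<and> up (\<tau> v) \<and> snd ?\<gamma> = \<tau> v \<and> fst \<beta> = \<tau> v"
    then have "vert (fst \<beta>) = v" "vert (Suc (fst \<beta>)) = u"
      using uv by (metis vert_tau)+
    then show thesis
      using 1 lt q p' by (intro that[of q]) (auto simp: joins_def a c)
  next
    assume 2: "\<tau> v = Suc (\<tau> u) \<and> \<not> up (\<tau> u) \<and> fst ?\<gamma> = \<tau> u \<and> snd \<beta> = \<tau> u"
    then have "vert (snd \<beta>) = u" "vert (Suc (snd \<beta>)) = v"
      using uv by (metis vert_tau)+
    then show thesis
      using 2 lt q p' by (intro that[of q]) (auto simp: joins_def a c)
  qed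
qed

definition hbasis :: "(nat \<times> nat) list \<Rightarrow> obj set \<Rightarrow> 'k::field" where
  "hbasis w = basis_vec (cls (dul w))"

lemma hbasis_in: "hbasis w \<in> finsupp iso_classes"
  unfolding hbasis_def by (intro finsupp_basis_vec cls_in_iso_classes valid_du dul_object)

lemma hbasis_permute: "mset w = mset w' \<Longrightarrow> hbasis w = hbasis w'"
  unfolding hbasis_def by (intro arg_cong[of _ _ basis_vec] cls_eqI du_permute) simp

lemma glue_dul: "glue (dul [\<beta>]) (shift 1 (dul w)) {} = dul (\<beta> # w)"
  using glue_du[of \<Gamma> "[seg \<beta>]" "map seg w"] by simp

lemma hbasis_mult:
  "H.prod_alg (hbasis [\<beta>]) (hbasis w) =
    (\<Sum>E\<in>extensions (dul [\<beta>]) (shift 1 (dul w)).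
       basis_vec (cls (glue (dul [\<beta>]) (shift 1 (dul w)) E)) :: obj set \<Rightarrow> 'k::field)"
proof -
  have "separated (dul [\<beta>]) (shift 1 (dul w))"
    using separated_shift[of \<Gamma> "[seg \<beta>]" "map seg w"] by simp
  moreover have "cls (dul w) = cls (shift 1 (dul w))"
    by (rule cls_eqI[OF shift_isomorphic])
  moreover have "valid (dul [\<beta>])" "valid (shift 1 (dul w))"
    using valid_du[OF dul_object] valid_isomorphic[OF _ shift_isomorphic] by blast+
  ultimately show ?thesis
    unfolding hbasis_def by (simp only: hall_mult)
qed

lemma empty_extension: "{} \<in> extensions (dul [\<beta>]) (shift 1 (dul w))"
  unfolding extensions_def mem_Collect_eq glue_dul using valid_du[OF dul_object] by blast

text \<open>
  By the choice of the ordering no segment of \<open>w\<close> joins \<open>\<beta>\<close>, so the only extension is the split one.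
\<close>
lemma hbasis_mult_sorted:
  assumes "\<beta> \<in> roots" "set w \<subseteq> roots" "\<And>\<gamma>. \<gamma> \<in> set w \<Longrightarrow> key \<beta> \<le> key \<gamma>"
  shows "H.prod_alg (hbasis [\<beta>]) (hbasis w) = (hbasis (\<beta> # w) :: obj set \<Rightarrow> 'k::field)"
proof -
  have no_join: "\<not> joins \<gamma> \<beta>" if "\<gamma> \<in> set w" for \<gamma>
    using joins_key[OF _ assms(1)] assms(2) assms(3)[OF that] that by (meson leD subsetD)
  have "E = {}" if E: "E \<in> extensions (dul [\<beta>]) (shift 1 (dul w))" for E
  proof (rule ccontr)
    assume "E \<noteq> {}"
    then obtain c a where "(c, a) \<in> E"
      by (metis ex_in_conv surj_pair)
    from extension_edge[OF assms(1,2) E this] show False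
      using no_join nth_mem by metis
  qed
  then have "extensions (dul [\<beta>]) (shift 1 (dul w)) = {{}}"
    using empty_extension by blast
  then show ?thesis
    unfolding hbasis_mult by (simp add: glue_dul[unfolded One_nat_def] hbasis_def del: list.map)
qed

text \<open>
  Forgetting the tags maps the two segments onto their union, and the arrows of the union that lead from
  \<open>\<gamma>\<close> to \<open>\<beta>\<close> form the required \<open>E\<close>.
\<close>
lemma glue_join:
  assumes "\<beta> \<in> roots" "\<gamma> \<in> roots" "joins \<gamma> \<beta>"
  shows "\<exists>E. E \<noteq> {} \<and> E \<in> extensions (dul [\<beta>]) (shift 1 (dul [\<gamma>])) \<and>
    glue (dul [\<beta>]) (shift 1 (dul [\<gamma>])) E \<cong>\<^sub>q dul [(min (fst \<beta>) (fst \<gamma>), max (snd \<beta>) (snd \<gamma>))]"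
proof -
  let ?\<delta> = "(min (fst \<beta>) (fst \<gamma>), max (snd \<beta>) (snd \<gamma>))"
  let ?P = "dul [\<beta>]" and ?Q = "shift 1 (dul [\<gamma>])"
  define e where "e = (\<lambda>x :: nat \<times> nat. (0 :: nat, snd x))"
  define E where "E = {(x, y). x \<in> vertices ?Q \<and> y \<in> vertices ?P \<and> (e x, e y) \<in> arrows (dul [?\<delta>])}"
  have lt: "fst \<beta> < snd \<beta>" "fst \<gamma> < snd \<gamma>" "snd \<beta> \<le> n" "snd \<gamma> \<le> n"
    using assms(1,2) by (auto simp: roots_def)
  have adj: "snd \<gamma> = fst \<beta> \<and> up (snd \<gamma>) \<or> snd \<beta> = fst \<gamma> \<and> \<not> up (snd \<beta>)"
    using assms(3) by (auto simp: joins_def)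
  have seg: "seg ?\<delta> = seg \<beta> \<union> seg \<gamma>" "seg \<beta> \<inter> seg \<gamma> = {}"
    using adj lt by (auto simp: seg_def)
  have VP: "(p, v) \<in> vertices ?P \<longleftrightarrow> p = 0 \<and> v \<in> seg \<beta>" for p v
    by auto
  have VQ: "(p, v) \<in> vertices ?Q \<longleftrightarrow> p = 1 \<and> v \<in> seg \<gamma>" for p v
    by auto
  have sep: "separated ?P ?Q"
    using separated_shift[of \<Gamma> "[seg \<beta>]" "map seg [\<gamma>]"] by simp
  have iso: "labelled_iso (glue ?P ?Q E) (dul [?\<delta>]) (\<lambda>z. if z \<in> vertices ?P then e z else e z)"
  proof (rule glue_iso[OF sep])
    show "labelled_emb ?P (dul [?\<delta>]) e"
      unfolding labelled_emb_def by (auto simp: e_def seg inj_on_def)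
    show "labelled_emb ?Q (dul [?\<delta>]) e"
      unfolding labelled_emb_def by (auto simp: e_def seg inj_on_def)
    show "e ` vertices ?P \<inter> e ` vertices ?Q = {}"
      using seg(2) by (auto simp: e_def disjoint_iff)
    show "e ` vertices ?P \<union> e ` vertices ?Q = vertices (dul [?\<delta>])"
    proof
      show "vertices (dul [?\<delta>]) \<subseteq> e ` vertices ?P \<union> e ` vertices ?Q"
      proof
        fix x assume "x \<in> vertices (dul [?\<delta>])"
        then obtain v where "x = (0, v)" "v \<in> seg \<beta> \<or> v \<in> seg \<gamma>"
          using seg(1) by (cases x) auto
        then have "x = e (0, v) \<and> (0, v) \<in> vertices ?P \<or> x = e (1, v) \<and> (1, v) \<in> vertices ?Q"
          unfolding VP VQ by (simp add: e_def)
        then show "x \<in> e ` vertices ?P \<union> e ` vertices ?Q"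
          by blast
      qed
    qed (auto simp: e_def seg)
    show "(e x, e y) \<notin> arrows (dul [?\<delta>])" if "x \<in> vertices ?P" "y \<in> vertices ?Q" for x y
    proof -
      obtain p v p' u where pq: "x = (p, v)" "y = (p', u)"
        by (metis surj_pair)
      with that VP VQ have vu: "v \<in> seg \<beta>" "u \<in> seg \<gamma>"
        by blast+
      have "(v, u) \<notin> arrows \<Gamma>"
      proof
        assume "(v, u) \<in> arrows \<Gamma>"
        then have "\<tau> u = Suc (\<tau> v) \<and> up (\<tau> v) \<or> \<tau> v = Suc (\<tau> u) \<and> \<not> up (\<tau> u)"
          using arrow_iff arrow_vertices by blast
        moreover have "fst \<beta> < \<tau> v" "\<tau> v \<le> snd \<beta>" "fst \<gamma> < \<tau> u" "\<tau> u \<le> snd \<gamma>"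
          using vu by (auto simp: seg_def)
        ultimately have "\<tau> u = snd \<gamma> \<and> \<not> up (\<tau> u) \<and> snd \<gamma> = fst \<beta> \<or> \<tau> v = snd \<beta> \<and> up (\<tau> v) \<and> snd \<beta> = fst \<gamma>"
          using adj lt by linarith
        with adj lt show False by auto
      qed
      then show ?thesis
        by (simp add: e_def pq)
    qed
  qed (auto simp: E_def)
  \<comment> \<open>The edge at the point where the segments meet contributes an arrow to \<open>E\<close>.\<close>
  obtain j where j: "1 \<le> j" "Suc j \<le> n"
    "vert j \<in> seg \<gamma> \<and> vert (Suc j) \<in> seg \<beta> \<and> (vert j, vert (Suc j)) \<in> arrows \<Gamma> \<or>
     vert j \<in> seg \<beta> \<and> vert (Suc j) \<in> seg \<gamma> \<and> (vert (Suc j), vert j) \<in> arrows \<Gamma>"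
  proof -
    from adj show thesis
    proof
      assume 1: "snd \<gamma> = fst \<beta> \<and> up (snd \<gamma>)"
      then show thesis
        using lt assms(1,2) by (intro that[of "snd \<gamma>"]) (auto simp: up_def intro!: vert_in_seg)
    next
      assume 2: "snd \<beta> = fst \<gamma> \<and> \<not> up (snd \<beta>)"
      then show thesis
        using lt assms(1,2) by (intro that[of "snd \<beta>"]) (auto simp: arrow_iff vert intro!: vert_in_seg)
    qed
  qed
  have "E \<noteq> {}"
  proof -
    from j(3) have "((1, vert j), (0, vert (Suc j))) \<in> E \<or> ((1, vert (Suc j)), (0, vert j)) \<in> E"
      unfolding E_def mem_Collect_eq split VP VQ by (auto simp: e_def seg)
    then show ?thesis by blast
  qed
  moreover have iso': "glue ?P ?Q E \<cong>\<^sub>q dul [?\<delta>]"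
    using iso unfolding isomorphic_def by blast
  moreover have "E \<in> extensions ?P ?Q"
  proof -
    have "valid (glue ?P ?Q E)"
      using valid_isomorphic[OF valid_du[OF dul_object] isomorphic_sym[OF iso']] .
    moreover have "E \<subseteq> vertices ?Q \<times> vertices ?P"
      unfolding E_def by blast
    ultimately show ?thesis
      by (simp add: extensions_def)
  qed
  ultimately show ?thesis by blast
qed

lemma hbasis_mult_two:
  assumes "\<beta> \<in> roots" "\<gamma> \<in> roots"
  shows "H.prod_alg (hbasis [\<beta>]) (hbasis [\<gamma>]) =
    (hbasis [\<beta>, \<gamma>] + (if joins \<gamma> \<beta>
       then hbasis [(min (fst \<beta>) (fst \<gamma>), max (snd \<beta>) (snd \<gamma>))] else 0) :: obj set \<Rightarrow> 'k::field)"
proof -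
  let ?P = "dul [\<beta>]" and ?Q = "shift 1 (dul [\<gamma>])"
  have lt: "fst \<beta> < snd \<beta>" "fst \<gamma> < snd \<gamma>"
    using assms by (auto simp: roots_def)
  have edge: "joins \<gamma> \<beta> \<and> (c, a) = (if snd \<gamma> = fst \<beta>
      then ((1, vert (fst \<beta>)), (0, vert (Suc (fst \<beta>)))) else ((1, vert (Suc (snd \<beta>))), (0, vert (snd \<beta>))))"
    if E: "E \<in> extensions ?P ?Q" "(c, a) \<in> E" for E c a
  proof -
    obtain q where "q < length [\<gamma>]" "joins ([\<gamma>] ! q) \<beta>"
      "snd ([\<gamma>] ! q) = fst \<beta> \<longrightarrow> c = (Suc q, vert (fst \<beta>)) \<and> a = (0, vert (Suc (fst \<beta>)))"
      "snd \<beta> = fst ([\<gamma>] ! q) \<longrightarrow> c = (Suc q, vert (Suc (snd \<beta>))) \<and> a = (0, vert (snd \<beta>))"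
      by (rule extension_edge[OF assms(1) _ E]) (use assms in auto)
    then show ?thesis
      by (auto simp: joins_def)
  qed
  show ?thesis
  proof (cases "joins \<gamma> \<beta>")
    case False
    have "E = {}" if "E \<in> extensions ?P ?Q" for E
      using edge[OF that] False by (metis ex_in_conv surj_pair)
    then have "extensions ?P ?Q = {{}}"
      using empty_extension by blast
    with False show ?thesis
      unfolding hbasis_mult by (simp add: glue_dul[unfolded One_nat_def] hbasis_def del: list.map)
  next
    case True
    obtain E where E: "E \<noteq> {}" "E \<in> extensions ?P ?Q"
      "glue ?P ?Q E \<cong>\<^sub>q dul [(min (fst \<beta>) (fst \<gamma>), max (snd \<beta>) (snd \<gamma>))]"
      using glue_join[OF assms True] by blast
    have "E' = E" if E': "E' \<in> extensions ?P ?Q" "E' \<noteq> {}" for E'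
    proof -
      have single: "F = {if snd \<gamma> = fst \<beta> then ((1, vert (fst \<beta>)), (0, vert (Suc (fst \<beta>))))
          else ((1, vert (Suc (snd \<beta>))), (0, vert (snd \<beta>)))}" (is "F = {?ca}")
        if F: "F \<in> extensions ?P ?Q" "F \<noteq> {}" for F
      proof -
        have "x = ?ca" if "x \<in> F" for x
          using edge[OF F(1), of "fst x" "snd x"] that by simp
        with F(2) show ?thesis by blast
      qed
      show ?thesis
        using single[OF E'] single[OF E(2,1)] by simp
    qed
    then have "extensions ?P ?Q = {{}, E}"
      using E empty_extension by blast
    with E(1) True cls_eqI[OF E(3)] show ?thesis
      unfolding hbasis_mult by (simp add: glue_dul[unfolded One_nat_def] hbasis_def del: list.map)
  qed
qed

text \<open>A segment is connected, so an isomorphism cannot distribute it over several summands.\<close>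
lemma segment_image:
  assumes \<phi>: "labelled_iso (dul w) (dul w') \<phi>" and p: "p < length w" "w ! p \<in> roots"
  shows "\<exists>q<length w'. \<forall>v\<in>seg (w ! p). \<phi> (p, v) = (q, v) \<and> v \<in> seg (w' ! q)"
proof -
  note D = labelled_isoD[OF \<phi>]
  obtain i j where ij: "w ! p = (i, j)" "i < j" "j \<le> n"
    using p(2) by (auto simp: roots_def)
  have V: "(p, v) \<in> vertices (dul w)" if "v \<in> seg (w ! p)" for v
    using that p(1) by simp
  have same: "fst (\<phi> (p, vert k)) = fst (\<phi> (p, vert (Suc i)))" if "Suc i \<le> k" "k \<le> j" for k
    using that
  proof (induction k rule: dec_induct)
    case (step k)
    have k: "vert k \<in> seg (w ! p)" "vert (Suc k) \<in> seg (w ! p)" "1 \<le> k" "Suc k \<le> n"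
      using step.hyps step.prems ij p(2) by (auto intro!: vert_in_seg)
    then have "(vert k, vert (Suc k)) \<in> arrows \<Gamma> \<or> (vert (Suc k), vert k) \<in> arrows \<Gamma>"
      by (subst adjacent) (simp_all add: vert adjacent_A_def)
    then have "((p, vert k), (p, vert (Suc k))) \<in> arrows (dul w) \<or>
        ((p, vert (Suc k)), (p, vert k)) \<in> arrows (dul w)"
      using k p(1) by simp
    then have "fst (\<phi> (p, vert k)) = fst (\<phi> (p, vert (Suc k)))"
      using D(6)[OF V[OF k(1)] V[OF k(2)]] D(6)[OF V[OF k(2)] V[OF k(1)]] du_arrowD(1) by metis
    with step show ?case by simp
  qed simp
  let ?q = "fst (\<phi> (p, vert (Suc i)))"
  have img: "\<phi> (p, v) = (?q, v)" if v: "v \<in> seg (w ! p)" for v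
  proof -
    have "v \<in> vertices \<Gamma>" "Suc i \<le> \<tau> v" "\<tau> v \<le> j"
      using v ij by (auto simp: seg_def)
    then have "fst (\<phi> (p, v)) = ?q"
      using same[of "\<tau> v"] by simp
    then show ?thesis
      using D(5)[OF V[OF v]] by (simp add: prod_eq_iff)
  qed
  have mem: "(?q, v) \<in> vertices (dul w')" if "v \<in> seg (w ! p)" for v
    using D(4)[OF V[OF that]] unfolding img[OF that] .
  have "vert (Suc i) \<in> seg (w ! p)"
    using ij p(2) by (intro vert_in_seg) auto
  then have q: "?q < length w'"
    using mem by fastforce
  have seg: "v \<in> seg (w' ! ?q)" if "v \<in> seg (w ! p)" for v
    using mem[OF that] nth_map[OF q, of seg] by simp
  show ?thesis
    by (rule exI[of _ ?q]) (use img q seg in blast)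
qed

text \<open>
  Uniqueness of the decomposition into segments: an isomorphism and its inverse induce mutually inverse
  maps between the summands, and each summand is contained in its image in both directions.
\<close>
lemma dul_isomorphic_imp_mset_eq:
  assumes w: "set w \<subseteq> roots" and w': "set w' \<subseteq> roots" and iso: "dul w \<cong>\<^sub>q dul w'"
  shows "mset w = mset w'"
proof -
  obtain \<phi> where \<phi>: "labelled_iso (dul w) (dul w') \<phi>"
    using iso unfolding isomorphic_def by blast
  let ?\<psi> = "inv_into (vertices (dul w)) \<phi>"
  have \<psi>: "labelled_iso (dul w') (dul w) ?\<psi>"
    by (rule labelled_iso_inv[OF \<phi>])
  have r: "w ! p \<in> roots" if "p < length w" for p
    using w that nth_mem by blast
  have r': "w' ! q \<in> roots" if "q < length w'" for q
    using w' that nth_mem by blast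
  obtain f where f: "\<And>p. p < length w \<Longrightarrow> f p < length w' \<and>
      (\<forall>v\<in>seg (w ! p). \<phi> (p, v) = (f p, v) \<and> v \<in> seg (w' ! f p))"
    using segment_image[OF \<phi> _ r] by metis
  obtain g where g: "\<And>q. q < length w' \<Longrightarrow> g q < length w \<and>
      (\<forall>v\<in>seg (w' ! q). ?\<psi> (q, v) = (g q, v) \<and> v \<in> seg (w ! g q))"
    using segment_image[OF \<psi> _ r'] by metis
  have nonempty: "\<exists>v. v \<in> seg \<beta>" if "\<beta> \<in> roots" for \<beta>
    using that vert_in_seg[of \<beta> "snd \<beta>"] by (auto simp: roots_def)
  have gf: "g (f p) = p" if p: "p < length w" for p
  proof -
    obtain v where v: "v \<in> seg (w ! p)"
      using nonempty[OF r[OF p]] by blast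
    have V: "(p, v) \<in> vertices (dul w)"
      using v p by simp
    have "?\<psi> (\<phi> (p, v)) = (p, v)"
      using labelled_isoD(2)[OF \<phi>] V by (rule inv_into_f_f)
    with v f[OF p] g[of "f p"] show ?thesis
      by (metis Pair_inject)
  qed
  have fg: "f (g q) = q" if q: "q < length w'" for q
  proof -
    obtain v where v: "v \<in> seg (w' ! q)"
      using nonempty[OF r'[OF q]] by blast
    have V: "(q, v) \<in> vertices (dul w')"
      using v q by simp
    have "\<phi> (?\<psi> (q, v)) = (q, v)"
    proof (rule f_inv_into_f)
      show "(q, v) \<in> \<phi> ` vertices (dul w)"
        unfolding labelled_isoD(3)[OF \<phi>] by (rule V)
    qed
    with v g[OF q] f[of "g q"] show ?thesis
      by (metis Pair_inject)
  qed
  have eq: "w ! p = w' ! f p" if p: "p < length w" for p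
  proof (rule seg_inj)
    have "seg (w ! p) \<subseteq> seg (w' ! f p)"
      using f[OF p] by blast
    moreover have "seg (w' ! f p) \<subseteq> seg (w ! p)"
      using g[of "f p"] f[OF p] gf[OF p] by auto
    ultimately show "seg (w ! p) = seg (w' ! f p)" by blast
  qed (use r[OF p] r' f[OF p] in auto)
  have bij: "bij_betw f {..<length w} {..<length w'}"
    by (rule bij_betw_byWitness[where f' = g]) (use f g gf fg in auto)
  have mset_nth: "mset u = image_mset (\<lambda>p. u ! p) (mset_set {..<length u})" for u :: "(nat \<times> nat) list"
    by (metis map_nth mset_map mset_upt lessThan_atLeast0)
  have "mset w = image_mset (\<lambda>p. w' ! f p) (mset_set {..<length w})"
    unfolding mset_nth[of w] by (intro image_mset_cong) (simp add: eq)
  also have "\<dots> = image_mset (\<lambda>q. w' ! q) (image_mset f (mset_set {..<length w}))"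
    by (simp add: image_mset.compositionality comp_def)
  also have "image_mset f (mset_set {..<length w}) = mset_set {..<length w'}"
    using bij by (simp add: image_mset_mset_set bij_betw_def)
  finally show ?thesis
    unfolding mset_nth[of w'] .
qed

end

section \<open>The Lie algebra inside the Hall algebra\<close>

lemma free_algebra_unital:
  "unital_algebra (lists S) [] (\<lambda>u v w. if w = u @ v then 1 else (0 :: 'k::field))"
proof -
  interpret structure_constants "lists S" "[]" "\<lambda>u v w. if w = u @ v then 1 else (0 :: 'k)"
    by standard auto
  have prod: "prod_alg (basis_vec u) (basis_vec v) = basis_vec (u @ v)" if "u \<in> lists S" "v \<in> lists S" for u v
    using that unfolding mult_basis bprod_def by (auto simp: basis_vec_def fun_eq_iff)
  show ?thesis
    by standard (simp_all add: prod del: in_lists_conv_set)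
qed

text \<open>The second parameter only fixes the field of scalars.\<close>
locale free_algebra_on =
  fixes S :: "'v set" and field_type :: "'k::field itself"
begin

sublocale unital_algebra "lists S" "[]" "\<lambda>u v w. if w = u @ v then 1 else (0 :: 'k)"
  by (rule free_algebra_unital)

lemma free_algebra_eq: "(free_algebra S :: ('k, 'v list \<Rightarrow> 'k) module) = alg"
  by (simp add: free_algebra_def)

lemma mult_words:
  "u \<in> lists S \<Longrightarrow> v \<in> lists S \<Longrightarrow> prod_alg (basis_vec u) (basis_vec v) = (basis_vec (u @ v) :: 'v list \<Rightarrow> 'k)"
  unfolding mult_basis bprod_def by (auto simp: basis_vec_def fun_eq_iff)

end

lemma free_gen_eq: "free_gen x = basis_vec [x]"
  by (simp add: free_gen_def basis_vec_def)

context structure_constants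
begin

lemma mult_diff_left:
  assumes "x \<in> finsupp B" "x' \<in> finsupp B"
  shows "(x - x') \<odot>\<odot> y = x \<odot>\<odot> y - x' \<odot>\<odot> y"
proof -
  have "(x + scale (- 1) x') \<odot>\<odot> y = x \<odot>\<odot> y + scale (- 1) (x' \<odot>\<odot> y)"
    using assms by (simp only: mult_add_left mult_scale_left finsupp_scale)
  then show ?thesis
    by (simp add: scale_distribs)
qed

lemma mult_diff_right:
  assumes "y \<in> finsupp B" "y' \<in> finsupp B"
  shows "x \<odot>\<odot> (y - y') = x \<odot>\<odot> y - x \<odot>\<odot> y'"
proof -
  have "x \<odot>\<odot> (y + scale (- 1) y') = x \<odot>\<odot> y + scale (- 1) (x \<odot>\<odot> y')"
    using assms by (simp only: mult_add_right mult_scale_right finsupp_scale)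
  then show ?thesis
    by (simp add: scale_distribs)
qed

end

context line_quiver
begin

text \<open>
  The commutator of the classes of \<open>(i, j)\<close> and \<open>(j, k)\<close> is the class of \<open>(i, k)\<close> up to the sign of the
  edge at \<open>j\<close>. Scaling the class of \<open>(i, k)\<close> by all signs at inner points of \<open>(i, k)\<close> absorbs these
  signs, by \<open>root_sign_split\<close>.
\<close>
definition edge_sign :: "nat \<Rightarrow> 'k::field" where
  "edge_sign l = (if up l then - 1 else 1)"

definition root_sign :: "nat \<Rightarrow> nat \<Rightarrow> 'k::field" where
  "root_sign i j = (\<Prod>l\<in>{i<..<j}. edge_sign l)"

lemma root_sign_split:
  assumes "i < j" "j < k"
  shows "root_sign i k = root_sign i j * edge_sign j * root_sign j k"
proof -
  have "{i<..<k} = insert j ({i<..<j} \<union> {j<..<k})"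
    using assms by auto
  moreover have "j \<notin> {i<..<j} \<union> {j<..<k}" "{i<..<j} \<inter> {j<..<k} = {}"
    by auto
  ultimately show ?thesis
    unfolding root_sign_def by (simp add: prod.union_disjoint mult.assoc mult.left_commute)
qed

lemma root_sign_square: "root_sign i j * root_sign i j = (1 :: 'k::field)"
  unfolding root_sign_def prod.distrib[symmetric] by (rule prod.neutral) (simp add: edge_sign_def)

definition strict_upper :: "'k::field mat set" where
  "strict_upper = lcarrier (sl_positive_part (n + 1))"

lemma strict_upper_iff:
  "A \<in> strict_upper \<longleftrightarrow> A \<in> carrier_mat (Suc n) (Suc n) \<and> (\<forall>i\<le>n. \<forall>j\<le>i. A $$ (i, j) = 0)"
  by (auto simp: strict_upper_def sl_positive_part_def less_Suc_eq_le)

lemma strict_upper_closed: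
  assumes "A \<in> strict_upper" "B \<in> strict_upper"
  shows "A + B \<in> strict_upper" "a \<cdot>\<^sub>m A \<in> strict_upper" "A * B \<in> strict_upper" "A * B - B * A \<in> strict_upper"
proof -
  have dim: "A \<in> carrier_mat (Suc n) (Suc n)" "B \<in> carrier_mat (Suc n) (Suc n)"
    using assms by (simp_all add: strict_upper_iff)
  show "A + B \<in> strict_upper" "a \<cdot>\<^sub>m A \<in> strict_upper"
    using assms by (auto simp: strict_upper_iff)
  have prod: "A * B \<in> strict_upper" if "A \<in> strict_upper" "B \<in> strict_upper" for A B :: "'a mat"
  proof -
    have "(A * B) $$ (i, j) = 0" if "i \<le> n" "j \<le> i" for i j
    proof -
      have "A $$ (i, l) * B $$ (l, j) = 0" if "l \<le> n" for l
        using \<open>A \<in> strict_upper\<close> \<open>B \<in> strict_upper\<close> \<open>i \<le> n\<close> \<open>j \<le> i\<close> that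
        by (cases "l \<le> i") (auto simp: strict_upper_iff)
      then show ?thesis
        using \<open>A \<in> strict_upper\<close> \<open>B \<in> strict_upper\<close> that
        by (auto simp: strict_upper_iff scalar_prod_def intro!: sum.neutral)
    qed
    then show ?thesis
      using that by (auto simp: strict_upper_iff)
  qed
  then show AB: "A * B \<in> strict_upper"
    using assms by blast
  have "B * A \<in> strict_upper"
    using prod assms by blast
  with AB show "A * B - B * A \<in> strict_upper"
    using dim by (auto simp: strict_upper_iff)
qed

text \<open>
  The sum runs over all entries, which makes linearity immediate. For \<open>j \<le> i\<close> the pair \<open>(i, j)\<close>
  denotes the empty segment, but there the entries of a strictly upper triangular matrix vanish.
\<close>
definition hall_of_mat :: "'k::field mat \<Rightarrow> obj set \<Rightarrow> 'k" where
  "hall_of_mat A = (\<Sum>i\<le>n. \<Sum>j\<le>n. scale (root_sign i j * A $$ (i, j)) (hbasis [(i, j)]))"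

lemma hall_of_mat_in: "hall_of_mat A \<in> finsupp iso_classes"
  unfolding hall_of_mat_def by (intro finsupp_sum finsupp_scale hbasis_in)

lemma hall_of_mat_add:
  assumes "A \<in> carrier_mat (Suc n) (Suc n)" "B \<in> carrier_mat (Suc n) (Suc n)"
  shows "hall_of_mat (A + B) = hall_of_mat A + hall_of_mat B"
  unfolding hall_of_mat_def sum.distrib[symmetric] scale_distribs(2)[symmetric]
  using assms by (intro sum.cong HOL.refl) (simp add: distrib_left)

lemma hall_of_mat_scale:
  assumes "A \<in> carrier_mat (Suc n) (Suc n)"
  shows "hall_of_mat (a \<cdot>\<^sub>m A) = scale a (hall_of_mat A)"
  unfolding hall_of_mat_def scale_sum
  using assms by (intro sum.cong HOL.refl) (simp add: mult.left_commute)

lemma hall_of_mat_diff: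
  assumes "A \<in> carrier_mat (Suc n) (Suc n)" "B \<in> carrier_mat (Suc n) (Suc n)"
  shows "hall_of_mat (A - B) = hall_of_mat A - hall_of_mat B"
  unfolding hall_of_mat_def sum_subtractf[symmetric]
  using assms by (intro sum.cong HOL.refl) (simp add: fun_eq_iff algebra_simps)

text \<open>
  The part of the commutator that comes from \<open>\<gamma>\<close> following \<open>\<beta>\<close> on the line; it mirrors the product
  \<open>E\<^sub>i\<^sub>j E\<^sub>k\<^sub>l\<close> of matrix units.
\<close>
definition rbracket :: "nat \<times> nat \<Rightarrow> nat \<times> nat \<Rightarrow> obj set \<Rightarrow> 'k::field" where
  "rbracket \<beta> \<gamma> = (if snd \<beta> = fst \<gamma> then scale (edge_sign (snd \<beta>)) (hbasis [(fst \<beta>, snd \<gamma>)]) else 0)"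

text \<open>
  The split extensions agree in both orders and cancel. If the segments are adjacent, the joined
  segment remains; it arises in exactly one order, given by the orientation of the edge between them.
\<close>
lemma hbasis_commutator:
  assumes "\<beta> \<in> roots" "\<gamma> \<in> roots"
  shows "H.prod_alg (hbasis [\<beta>]) (hbasis [\<gamma>]) - H.prod_alg (hbasis [\<gamma>]) (hbasis [\<beta>]) =
    (rbracket \<beta> \<gamma> - rbracket \<gamma> \<beta> :: obj set \<Rightarrow> 'k::field)"
proof -
  have lt: "fst \<beta> < snd \<beta>" "fst \<gamma> < snd \<gamma>"
    using assms by (auto simp: roots_def)
  have perm: "hbasis [\<gamma>, \<beta>] = hbasis [\<beta>, \<gamma>]"
    by (rule hbasis_permute) simp
  show ?thesis
    unfolding hbasis_mult_two[OF assms] hbasis_mult_two[OF assms(2,1)] perm rbracket_def joins_def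
    using lt by (auto simp: edge_sign_def scale_distribs min_def max_def)
qed

text \<open>
  Only terms with \<open>j = k\<close> survive. They vanish unless \<open>i < j < l\<close>, and then the three signs combine to that of
  \<open>(i, l)\<close>.
\<close>
lemma sum_rbracket:
  assumes A: "A \<in> strict_upper" and B: "B \<in> strict_upper"
  shows "(\<Sum>i\<le>n. \<Sum>j\<le>n. \<Sum>k\<le>n. \<Sum>l\<le>n.
      scale (root_sign i j * A $$ (i, j) * (root_sign k l * B $$ (k, l))) (rbracket (i, j) (k, l))) =
    (hall_of_mat (A * B) :: obj set \<Rightarrow> 'k::field)"
proof -
  have zero: "A $$ (i, j) = 0" "B $$ (i, j) = 0" if "i \<le> n" "j \<le> i" for i j
    using that A B by (auto simp: strict_upper_iff)
  have dim: "A \<in> carrier_mat (Suc n) (Suc n)" "B \<in> carrier_mat (Suc n) (Suc n)"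
    using A B by (simp_all add: strict_upper_iff)
  have summand: "scale (root_sign i j * A $$ (i, j) * (root_sign j l * B $$ (j, l)) * edge_sign j) x =
      scale (root_sign i l * (A $$ (i, j) * B $$ (j, l))) x"
    if "i \<le> n" "j \<le> n" "l \<le> n" for i j l and x :: "obj set \<Rightarrow> 'k"
  proof (cases "i < j \<and> j < l")
    case True
    then show ?thesis
      by (simp add: root_sign_split[of i j l] ac_simps)
  next
    case False
    then have "A $$ (i, j) * B $$ (j, l) = 0"
      using zero that by (auto simp: not_less)
    then show ?thesis by auto
  qed
  have "(\<Sum>k\<le>n. \<Sum>l\<le>n. scale (root_sign i j * A $$ (i, j) * (root_sign k l * B $$ (k, l))) (rbracket (i, j) (k, l))) =
      (\<Sum>l\<le>n. scale (root_sign i l * (A $$ (i, j) * B $$ (j, l))) (hbasis [(i, l)] :: obj set \<Rightarrow> 'k))"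
    if "i \<le> n" "j \<le> n" for i j
  proof -
    have "(\<Sum>k\<le>n. \<Sum>l\<le>n. scale (root_sign i j * A $$ (i, j) * (root_sign k l * B $$ (k, l))) (rbracket (i, j) (k, l))) =
        (\<Sum>k\<le>n. if k = j then \<Sum>l\<le>n. scale (root_sign i j * A $$ (i, j) * (root_sign j l * B $$ (j, l)) * edge_sign j)
          (hbasis [(i, l)] :: obj set \<Rightarrow> 'k) else 0)"
      by (intro sum.cong HOL.refl) (auto simp: rbracket_def)
    also have "\<dots> = (\<Sum>l\<le>n. scale (root_sign i j * A $$ (i, j) * (root_sign j l * B $$ (j, l)) * edge_sign j)
          (hbasis [(i, l)]))"
      using that by (subst sum.delta) auto
    also have "\<dots> = (\<Sum>l\<le>n. scale (root_sign i l * (A $$ (i, j) * B $$ (j, l))) (hbasis [(i, l)]))"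
      using that by (intro sum.cong HOL.refl summand) auto
    finally show ?thesis .
  qed
  note inner = this
  have "(\<Sum>i\<le>n. \<Sum>j\<le>n. \<Sum>k\<le>n. \<Sum>l\<le>n.
      scale (root_sign i j * A $$ (i, j) * (root_sign k l * B $$ (k, l))) (rbracket (i, j) (k, l))) =
    (\<Sum>i\<le>n. \<Sum>j\<le>n. \<Sum>l\<le>n. scale (root_sign i l * (A $$ (i, j) * B $$ (j, l))) (hbasis [(i, l)] :: obj set \<Rightarrow> 'k))"
    by (rule sum.cong[OF HOL.refl], rule sum.cong[OF HOL.refl]) (simp only: inner atMost_iff)
  also have "\<dots> = (\<Sum>i\<le>n. \<Sum>l\<le>n. \<Sum>j\<le>n. scale (root_sign i l * (A $$ (i, j) * B $$ (j, l))) (hbasis [(i, l)]))"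
    by (intro sum.cong HOL.refl sum.swap)
  also have "\<dots> = hall_of_mat (A * B)"
    unfolding hall_of_mat_def
  proof (intro sum.cong HOL.refl)
    fix i l assume "i \<in> {..n}" "l \<in> {..n}"
    then have "(A * B) $$ (i, l) = (\<Sum>j\<le>n. A $$ (i, j) * B $$ (j, l))"
      using dim by (auto simp: scalar_prod_def atLeast0LessThan lessThan_Suc_atMost)
    then show "(\<Sum>j\<le>n. scale (root_sign i l * (A $$ (i, j) * B $$ (j, l))) (hbasis [(i, l)])) =
        scale (root_sign i l * (A * B) $$ (i, l)) (hbasis [(i, l)] :: obj set \<Rightarrow> 'k)"
      by (simp add: fun_eq_iff sum_distrib_left sum_distrib_right)
  qed
  finally show ?thesis .
qed

lemma hall_of_mat_mult:
  "H.prod_alg (hall_of_mat A) (hall_of_mat B) = (\<Sum>i\<le>n. \<Sum>j\<le>n. \<Sum>k\<le>n. \<Sum>l\<le>n.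
      scale (root_sign i j * A $$ (i, j) * (root_sign k l * B $$ (k, l)))
        (H.prod_alg (hbasis [(i, j)]) (hbasis [(k, l)])) :: obj set \<Rightarrow> 'k::field)"
proof -
  have left: "H.prod_alg (hall_of_mat A) y = (\<Sum>i\<le>n. \<Sum>j\<le>n.
      scale (root_sign i j * A $$ (i, j)) (H.prod_alg (hbasis [(i, j)]) y))" for y :: "obj set \<Rightarrow> 'k"
    unfolding hall_of_mat_def
    by (simp only: H.mult_sum_left finsupp_sum finsupp_scale hbasis_in H.mult_scale_left)
  have right: "H.prod_alg x (hall_of_mat B) = (\<Sum>k\<le>n. \<Sum>l\<le>n.
      scale (root_sign k l * B $$ (k, l)) (H.prod_alg x (hbasis [(k, l)])))" for x :: "obj set \<Rightarrow> 'k"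
    unfolding hall_of_mat_def
    by (simp only: H.mult_sum_right finsupp_sum finsupp_scale hbasis_in H.mult_scale_right)
  show ?thesis
    unfolding left unfolding right by (simp only: scale_sum scale_simps)
qed

lemma hall_of_mat_bracket:
  assumes A: "A \<in> strict_upper" and B: "B \<in> strict_upper"
  shows "hall_of_mat (A * B - B * A) =
    (H.prod_alg (hall_of_mat A) (hall_of_mat B) - H.prod_alg (hall_of_mat B) (hall_of_mat A) :: obj set \<Rightarrow> 'k::field)"
proof -
  let ?c = "\<lambda>i j k l. root_sign i j * A $$ (i, j) * (root_sign k l * B $$ (k, l))"
  have swap4: "(\<Sum>i\<le>n. \<Sum>j\<le>n. \<Sum>k\<le>n. \<Sum>l\<le>n. f i j k l) = (\<Sum>k\<le>n. \<Sum>l\<le>n. \<Sum>i\<le>n. \<Sum>j\<le>n. f i j k l)"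
    for f :: "nat \<Rightarrow> nat \<Rightarrow> nat \<Rightarrow> nat \<Rightarrow> obj set \<Rightarrow> 'k"
  proof -
    have "(\<Sum>i\<le>n. \<Sum>j\<le>n. \<Sum>k\<le>n. \<Sum>l\<le>n. f i j k l) = (\<Sum>i\<le>n. \<Sum>k\<le>n. \<Sum>j\<le>n. \<Sum>l\<le>n. f i j k l)"
      by (rule sum.cong[OF HOL.refl], rule sum.swap)
    also have "\<dots> = (\<Sum>k\<le>n. \<Sum>i\<le>n. \<Sum>j\<le>n. \<Sum>l\<le>n. f i j k l)"
      by (rule sum.swap)
    also have "\<dots> = (\<Sum>k\<le>n. \<Sum>i\<le>n. \<Sum>l\<le>n. \<Sum>j\<le>n. f i j k l)"
      by (rule sum.cong[OF HOL.refl], rule sum.cong[OF HOL.refl], rule sum.swap)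
    also have "\<dots> = (\<Sum>k\<le>n. \<Sum>l\<le>n. \<Sum>i\<le>n. \<Sum>j\<le>n. f i j k l)"
      by (rule sum.cong[OF HOL.refl], rule sum.swap)
    finally show ?thesis .
  qed
  have BA: "H.prod_alg (hall_of_mat B) (hall_of_mat A) = (\<Sum>i\<le>n. \<Sum>j\<le>n. \<Sum>k\<le>n. \<Sum>l\<le>n.
      scale (?c i j k l) (H.prod_alg (hbasis [(k, l)]) (hbasis [(i, j)])) :: obj set \<Rightarrow> 'k)"
    by (rule HOL.trans[OF hall_of_mat_mult], rule HOL.trans[OF swap4])
      (intro sum.cong HOL.refl arg_cong2[where f = scale] mult.commute)
  have "hall_of_mat (A * B - B * A) = (hall_of_mat (A * B) - hall_of_mat (B * A) :: obj set \<Rightarrow> 'k)"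
    using strict_upper_closed(3)[OF A B] strict_upper_closed(3)[OF B A]
    by (intro hall_of_mat_diff) (simp_all add: strict_upper_iff)
  also have "\<dots> = (\<Sum>i\<le>n. \<Sum>j\<le>n. \<Sum>k\<le>n. \<Sum>l\<le>n. scale (?c i j k l) (rbracket (i, j) (k, l))) -
      (\<Sum>i\<le>n. \<Sum>j\<le>n. \<Sum>k\<le>n. \<Sum>l\<le>n. scale (?c i j k l) (rbracket (k, l) (i, j)))"
  proof -
    have "(\<Sum>i\<le>n. \<Sum>j\<le>n. \<Sum>k\<le>n. \<Sum>l\<le>n. scale (?c i j k l) (rbracket (k, l) (i, j))) =
        (hall_of_mat (B * A) :: obj set \<Rightarrow> 'k)"
      unfolding sum_rbracket[OF B A, symmetric]
      by (rule HOL.trans[OF swap4]) (intro sum.cong HOL.refl arg_cong2[where f = scale] mult.commute)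
    then show ?thesis
      by (simp only: sum_rbracket[OF A B])
  qed
  also have "\<dots> = (\<Sum>i\<le>n. \<Sum>j\<le>n. \<Sum>k\<le>n. \<Sum>l\<le>n. scale (?c i j k l)
      (H.prod_alg (hbasis [(i, j)]) (hbasis [(k, l)]) - H.prod_alg (hbasis [(k, l)]) (hbasis [(i, j)])))"
    unfolding sum_subtractf[symmetric] scale_distribs(3)[symmetric]
  proof (intro sum.cong HOL.refl)
    fix i j k l assume ijkl: "i \<in> {..n}" "j \<in> {..n}" "k \<in> {..n}" "l \<in> {..n}"
    show "scale (?c i j k l) (rbracket (i, j) (k, l) - rbracket (k, l) (i, j)) = scale (?c i j k l)
      (H.prod_alg (hbasis [(i, j)]) (hbasis [(k, l)]) - H.prod_alg (hbasis [(k, l)]) (hbasis [(i, j)]))"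
    proof (cases "i < j \<and> k < l")
      case True
      then have "(i, j) \<in> roots" "(k, l) \<in> roots"
        using ijkl by (auto simp: roots_def)
      then show ?thesis
        by (simp only: hbasis_commutator)
    next
      case False
      then have "?c i j k l = 0"
        using A B ijkl by (auto simp: strict_upper_iff not_less)
      then show ?thesis
        by (simp only: scale_simps)
    qed
  qed
  also have "\<dots> = H.prod_alg (hall_of_mat A) (hall_of_mat B) - H.prod_alg (hall_of_mat B) (hall_of_mat A)"
    unfolding BA unfolding hall_of_mat_mult sum_subtractf[symmetric] scale_distribs(3) ..
  finally show ?thesis .
qed

text \<open>The sign is chosen such that \<open>hall_of_mat\<close> sends this matrix to the class of the segment itself.\<close>
definition root_mat :: "nat \<times> nat \<Rightarrow> 'k::field mat" where
  "root_mat \<beta> = mat (Suc n) (Suc n) (\<lambda>x. if x = \<beta> then root_sign (fst \<beta>) (snd \<beta>) else 0)"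

lemma root_mat_in: "\<beta> \<in> roots \<Longrightarrow> root_mat \<beta> \<in> strict_upper"
  by (auto simp: strict_upper_iff root_mat_def roots_def)

lemma hall_of_root_mat:
  assumes "\<beta> \<in> roots"
  shows "hall_of_mat (root_mat \<beta>) = hbasis [\<beta>]"
proof -
  obtain a b where ab: "\<beta> = (a, b)" "a \<le> n" "b \<le> n"
    using assms by (auto simp: roots_def)
  have "hall_of_mat (root_mat \<beta>) = (\<Sum>i\<le>n. \<Sum>j\<le>n. if j = b then if i = a then hbasis [\<beta>] else 0 else 0)"
    unfolding hall_of_mat_def
    by (intro sum.cong HOL.refl) (auto simp: root_mat_def ab root_sign_square)
  also have "\<dots> = hbasis [\<beta>]"
    using ab by (simp add: sum.delta')
  finally show ?thesis .
qed

text \<open>The root matrices span. They are added to a matrix one entry at a time.\<close>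
lemma strict_upper_induct [consumes 1, case_names zero add scale root]:
  assumes A: "A \<in> strict_upper"
    and zero: "Q (0\<^sub>m (Suc n) (Suc n))"
    and add: "\<And>A B. A \<in> strict_upper \<Longrightarrow> B \<in> strict_upper \<Longrightarrow> Q A \<Longrightarrow> Q B \<Longrightarrow> Q (A + B)"
    and scale: "\<And>a A. A \<in> strict_upper \<Longrightarrow> Q A \<Longrightarrow> Q (a \<cdot>\<^sub>m A)"
    and root: "\<And>\<beta>. \<beta> \<in> roots \<Longrightarrow> Q (root_mat \<beta>)"
  shows "Q A"
proof -
  define part where "part D = mat (Suc n) (Suc n) (\<lambda>x. if x \<in> D then A $$ x else 0)" for D
  have part_in: "part D \<in> strict_upper" for D
    using A by (auto simp: strict_upper_iff part_def)
  have "Q (part D)" if "finite D" "D \<subseteq> roots" for D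
    using that
  proof (induction D)
    case empty
    have "part {} = 0\<^sub>m (Suc n) (Suc n)"
      by (auto simp: part_def)
    then show ?case using zero by simp
  next
    case (insert \<beta> D)
    have "part (insert \<beta> D) = (A $$ \<beta> * root_sign (fst \<beta>) (snd \<beta>)) \<cdot>\<^sub>m root_mat \<beta> + part D"
      using insert.hyps(2) root_sign_square[of "fst \<beta>" "snd \<beta>"]
      by (intro eq_matI) (auto simp: part_def root_mat_def mult.assoc)
    moreover have \<beta>: "\<beta> \<in> roots" and "Q (part D)"
      using insert by blast+
    moreover have "c \<cdot>\<^sub>m root_mat \<beta> \<in> strict_upper" "Q (c \<cdot>\<^sub>m root_mat \<beta>)" for c
      using strict_upper_closed(2)[OF root_mat_in[OF \<beta>] part_in] scale[OF root_mat_in root] \<beta> by blast+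
    ultimately show ?case
      using add part_in by simp
  qed
  moreover have "finite roots"
    by (rule finite_subset[of _ "{..n} \<times> {..n}"]) (auto simp: roots_def)
  moreover have "part roots = A"
    using A by (intro eq_matI) (auto simp: part_def roots_def strict_upper_iff not_less)
  ultimately show ?thesis
    by (metis order_refl)
qed

end

section \<open>The homomorphism from the free algebra\<close>

text \<open>
  Rearrangements are generated by swaps of neighbours. The swapped lists keep the elements of \<open>xs\<close>, so
  a relation that holds only for lists of a given length or with given entries can be used.
\<close>
lemma mset_eq_swap_induct:
  assumes "mset xs = mset ys"
    and refl: "\<And>zs. R zs zs"
    and trans: "\<And>us vs zs. R us vs \<Longrightarrow> R vs zs \<Longrightarrow> R us zs"
    and swap: "\<And>us x y vs. mset (us @ x # y # vs) = mset xs \<Longrightarrow> R (us @ x # y # vs) (us @ y # x # vs)"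
  shows "R xs ys"
proof -
  have move: "R (us @ as @ x # bs) (us @ x # as @ bs)"
    if "mset (us @ as @ x # bs) = mset xs" for us as bs x
    using that
  proof (induction as arbitrary: us)
    case (Cons a as)
    have "R ((us @ [a]) @ as @ x # bs) ((us @ [a]) @ x # as @ bs)"
      using Cons.prems by (intro Cons.IH) simp
    then have 1: "R (us @ a # as @ x # bs) (us @ a # x # as @ bs)"
      by simp
    have 2: "R (us @ a # x # as @ bs) (us @ x # a # as @ bs)"
      using Cons.prems by (intro swap) simp
    from trans[OF 1 2] show ?case
      by simp
  qed (simp add: refl)
  have "R (us @ as) (us @ bs)" if "mset as = mset bs" "mset (us @ as) = mset xs" for us as bs
    using that
  proof (induction bs arbitrary: as us)
    case (Cons b bs)
    then have "b \<in> set as"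
      by (metis list.set_intros(1) mset_eq_setD)
    then obtain as1 as2 where as: "as = as1 @ b # as2"
      by (meson split_list)
    have 1: "R (us @ as1 @ b # as2) (us @ b # as1 @ as2)"
      using Cons.prems(2) by (intro move) (simp add: as)
    have "R ((us @ [b]) @ as1 @ as2) ((us @ [b]) @ bs)"
      using Cons.prems by (intro Cons.IH) (simp_all add: as)
    then have 2: "R (us @ b # as1 @ as2) (us @ b # bs)"
      by simp
    from trans[OF 1 2] show ?case
      by (simp add: as)
  qed (simp add: refl)
  from this[of xs ys "[]"] assms(1) show ?thesis
    by simp
qed

locale hall_enveloping = line_quiver \<Gamma> n \<tau>
  for \<Gamma> :: "nat quiver" and n :: nat and \<tau> :: "nat \<Rightarrow> nat" +
  fixes field_type :: "'k::field itself"
begin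

sublocale F: free_algebra_on "strict_upper :: 'k mat set" field_type .

abbreviation words :: "'k mat list set" where
  "words \<equiv> lists strict_upper"

abbreviation word :: "'k mat list \<Rightarrow> 'k mat list \<Rightarrow> 'k" where
  "word \<equiv> basis_vec"

definition word_image :: "'k mat list \<Rightarrow> obj set \<Rightarrow> 'k" where
  "word_image u = foldr (\<lambda>A x. H.prod_alg (hall_of_mat A) x) u (hbasis [])"

definition Phi :: "('k mat list \<Rightarrow> 'k) \<Rightarrow> obj set \<Rightarrow> 'k" where
  "Phi = lin_ext word_image"

lemma hbasis_Nil: "hbasis [] = basis_vec (cls (du []))"
  by (simp add: hbasis_def)

lemma word_image_in: "word_image u \<in> finsupp iso_classes"
  by (induction u) (simp_all add: word_image_def hbasis_in H.mult_in hall_of_mat_in)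

lemma word_image_append: "word_image (u @ v) = H.prod_alg (word_image u) (word_image v)"
proof (induction u)
  case Nil
  then show ?case
    using H.one_mult[OF word_image_in, of v] by (simp add: word_image_def hbasis_Nil)
next
  case (Cons A u)
  have "word_image ((A # u) @ v) = H.prod_alg (hall_of_mat A) (word_image (u @ v))"
    by (simp add: word_image_def)
  also have "\<dots> = H.prod_alg (H.prod_alg (hall_of_mat A) (word_image u)) (word_image v)"
    unfolding Cons.IH by (rule H.mult_assoc[symmetric]; rule hall_of_mat_in word_image_in)
  finally show ?case
    by (simp add: word_image_def)
qed

lemma word_image_single: "word_image [A] = hall_of_mat A"
  using H.mult_one[OF hall_of_mat_in, of A] by (simp add: word_image_def hbasis_Nil)

lemma Phi_in: "x \<in> finsupp words \<Longrightarrow> Phi x \<in> finsupp iso_classes"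
  unfolding Phi_def by (rule lin_ext_in[OF _ word_image_in])

lemma Phi_word [simp]: "Phi (word u) = word_image u"
  by (simp add: Phi_def)

lemma Phi_linear:
  assumes "x \<in> finsupp words"
  shows "y \<in> finsupp words \<Longrightarrow> Phi (x + y) = Phi x + Phi y"
    and "y \<in> finsupp words \<Longrightarrow> Phi (x - y) = Phi x - Phi y"
    and "Phi (scale a x) = scale a (Phi x)"
  unfolding Phi_def using assms by (simp_all add: lin_ext_add lin_ext_diff lin_ext_scale)

lemma Phi_mult:
  assumes "x \<in> finsupp words" "y \<in> finsupp words"
  shows "Phi (F.prod_alg x y) = H.prod_alg (Phi x) (Phi y)"
proof -
  note simps = F.bilinear_simps H.bilinear_simps Phi_linear Phi_in word_image_in
  have 0: "Phi 0 = 0"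
    by (simp add: Phi_def)
  have 1: "Phi (F.prod_alg x (word v)) = H.prod_alg (Phi x) (word_image v)"
    if "x \<in> finsupp words" "v \<in> words" for x v
    using that
    by (induction x rule: finsupp_induct)
      (simp_all add: simps 0 F.mult_words word_image_append
        del: plus_fun_apply zero_fun_apply scale_apply in_lists_conv_set)
  show ?thesis
    using assms(2,1)
    by (induction y rule: finsupp_induct)
      (simp_all add: simps 0 1 del: plus_fun_apply zero_fun_apply scale_apply in_lists_conv_set)
qed

lemma Phi_ring_hom: "ring_hom_ring F.alg H.alg Phi"
proof (rule ring_hom_ringI[OF F.ring_axioms H.ring_axioms])
  show "Phi \<one>\<^bsub>F.alg\<^esub> = \<one>\<^bsub>H.alg\<^esub>"
    by (simp add: word_image_def hbasis_Nil)
qed (simp_all add: F.carrier_alg H.carrier_alg Phi_in Phi_mult Phi_linear del: structure_algebra_sel(1))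

abbreviation relations :: "('k mat list \<Rightarrow> 'k) set" where
  "relations \<equiv> enveloping_relations (sl_positive_part (n + 1))"

lemma word_in: "u \<in> words \<Longrightarrow> word u \<in> finsupp words"
  by (rule finsupp_basis_vec)

lemma letter_in: "A \<in> strict_upper \<Longrightarrow> word [A] \<in> finsupp words"
  by (rule word_in) simp

lemma sl_sel [simp]:
  "ladd (sl_positive_part m) = (+)" "lscale (sl_positive_part m) = (\<cdot>\<^sub>m)"
  "lbracket (sl_positive_part m) A B = A * B - B * A"
  by (auto simp: sl_positive_part_def)

text \<open>The defining relations, with the ring operations of the free algebra evaluated.\<close>
lemma relations_eq:
  "relations =
    {word [A + B] - (word [A] + word [B]) | A B. A \<in> strict_upper \<and> B \<in> strict_upper} \<union>
    {word [a \<cdot>\<^sub>m A] - scale a (word [A]) | a A. A \<in> strict_upper} \<union>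
    {(word [A, B] - word [B, A]) - word [A * B - B * A] | A B. A \<in> strict_upper \<and> B \<in> strict_upper}"
  (is "_ = ?R1 \<union> ?R2 \<union> ?R3")
proof -
  have FA: "free_algebra (lcarrier (sl_positive_part (n + 1))) = F.alg"
    unfolding strict_upper_def[symmetric] by (rule F.free_algebra_eq)
  have 1: "word [A + B] \<ominus>\<^bsub>F.alg\<^esub> (word [A] \<oplus>\<^bsub>F.alg\<^esub> word [B]) = word [A + B] - (word [A] + word [B])"
    if "A \<in> strict_upper" "B \<in> strict_upper" for A B
    by (simp only: structure_algebra_sel F.a_minus_eq finsupp_add letter_in that)
  have 2: "word [a \<cdot>\<^sub>m A] \<ominus>\<^bsub>F.alg\<^esub> (a \<odot>\<^bsub>F.alg\<^esub> word [A]) = word [a \<cdot>\<^sub>m A] - scale a (word [A])"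
    if "A \<in> strict_upper" for a A
    by (simp only: structure_algebra_sel F.a_minus_eq finsupp_scale letter_in that)
  have 3: "(word [A] \<otimes>\<^bsub>F.alg\<^esub> word [B] \<ominus>\<^bsub>F.alg\<^esub> word [B] \<otimes>\<^bsub>F.alg\<^esub> word [A]) \<ominus>\<^bsub>F.alg\<^esub> word [A * B - B * A] =
      (word [A, B] - word [B, A]) - word [A * B - B * A]"
    if "A \<in> strict_upper" "B \<in> strict_upper" for A B
  proof -
    have "word [A] \<otimes>\<^bsub>F.alg\<^esub> word [B] = word [A, B]" "word [B] \<otimes>\<^bsub>F.alg\<^esub> word [A] = word [B, A]"
      using that by (simp_all add: F.mult_words)
    then show ?thesis
      using that strict_upper_closed(4)[OF that] by (simp add: F.a_minus_eq word_in)
  qed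
  have "{word [A + B] \<ominus>\<^bsub>F.alg\<^esub> (word [A] \<oplus>\<^bsub>F.alg\<^esub> word [B]) | A B. A \<in> strict_upper \<and> B \<in> strict_upper} = ?R1"
    by (rule Collect_cong, rule ex_cong1, rule ex_cong1) (metis 1)
  moreover have "{word [a \<cdot>\<^sub>m A] \<ominus>\<^bsub>F.alg\<^esub> (a \<odot>\<^bsub>F.alg\<^esub> word [A]) | a A. A \<in> strict_upper} = ?R2"
    by (rule Collect_cong, rule ex_cong1, rule ex_cong1) (metis 2)
  moreover have "{(word [A] \<otimes>\<^bsub>F.alg\<^esub> word [B] \<ominus>\<^bsub>F.alg\<^esub> word [B] \<otimes>\<^bsub>F.alg\<^esub> word [A]) \<ominus>\<^bsub>F.alg\<^esub> word [A * B - B * A] | A B.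
      A \<in> strict_upper \<and> B \<in> strict_upper} = ?R3"
    by (rule Collect_cong, rule ex_cong1, rule ex_cong1) (metis 3)
  ultimately show ?thesis
    unfolding enveloping_relations_def Let_def free_gen_eq FA sl_sel
    unfolding strict_upper_def[symmetric] by simp
qed

definition I :: "('k mat list \<Rightarrow> 'k) set" where
  "I = genideal F.alg relations"

lemma relations_subset: "relations \<subseteq> finsupp words"
  unfolding relations_eq
  by (auto intro!: finsupp_diff finsupp_add finsupp_scale word_in simp: strict_upper_closed)

lemma ideal_I: "ideal I F.alg"
  unfolding I_def using relations_subset by (intro F.genideal_ideal) (simp add: F.carrier_alg del: structure_algebra_sel(1))

lemma relations_I: "relations \<subseteq> I"
  unfolding I_def using relations_subset by (intro F.genideal_self) (simp add: F.carrier_alg del: structure_algebra_sel(1))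

lemma I_subset: "I \<subseteq> finsupp words"
  using additive_subgroup.a_subset[OF ideal.axioms(1)[OF ideal_I]] by (simp only: F.carrier_alg)

lemma I_closed:
  "0 \<in> I"
  "x \<in> I \<Longrightarrow> y \<in> I \<Longrightarrow> x + y \<in> I"
  "x \<in> I \<Longrightarrow> z \<in> finsupp words \<Longrightarrow> F.prod_alg z x \<in> I"
  "x \<in> I \<Longrightarrow> z \<in> finsupp words \<Longrightarrow> F.prod_alg x z \<in> I"
  using additive_subgroup.zero_closed[OF ideal.axioms(1)[OF ideal_I]]
    additive_subgroup.a_closed[OF ideal.axioms(1)[OF ideal_I]]
    ideal.I_l_closed[OF ideal_I] ideal.I_r_closed[OF ideal_I]
  by (simp_all add: F.carrier_alg del: structure_algebra_sel(1))

lemma I_scale: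
  assumes "x \<in> I"
  shows "scale a x \<in> I"
proof -
  have x: "x \<in> finsupp words"
    using assms I_subset by blast
  have "F.prod_alg (scale a (word [])) x = scale a x"
    using F.one_mult[OF x] by (simp only: F.mult_scale_left word_in lists.Nil)
  then show ?thesis
    using I_closed(3)[OF assms finsupp_scale[OF word_in]] by (metis lists.Nil)
qed

text \<open>
  This is the universal property of the enveloping algebra: \<open>hall_of_mat\<close> is linear and respects brackets.
\<close>
lemma I_kernel: "I \<subseteq> a_kernel F.alg H.alg Phi"
proof -
  have "Phi x = 0" if x: "x \<in> relations" for x
  proof -
    from x consider
        A B where "x = word [A + B] - (word [A] + word [B])" "A \<in> strict_upper" "B \<in> strict_upper"
      | a A where "x = word [a \<cdot>\<^sub>m A] - scale a (word [A])" "A \<in> strict_upper"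
      | A B where "x = (word [A, B] - word [B, A]) - word [A * B - B * A]" "A \<in> strict_upper" "B \<in> strict_upper"
      unfolding relations_eq by blast
    then show ?thesis
    proof cases
      case 1
      then show ?thesis
        by (simp add: Phi_linear letter_in finsupp_add strict_upper_closed word_image_single
            hall_of_mat_add strict_upper_iff[THEN iffD1, THEN conjunct1])
    next
      case 2
      then show ?thesis
        by (simp add: Phi_linear letter_in finsupp_scale strict_upper_closed word_image_single
            hall_of_mat_scale strict_upper_iff[THEN iffD1, THEN conjunct1])
    next
      case 3
      have "word_image [A, B] = H.prod_alg (hall_of_mat A) (hall_of_mat B)" for A B
        using word_image_append[of "[A]" "[B]"] by (simp add: word_image_single)
      with 3 show ?thesis
        by (simp add: Phi_linear word_in finsupp_diff strict_upper_closed word_image_single hall_of_mat_bracket)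
    qed
  qed
  then have "relations \<subseteq> a_kernel F.alg H.alg Phi"
    using relations_subset by (auto simp: a_kernel_def' F.carrier_alg simp del: structure_algebra_sel(1))
  then show ?thesis
    unfolding I_def by (intro F.genideal_minimal ring_hom_ring.kernel_is_ideal[OF Phi_ring_hom])
qed

end

section \<open>Ordered monomials and the kernel\<close>

context hall_enveloping
begin

text \<open>
  The ordered monomial of a class.
\<close>
definition normal_word :: "obj set \<Rightarrow> 'k mat list" where
  "normal_word K = map root_mat (SOME w. set w \<subseteq> roots \<and> sorted (map key w) \<and> cls (dul w) = K)"

lemma normal_wordE:
  assumes "K \<in> iso_classes"
  obtains w where "set w \<subseteq> roots" "sorted (map key w)" "cls (dul w) = K" "normal_word K = map root_mat w"
proof -
  obtain A where A: "A \<in> objects_S \<Gamma>" "K = cls (du A)"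
    using assms by (rule classes_cases)
  obtain w where w: "set w \<subseteq> roots" "du A \<cong>\<^sub>q dul w"
    using A(1) by (rule object_decomposition)
  have "du A \<cong>\<^sub>q dul (sort_key key w)"
    by (rule isomorphic_trans[OF w(2)]) (rule du_permute, simp)
  then have "set (sort_key key w) \<subseteq> roots \<and> sorted (map key (sort_key key w)) \<and> cls (dul (sort_key key w)) = K"
    using w(1) A(2) cls_eqI isomorphic_sym by simp
  then have "\<exists>w. set w \<subseteq> roots \<and> sorted (map key w) \<and> cls (dul w) = K"
    by blast
  from someI_ex[OF this] that show thesis
    unfolding normal_word_def by blast
qed

lemma root_word_in: "set w \<subseteq> roots \<Longrightarrow> map root_mat w \<in> words"
  by (induction w) (simp_all add: root_mat_in)

lemma normal_word_in: "K \<in> iso_classes \<Longrightarrow> normal_word K \<in> words"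
  by (erule normal_wordE) (metis root_word_in)

lemma word_image_sorted:
  "set w \<subseteq> roots \<Longrightarrow> sorted (map key w) \<Longrightarrow> word_image (map root_mat w) = hbasis w"
proof (induction w)
  case (Cons \<beta> w)
  then have "word_image (map root_mat (\<beta> # w)) = H.prod_alg (hbasis [\<beta>]) (hbasis w)"
    by (simp add: word_image_def hall_of_root_mat)
  also have "\<dots> = hbasis (\<beta> # w)"
    using Cons.prems by (intro hbasis_mult_sorted) auto
  finally show ?case .
qed (simp add: word_image_def)

lemma word_image_normal: "K \<in> iso_classes \<Longrightarrow> word_image (normal_word K) = basis_vec K"
  by (erule normal_wordE) (simp add: word_image_sorted hbasis_def)

definition reducible :: "('k mat list \<Rightarrow> 'k) set" where
  "reducible = {x \<in> finsupp words. \<exists>y\<in>finsupp (normal_word ` iso_classes). x - y \<in> I}"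

lemma reducibleI: "x \<in> finsupp words \<Longrightarrow> y \<in> finsupp (normal_word ` iso_classes) \<Longrightarrow> x - y \<in> I \<Longrightarrow> x \<in> reducible"
  unfolding reducible_def by blast

lemma reducible_add:
  assumes "x \<in> reducible" "y \<in> reducible" shows "x + y \<in> reducible"
proof -
  obtain x' y' where x: "x \<in> finsupp words" "x' \<in> finsupp (normal_word ` iso_classes)" "x - x' \<in> I"
    and y: "y \<in> finsupp words" "y' \<in> finsupp (normal_word ` iso_classes)" "y - y' \<in> I"
    using assms unfolding reducible_def by blast
  have "(x + y) - (x' + y') \<in> I"
    using I_closed(2)[OF x(3) y(3)] by (simp add: algebra_simps)
  then show ?thesis
    using x y by (intro reducibleI[of _ "x' + y'"] finsupp_add)
qed

lemma reducible_scale: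
  assumes "x \<in> reducible" shows "scale a x \<in> reducible"
proof -
  obtain x' where x: "x \<in> finsupp words" "x' \<in> finsupp (normal_word ` iso_classes)" "x - x' \<in> I"
    using assms unfolding reducible_def by blast
  have "scale a x - scale a x' \<in> I"
    using I_scale[OF x(3)] by (simp only: scale_distribs)
  then show ?thesis
    using x by (intro reducibleI[of _ "scale a x'"] finsupp_scale)
qed

lemma I_reducible: "x \<in> I \<Longrightarrow> x \<in> reducible"
  using I_subset by (intro reducibleI[of x 0]) auto

lemma reducible_sum: "(\<And>i. i \<in> J \<Longrightarrow> f i \<in> reducible) \<Longrightarrow> (\<Sum>i\<in>J. f i) \<in> reducible"
  by (induction J rule: infinite_finite_induct) (auto intro: reducible_add I_reducible I_closed(1))

lemma normal_reducible: "K \<in> iso_classes \<Longrightarrow> word (normal_word K) \<in> reducible"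
proof -
  assume K: "K \<in> iso_classes"
  have "word (normal_word K) - word (normal_word K) \<in> I"
    using I_closed(1) by simp
  then show ?thesis
    using K by (intro reducibleI[of _ "word (normal_word K)"] word_in normal_word_in finsupp_basis_vec) auto
qed

lemma sandwich_relation:
  assumes "u \<in> words" "v \<in> words" "x \<in> relations"
  shows "F.prod_alg (F.prod_alg (word u) x) (word v) \<in> I"
  using assms relations_I by (intro I_closed word_in) auto

lemma letter_linear:
  assumes u: "u \<in> words" and v: "v \<in> words" and A: "A \<in> strict_upper"
  shows "B \<in> strict_upper \<Longrightarrow> word (u @ (A + B) # v) - (word (u @ A # v) + word (u @ B # v)) \<in> I"
    and "word (u @ (a \<cdot>\<^sub>m A) # v) - scale a (word (u @ A # v)) \<in> I"
proof -
  note simps = F.mult_diff_left F.mult_diff_right F.bilinear_simps finsupp_diff word_in F.mult_words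
    strict_upper_closed append_in_lists_conv
  { assume B: "B \<in> strict_upper"
    have rel: "word [A + B] - (word [A] + word [B]) \<in> relations"
      unfolding relations_eq using A B by blast
    show "word (u @ (A + B) # v) - (word (u @ A # v) + word (u @ B # v)) \<in> I"
      using sandwich_relation[OF u v rel] u v A B by (simp add: simps del: in_lists_conv_set)
  }
  have rel: "word [a \<cdot>\<^sub>m A] - scale a (word [A]) \<in> relations"
    unfolding relations_eq using A by blast
  show "word (u @ (a \<cdot>\<^sub>m A) # v) - scale a (word (u @ A # v)) \<in> I"
    using sandwich_relation[OF u v rel] u v A by (simp add: simps del: in_lists_conv_set)
qed

lemma letter_swap:
  assumes u: "u \<in> words" and v: "v \<in> words" and A: "A \<in> strict_upper" and B: "B \<in> strict_upper"
  shows "(word (u @ A # B # v) - word (u @ B # A # v)) - word (u @ (A * B - B * A) # v) \<in> I"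
proof -
  have rel: "(word [A, B] - word [B, A]) - word [A * B - B * A] \<in> relations"
    unfolding relations_eq using A B by blast
  show ?thesis
    using sandwich_relation[OF u v rel] u v A B strict_upper_closed(4)[OF A B]
    by (simp add: F.mult_diff_left F.mult_diff_right finsupp_diff word_in F.mult_words del: in_lists_conv_set)
qed

text \<open>Words are multilinear in their letters modulo the ideal, so letters may be taken to be root matrices.\<close>
lemma reducible_letterwise:
  assumes u: "u \<in> words" and v: "v \<in> words" and A: "A \<in> strict_upper"
    and roots: "\<And>\<beta>. \<beta> \<in> roots \<Longrightarrow> word (u @ root_mat \<beta> # v) \<in> reducible"
  shows "word (u @ A # v) \<in> reducible"
  using A
proof (induction A rule: strict_upper_induct)
  case zero
  have Z: "0\<^sub>m (Suc n) (Suc n) \<in> (strict_upper :: 'k mat set)"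
    by (simp add: strict_upper_iff)
  \<comment> \<open>The zero matrix is 0 times itself, so a word with this letter lies in the ideal.\<close>
  have "(0 :: 'k) \<cdot>\<^sub>m 0\<^sub>m (Suc n) (Suc n) = 0\<^sub>m (Suc n) (Suc n)"
    by (intro eq_matI) auto
  then show ?case
    using letter_linear(2)[OF u v Z, of 0] I_reducible by simp
next
  case (add A B)
  have "word (u @ (A + B) # v) =
      (word (u @ (A + B) # v) - (word (u @ A # v) + word (u @ B # v))) + (word (u @ A # v) + word (u @ B # v))"
    by (rule diff_add_cancel[symmetric])
  then show ?case
    using reducible_add[OF I_reducible[OF letter_linear(1)[OF u v add(1,2)]] reducible_add[OF add(3,4)]] by metis
next
  case (scale a A)
  have "word (u @ (a \<cdot>\<^sub>m A) # v) =
      (word (u @ (a \<cdot>\<^sub>m A) # v) - scale a (word (u @ A # v))) + scale a (word (u @ A # v))"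
    by (rule diff_add_cancel[symmetric])
  then show ?case
    using reducible_add[OF I_reducible[OF letter_linear(2)[OF u v scale(1)]] reducible_scale[OF scale(2)]] by metis
qed (rule roots)

text \<open>
  The straightening step: exchanging two neighbouring letters costs a word that is shorter by one, and
  rearranging the letters leads to the ordered monomial with the same segments.
\<close>
lemma reducible_root_word:
  assumes shorter: "\<And>v. v \<in> words \<Longrightarrow> length v < length w \<Longrightarrow> word v \<in> reducible"
    and w: "set w \<subseteq> roots"
  shows "word (map root_mat w) \<in> reducible"
proof -
  have "cls (dul w) \<in> iso_classes"
    by (intro cls_in_iso_classes valid_du dul_object)
  then obtain w' where w': "set w' \<subseteq> roots" "cls (dul w') = cls (dul w)" "normal_word (cls (dul w)) = map root_mat w'"
    and K: "cls (dul w) \<in> iso_classes"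
    by (metis normal_wordE)
  have "dul w \<cong>\<^sub>q dul w'"
    using w'(2) by (intro cls_eqD valid_du dul_object) simp
  then have "mset w = mset w'"
    by (rule dul_isomorphic_imp_mset_eq[OF w w'(1)])
  then have "word (map root_mat w) - word (map root_mat w') \<in> reducible"
  proof (rule mset_eq_swap_induct)
    show "word (map root_mat u) - word (map root_mat u) \<in> reducible" for u
      using I_reducible[OF I_closed(1)] by simp
    show "word (map root_mat u1) - word (map root_mat u3) \<in> reducible"
      if "word (map root_mat u1) - word (map root_mat u2) \<in> reducible"
        "word (map root_mat u2) - word (map root_mat u3) \<in> reducible" for u1 u2 u3
      using reducible_add[OF that] by simp
    fix us \<beta> \<gamma> vs
    assume eq: "mset (us @ \<beta> # \<gamma> # vs) = mset w"
    have "set (us @ \<beta> # \<gamma> # vs) \<subseteq> roots"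
      unfolding mset_eq_setD[OF eq] by (rule w)
    moreover have len: "length w = Suc (Suc (length us + length vs))"
      using mset_eq_length[OF eq] by simp
    ultimately have in_words: "map root_mat us \<in> words" "map root_mat vs \<in> words"
      "root_mat \<beta> \<in> (strict_upper :: 'k mat set)" "root_mat \<gamma> \<in> (strict_upper :: 'k mat set)"
      by (simp_all add: root_word_in root_mat_in)
    let ?br = "word (map root_mat us @ (root_mat \<beta> * root_mat \<gamma> - root_mat \<gamma> * root_mat \<beta>) # map root_mat vs)"
    let ?d = "word (map root_mat us @ root_mat \<beta> # root_mat \<gamma> # map root_mat vs) -
      word (map root_mat us @ root_mat \<gamma> # root_mat \<beta> # map root_mat vs)"
    have "?br \<in> reducible"
      using in_words strict_upper_closed(4)[OF in_words(3,4)] len by (intro shorter) auto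
    from reducible_add[OF I_reducible[OF letter_swap[OF in_words]] this]
    have "?d \<in> reducible"
      by (simp only: diff_add_cancel)
    then show "word (map root_mat (us @ \<beta> # \<gamma> # vs)) - word (map root_mat (us @ \<gamma> # \<beta> # vs)) \<in> reducible"
      by simp
  qed
  from reducible_add[OF this normal_reducible[OF K]] show ?thesis
    by (simp only: w'(3) diff_add_cancel)
qed

lemma word_reducible: "u \<in> words \<Longrightarrow> word u \<in> reducible"
proof (induction "length u" arbitrary: u rule: less_induct)
  case less
  have "word (v @ map root_mat w) \<in> reducible"
    if "v \<in> words" "set w \<subseteq> roots" "length v + length w = length u" for v w
    using that
  proof (induction v arbitrary: w rule: rev_induct)
    case Nil
    have "word (map root_mat w) \<in> reducible"
      using Nil less.hyps by (intro reducible_root_word) auto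
    then show ?case by simp
  next
    case (snoc A v)
    then have v: "v \<in> words" and A: "A \<in> strict_upper"
      by auto
    have "word (v @ root_mat \<beta> # map root_mat w) \<in> reducible" if "\<beta> \<in> roots" for \<beta>
      using snoc.IH[of "\<beta> # w"] snoc.prems v that by simp
    from reducible_letterwise[OF v root_word_in[OF snoc.prems(2)] A this] show ?case
      by simp
  qed
  from this[of u "[]"] less.prems show ?case by simp
qed

lemma all_reducible: "x \<in> finsupp words \<Longrightarrow> x \<in> reducible"
proof -
  assume x: "x \<in> finsupp words"
  have "(\<Sum>u\<in>support x. scale (x u) (word u)) \<in> reducible"
    using x by (intro reducible_sum reducible_scale word_reducible) (auto simp: finsupp_def)
  then show ?thesis
    using finsupp_expand[OF x] by simp
qed

text \<open>The coefficient of \<open>y\<close> at an ordered monomial is the coefficient of its image at the class.\<close>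
lemma Phi_normal_injective:
  assumes y: "y \<in> finsupp (normal_word ` iso_classes)" and zero: "Phi y = 0"
  shows "y = 0"
proof (rule ccontr)
  assume "y \<noteq> 0"
  then obtain u where "y u \<noteq> 0"
    by (auto simp: fun_eq_iff)
  with y obtain K where K: "K \<in> iso_classes" "u = normal_word K"
    unfolding finsupp_def by blast
  have image: "word_image u' K = (if u' = u then 1 else 0)" if u': "u' \<in> support y" for u'
  proof -
    obtain K' where K': "K' \<in> iso_classes" "u' = normal_word K'"
      using y u' unfolding finsupp_def by blast
    show ?thesis
    proof (cases "K' = K")
      case True
      then show ?thesis
        using K K' by (simp add: word_image_normal basis_vec_def)
    next
      case False
      have "word_image u' \<noteq> word_image u"
        using K K' False by (simp add: word_image_normal basis_vec_def fun_eq_iff) metis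
      then show ?thesis
        using K' False by (auto simp: word_image_normal basis_vec_def)
    qed
  qed
  have "Phi y K = (\<Sum>u'\<in>support y. y u' * word_image u' K)"
    by (simp add: Phi_def lin_ext_def)
  also have "\<dots> = (\<Sum>u'\<in>support y. if u' = u then y u' else 0)"
    using image by (intro sum.cong HOL.refl) auto
  also have "\<dots> = y u"
    using \<open>y u \<noteq> 0\<close> y by (simp add: sum.delta finsupp_def)
  finally show False
    using zero \<open>y u \<noteq> 0\<close> by simp
qed

text \<open>
  Modulo the ideal every element is a combination of ordered monomials, on which the homomorphism is
  injective.
\<close>
lemma kernel_Phi: "a_kernel F.alg H.alg Phi = I"
proof
  show "a_kernel F.alg H.alg Phi \<subseteq> I"
  proof
    fix x assume "x \<in> a_kernel F.alg H.alg Phi"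
    then have x: "x \<in> finsupp words" "Phi x = 0"
      by (simp_all add: a_kernel_def' F.carrier_alg del: structure_algebra_sel(1))
    obtain y where y: "y \<in> finsupp (normal_word ` iso_classes)" "x - y \<in> I"
      using all_reducible[OF x(1)] unfolding reducible_def by blast
    have y_words: "y \<in> finsupp words"
      using y(1) normal_word_in unfolding finsupp_def by blast
    have "Phi (x - y) = 0"
      using I_kernel y(2) by (auto simp: a_kernel_def')
    then have "Phi y = 0"
      using x Phi_linear(2)[OF x(1) y_words] by simp
    then have "y = 0"
      by (rule Phi_normal_injective[OF y(1)])
    with y(2) show "x \<in> I"
      by simp
  qed
qed (rule I_kernel)

lemma Phi_sum:
  "(\<And>i. i \<in> J \<Longrightarrow> f i \<in> finsupp words) \<Longrightarrow> Phi (\<Sum>i\<in>J. f i) = (\<Sum>i\<in>J. Phi (f i))"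
  by (induction J rule: infinite_finite_induct) (auto simp: Phi_linear finsupp_sum, simp_all add: Phi_def)

lemma Phi_surjective: "Phi ` finsupp words = finsupp iso_classes"
proof
  show "finsupp iso_classes \<subseteq> Phi ` finsupp words"
  proof
    fix x :: "obj set \<Rightarrow> 'k" assume x: "x \<in> finsupp iso_classes"
    let ?y = "\<Sum>K\<in>support x. scale (x K) (word (normal_word K))"
    have in_words: "scale a (word (normal_word K)) \<in> finsupp words" if "K \<in> support x" for K a
      using x that by (intro finsupp_scale word_in normal_word_in) (auto simp: finsupp_def)
    have "Phi ?y = (\<Sum>K\<in>support x. Phi (scale (x K) (word (normal_word K))))"
      by (rule Phi_sum[OF in_words])
    also have "\<dots> = (\<Sum>K\<in>support x. scale (x K) (basis_vec K))"
      using x by (intro sum.cong HOL.refl)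
        (auto simp: Phi_linear(3) word_in normal_word_in word_image_normal finsupp_def
          simp del: in_lists_conv_set)
    also have "\<dots> = x"
      by (rule finsupp_expand[OF x, symmetric])
    finally have eq: "Phi ?y = x" .
    have "?y \<in> finsupp words"
      by (rule finsupp_sum[OF in_words])
    then have "Phi ?y \<in> Phi ` finsupp words"
      by (rule imageI)
    then show "x \<in> Phi ` finsupp words"
      unfolding eq .
  qed
qed (use Phi_in in blast)

lemma quotient_algebra_sel [simp]:
  "carrier (quotient_algebra A J) = carrier (A Quot J)" "mult (quotient_algebra A J) = mult (A Quot J)"
  "one (quotient_algebra A J) = one (A Quot J)" "add (quotient_algebra A J) = add (A Quot J)"
  "smult (quotient_algebra A J) = (\<lambda>c X. \<Union>x\<in>X. J +>\<^bsub>A\<^esub> (c \<odot>\<^bsub>A\<^esub> x))"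
  by (simp_all add: quotient_algebra_def)

text \<open>
  The isomorphism is inverse to the one that the homomorphism theorem provides. It sends the image of
  \<open>a\<close> to the coset of \<open>a\<close>, from which compatibility with scalars follows.
\<close>
theorem hall_algebra_iso_enveloping:
  "\<exists>\<psi>. \<psi> \<in> algebra_iso (hall_algebra \<Gamma> :: ('k, obj set \<Rightarrow> 'k) module)
     (universal_enveloping (sl_positive_part (n + 1)))"
proof -
  interpret hom: ring_hom_ring F.alg H.alg Phi
    by (rule Phi_ring_hom)
  let ?U = "quotient_algebra F.alg I"
  have U: "universal_enveloping (sl_positive_part (n + 1)) = ?U"
    unfolding universal_enveloping_def Let_def I_def strict_upper_def[symmetric] F.free_algebra_eq ..
  define \<theta> where "\<theta> = (\<lambda>X. the_elem (Phi ` X))"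
  have \<theta>: "\<theta> \<in> ring_iso (F.alg Quot I) H.alg"
    unfolding \<theta>_def using hom.FactRing_iso_set Phi_surjective
    by (simp add: kernel_Phi F.carrier_alg H.carrier_alg del: structure_algebra_sel(1))
  interpret I: ideal I F.alg
    by (rule ideal_I)
  have Qring: "ring (F.alg Quot I)"
    by (rule I.quotient_is_ring)
  define \<psi> where "\<psi> = inv_into (carrier (F.alg Quot I)) \<theta>"
  have \<psi>: "\<psi> \<in> ring_iso H.alg (F.alg Quot I)"
    unfolding \<psi>_def by (rule ring_iso_set_sym[OF Qring \<theta>])
  have \<psi>_Phi: "\<psi> (Phi a) = I +>\<^bsub>F.alg\<^esub> a" if a: "a \<in> finsupp words" for a
  proof -
    have mem: "I +>\<^bsub>F.alg\<^esub> a \<in> carrier (F.alg Quot I)"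
      using a by (auto simp: FactRing_def A_RCOSETS_def' F.carrier_alg simp del: structure_algebra_sel(1))
    have eq: "\<theta> (I +>\<^bsub>F.alg\<^esub> a) = Phi a"
      unfolding \<theta>_def using hom.the_elem_simp[of a] a
      by (simp add: kernel_Phi F.carrier_alg del: structure_algebra_sel(1))
    have inj: "inj_on \<theta> (carrier (F.alg Quot I))"
      using \<theta> by (simp add: ring_iso_def bij_betw_def)
    show ?thesis
      unfolding \<psi>_def eq[symmetric] by (rule inv_into_f_f[OF inj mem])
  qed
  have coset_eq: "I +>\<^bsub>F.alg\<^esub> z = I +>\<^bsub>F.alg\<^esub> a" if "a \<in> finsupp words" "z \<in> finsupp words" "Phi z = Phi a" for a z
    using \<psi>_Phi[OF that(1)] \<psi>_Phi[OF that(2)] that(3) by simp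
  have coset: "z \<in> finsupp words \<and> Phi z = Phi a" if a: "a \<in> finsupp words" and z: "z \<in> I +>\<^bsub>F.alg\<^esub> a" for a z
  proof -
    obtain b where b: "b \<in> I" "z = b + a"
      using z by (auto simp: a_r_coset_def')
    have "b \<in> a_kernel F.alg H.alg Phi"
      using I_kernel b(1) by blast
    then have "Phi b = 0"
      unfolding a_kernel_def' structure_algebra_sel(3) by blast
    moreover have "b \<in> finsupp words"
      using I_subset b(1) by blast
    ultimately show ?thesis
      using b(2) a by (simp add: finsupp_add Phi_linear)
  qed
  have "\<psi> (a \<odot>\<^bsub>H.alg\<^esub> x) = a \<odot>\<^bsub>?U\<^esub> \<psi> x" if x: "x \<in> carrier H.alg" for a x
  proof -
    obtain y where y: "y \<in> finsupp words" "x = Phi y"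
      using x Phi_surjective unfolding H.carrier_alg by blast
    have left: "\<psi> (scale a x) = I +>\<^bsub>F.alg\<^esub> scale a y"
      using \<psi>_Phi[OF finsupp_scale[OF y(1)]] y Phi_linear(3) by simp
    have "I +>\<^bsub>F.alg\<^esub> scale a z = I +>\<^bsub>F.alg\<^esub> scale a y" if "z \<in> \<psi> x" for z
      using coset[OF y(1)] that y \<psi>_Phi[OF y(1)]
      by (intro coset_eq finsupp_scale) (simp_all add: Phi_linear)
    then have "(\<Union>z\<in>\<psi> x. I +>\<^bsub>F.alg\<^esub> scale a z) = (\<Union>z\<in>\<psi> x. I +>\<^bsub>F.alg\<^esub> scale a y)"
      by (rule SUP_cong[OF HOL.refl])
    moreover have "y \<in> \<psi> x"
      using y \<psi>_Phi[OF y(1)] I.a_rcos_self by (simp add: F.carrier_alg del: structure_algebra_sel(1))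
    ultimately have "(\<Union>z\<in>\<psi> x. I +>\<^bsub>F.alg\<^esub> scale a z) = I +>\<^bsub>F.alg\<^esub> scale a y"
      by (simp only: UN_constant empty_iff if_False split: if_split) blast
    with left show ?thesis
      by (simp only: quotient_algebra_sel structure_algebra_sel)
  qed
  moreover have "\<psi> \<in> ring_iso H.alg ?U"
    using \<psi> by (simp add: ring_iso_def Ring.ring_hom_def del: structure_algebra_sel)
  ultimately have "\<psi> \<in> algebra_iso H.alg ?U"
    by (simp add: algebra_iso_def)
  then show ?thesis
    unfolding U hall_algebra_eq by blast
qed

end

lemma geo_form_sym:
  assumes "\<And>i j. coxeter_matrix W s i j = coxeter_matrix W s j i"
  shows "geo_form W s v w = geo_form W s w v"
  unfolding geo_form_def by (subst sum.swap) (simp add: assms mult.commute mult.left_commute)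

text \<open>
  Opposite arrows between two vertices are impossible because the form is symmetric and the factor
  \<open>i - j\<close> changes its sign.
\<close>
lemma root_quiver_line:
  assumes "weyl_type_A m (Wgrp X) (srefl X)" and "dynkin_quiver_A n (root_quiver X)"
  obtains \<tau> where "line_quiver (root_quiver X) n \<tau>"
proof -
  obtain \<tau> where \<tau>: "bij_betw \<tau> (vertices (root_quiver X)) {1..n}"
    "\<forall>i\<in>vertices (root_quiver X). \<forall>j\<in>vertices (root_quiver X).
       (i, j) \<in> arrows (root_quiver X) \<or> (j, i) \<in> arrows (root_quiver X) \<longleftrightarrow> adjacent_A (\<tau> i) (\<tau> j)"
    using assms(2) unfolding dynkin_quiver_A_def by blast
  have "coxeter_matrix (Wgrp X) (srefl X) i j = coxeter_matrix (Wgrp X) (srefl X) j i" for i j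
    using assms(1) unfolding weyl_type_A_def adjacent_A_def by auto
  from geo_form_sym[OF this] have sym: "geo_form (Wgrp X) (srefl X) v w = geo_form (Wgrp X) (srefl X) w v" for v w .
  have "line_quiver (root_quiver X) n \<tau>"
  proof
    show "(j, i) \<notin> arrows (root_quiver X)" if "(i, j) \<in> arrows (root_quiver X)" for i j
    proof -
      have "(real j - real i) * x = - ((real i - real j) * x)" for x
        by (simp add: algebra_simps)
      then show ?thesis
        using that sym[of "root_fun X i" "root_fun X j"] by (simp add: root_quiver_def)
    qed
    show "wf_quiver (root_quiver X)"
      by (auto simp: wf_quiver_def root_quiver_def)
  qed (use \<tau> in auto)
  then show thesis using that by blast
qed

theorem corollary3p31:
  fixes X :: "('g, 'n::finite) quadruple" and n :: nat
  assumes "X \<in> objects_D"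
    and "weyl_type_A n (Wgrp X) (srefl X)"
    and "dynkin_quiver_A n (root_quiver X)"
  shows "\<exists>\<psi>. \<psi> \<in> algebra_iso
           (hall_algebra (root_quiver X) :: ('k::field_char_0, obj set \<Rightarrow> 'k) module)
           (universal_enveloping (sl_positive_part (n + 1)))"
proof -
  obtain \<tau> where "line_quiver (root_quiver X) n \<tau>"
    using assms(2,3) by (rule root_quiver_line)
  then interpret hall_enveloping "root_quiver X" n \<tau> "TYPE('k)"
    by (rule hall_enveloping.intro)
  show ?thesis
    by (rule hall_algebra_iso_enveloping)
qed

end
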